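(* In the metric of $\mathbb{H}(\mathbb{H}(\mathbb{X}))$, $$\lim_{V\to\infty}\mathfrak{H}_{V,1}=\mathfrak{H}.$$ Moreover, if for each $V$ the probabilities satisfy $\mathcal{P}^{a}=\dfrac{P_{n_1}P_{n_2}\cdots P_{n_V}}{V^{MV}}$ for every $a\in\mathcal{A}$, then in the metric of $\mathbb{P}(\mathbb{H}(\mathbb{X}))$ $$\lim_{V\to\infty}\mathfrak{P}_{V,1}=\mathfrak{P}.$$
   Context: Spaces and metrics. For a compact metric space $Y$: $\mathbb{H}(Y)$ is the set of non-empty compact subsets of $Y$ with the Hausdorff metric; $\mathbb{P}(Y)$ is the set of Borel probability measures on $Y$ with the Monge–Kantorovitch metric $d(\mu,\nu)=\sup\{\int f\,d\mu-\int f\,d\nu\}$ over $f:Y\to\mathbb{R}$ with Lipschitz constant at most $1$. IFS. An IFS (with probabilities) on a compact metric space $Y$ is a finite family of contraction maps $g_a:Y\to Y$ together with probabilities $p_a\ge 0$, $\sum_a p_a=1$. Its set attractor is the unique non-empty compact $A\subset Y$ with $A=\bigcup_a g_a(A)$; its measure attractor is the unique Borel probability measure $\mu$ on $Y$ with $\mu=\sum_a p_a\, g_a(\mu)$, where $g(\mu)=\mu\circ g^{-1}$. SuperIFS. $(\mathbb{X},d)$ is a compact metric space; $M,N,V$ are positive integers. For $n\in\{1,\dots,N\}$, $m\in\{1,\dots,M\}$, $f_m^n:\mathbb{X}\to\mathbb{X}$ is Lipschitz with constant $l$, where $0\le l<1$ is fixed. $P_1,\dots,P_N>0$ with $\sum_nP_n=1$.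 Random fractal sets. $T$ is the set of all finite sequences over $\{1,\dots,M\}$, including the empty sequence $\emptyset$. $\Omega$ is the set of all functions (code trees) $\sigma:T\to\{1,\dots,N\}$. $\rho$ is the probability measure on $\Omega$ (on the $\sigma$-algebra generated by cylinder sets) under which the random variables $\sigma(i)$, $i\in T$, are i.i.d. with $\Pr(\sigma(i)=n)=P_n$. For $\sigma\in\Omega$, $$\mathcal{F}(\sigma)=\lim_{k\to\infty}\ \bigcup_{i=i_1\cdots i_k\in T}f_{i_1}^{\sigma(\emptyset)}\circ f_{i_2}^{\sigma(i_1)}\circ\cdots\circ f_{i_k}^{\sigma(i_1i_2\cdots i_{k-1})}(K),$$ the limit existing in the Hausdorff metric and being independent of $K\in\mathbb{H}(\mathbb{X})$. $\mathfrak{H}=\{\mathcal{F}(\sigma):\sigma\in\Omega\}$ is the set of fractal sets associated with the superIFS, and $\mathfrak{P}=\rho\circ\mathcal{F}^{-1}$ is the corresponding distribution. $V$-variable fractal sets. Write $\mathbb{H}=\mathbb{H}(\mathbb{X})$; $\mathbb{H}^V$ carries the maximum metric. $\mathcal{A}=\{\{1,\dots,N\}\times\{1,\dots,V\}^M\}^V$; write $a=(a_1,\dots,a_V)\in\mathcal{A}$ with $a_v=(n_v;v_{v,1},\dots,v_{v,M})$. $\{\mathcal{P}^a\}_{a\in\mathcal{A}}$ are probabilities. For $a\in\mathcal{A}$ define $f^a:\mathbb{H}^V\to\mathbb{H}^V$ by letting the $v$-th component of $f^a(K_1,\dots,K_V)$ be $\bigcup_{m=1}^M f_m^{n_v}(K_{v_{v,m}})$.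 $\mathcal{F}_V=\{\mathbb{H}^V;f^a,\mathcal{P}^a,a\in\mathcal{A}\}$ is an IFS of contractions with set attractor $\mathfrak{H}_V$ and measure attractor $\mathfrak{P}_V$. $\mathfrak{H}_{V,1}\subset\mathbb{H}$ is the set of first components of elements of $\mathfrak{H}_V$, and $\mathfrak{P}_{V,1}(B)=\mathfrak{P}_V(B\times\mathbb{H}\times\cdots\times\mathbb{H})$ for Borel $B\subset\mathbb{H}$. *)

theory Defs
  imports "HOL-Probability.Probability"
begin

section \<open>Lipschitz maps\<close>

definition lipschitz_map :: "real \<Rightarrow> 'a metric \<Rightarrow> 'b metric \<Rightarrow> ('a \<Rightarrow> 'b) \<Rightarrow> bool"
  where "lipschitz_map L Y Z g \<longleftrightarrow>
    g \<in> mspace Y \<rightarrow> mspace Z \<and>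
    (\<forall>x\<in>mspace Y. \<forall>y\<in>mspace Y. mdist Z (g x) (g y) \<le> L * mdist Y x y)"


section \<open>The Hausdorff metric\<close>

definition hyperspace :: "'a metric \<Rightarrow> 'a set set"
  where "hyperspace Y = {K. K \<noteq> {} \<and> compactin (mtopology_of Y) K}"

text \<open>
  The axioms of \<^locale>\<open>Metric_space\<close> include non-negativity and symmetry outside the carrier,
  hence the value \<open>0\<close> there.
\<close>

definition hausdorff_dist :: "'a metric \<Rightarrow> 'a set \<Rightarrow> 'a set \<Rightarrow> real"
  where "hausdorff_dist Y A B =
    (if A \<in> hyperspace Y \<and> B \<in> hyperspace Y
     then max (SUP a\<in>A. INF b\<in>B. mdist Y a b) (SUP b\<in>B. INF a\<in>A. mdist Y b a)
     else 0)"

definition hyper :: "'a metric \<Rightarrow> 'a set metric"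
  where "hyper Y = metric (hyperspace Y, hausdorff_dist Y)"

context
  fixes Y :: "'a metric"
begin

interpretation Y: Metric_space "mspace Y" "mdist Y"
  by simp

lemma hyperspace_subset: "A \<in> hyperspace Y \<Longrightarrow> A \<subseteq> mspace Y"
  using compactin_subset_topspace[of "mtopology_of Y" A] by (simp add: hyperspace_def)

lemma hyperspace_bound:
  assumes "A \<in> hyperspace Y" "B \<in> hyperspace Y"
  obtains r where "\<And>a b. a \<in> A \<Longrightarrow> b \<in> B \<Longrightarrow> mdist Y a b \<le> r"
proof -
  have "Y.mbounded (A \<union> B)"
    using assms Y.compactin_imp_mbounded
    by (simp add: hyperspace_def mtopology_of_def Y.mbounded_Un)
  then show ?thesis
    using that by (meson UnCI Y.mbounded_alt)
qed

lemma hausdorff_dist_commute: "hausdorff_dist Y A B = hausdorff_dist Y B A"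
  unfolding hausdorff_dist_def by (subst max.commute) (subst conj_commute, rule refl)

lemma INF_mdist_le: "b \<in> B \<Longrightarrow> (INF b\<in>B. mdist Y a b) \<le> mdist Y a b"
  by (rule cINF_lower) (auto intro!: bdd_belowI[where m = 0])

lemma INF_mdist_nonneg: "B \<noteq> {} \<Longrightarrow> 0 \<le> (INF b\<in>B. mdist Y a b)"
  by (rule cINF_greatest) auto

lemma INF_mdist_le_hausdorff_dist:
  assumes A: "A \<in> hyperspace Y" and B: "B \<in> hyperspace Y" and a: "a \<in> A"
  shows "(INF b\<in>B. mdist Y a b) \<le> hausdorff_dist Y A B"
proof -
  obtain r where r: "\<And>a b. a \<in> A \<Longrightarrow> b \<in> B \<Longrightarrow> mdist Y a b \<le> r"
    using hyperspace_bound[OF A B] by blast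
  obtain b where b: "b \<in> B"
    using B by (auto simp: hyperspace_def)
  have "bdd_above ((\<lambda>a. INF b\<in>B. mdist Y a b) ` A)"
    by (rule bdd_aboveI2[where M = r]) (rule order_trans[OF INF_mdist_le[OF b] r[OF _ b]])
  then have "(INF b\<in>B. mdist Y a b) \<le> (SUP a\<in>A. INF b\<in>B. mdist Y a b)"
    by (rule cSUP_upper[OF a])
  then show ?thesis
    using A B by (simp add: hausdorff_dist_def)
qed

lemma hausdorff_dist_le:
  assumes A: "A \<in> hyperspace Y" and B: "B \<in> hyperspace Y"
    and 1: "\<And>a. a \<in> A \<Longrightarrow> (INF b\<in>B. mdist Y a b) \<le> r"
    and 2: "\<And>b. b \<in> B \<Longrightarrow> (INF a\<in>A. mdist Y b a) \<le> r"
  shows "hausdorff_dist Y A B \<le> r"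
proof -
  have "(SUP a\<in>A. INF b\<in>B. mdist Y a b) \<le> r"
    using A 1 by (intro cSUP_least) (auto simp: hyperspace_def)
  moreover have "(SUP b\<in>B. INF a\<in>A. mdist Y b a) \<le> r"
    using B 2 by (intro cSUP_least) (auto simp: hyperspace_def)
  ultimately show ?thesis
    using A B by (simp add: hausdorff_dist_def)
qed

lemma hausdorff_dist_nonneg: "0 \<le> hausdorff_dist Y A B"
proof (cases "A \<in> hyperspace Y \<and> B \<in> hyperspace Y")
  case True
  then obtain a where "a \<in> A" "B \<noteq> {}"
    by (auto simp: hyperspace_def)
  then show ?thesis
    using INF_mdist_le_hausdorff_dist[of A B a] INF_mdist_nonneg[of B a] True by linarith
qed (auto simp: hausdorff_dist_def)

lemma hausdorff_dist_near:
  assumes "A \<in> hyperspace Y" "B \<in> hyperspace Y" "a \<in> A" "0 < e"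
  obtains b where "b \<in> B" "mdist Y a b < hausdorff_dist Y A B + e"
proof -
  have "(INF b\<in>B. mdist Y a b) < hausdorff_dist Y A B + e"
    using INF_mdist_le_hausdorff_dist[OF assms(1-3)] assms(4) by linarith
  then show ?thesis
    using that assms(2)
    by (subst (asm) cINF_less_iff) (auto simp: hyperspace_def intro!: bdd_belowI[where m = 0])
qed

lemma hausdorff_dist_triangle_aux:
  assumes A: "A \<in> hyperspace Y" and B: "B \<in> hyperspace Y" and C: "C \<in> hyperspace Y"
    and a: "a \<in> A"
  shows "(INF c\<in>C. mdist Y a c) \<le> hausdorff_dist Y A B + hausdorff_dist Y B C"
proof (rule field_le_epsilon)
  fix e :: real
  assume e: "0 < e"
  obtain b where b: "b \<in> B" "mdist Y a b < hausdorff_dist Y A B + e/2"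
    using hausdorff_dist_near[OF A B a, of "e/2"] e by auto
  obtain c where c: "c \<in> C" "mdist Y b c < hausdorff_dist Y B C + e/2"
    using hausdorff_dist_near[OF B C b(1), of "e/2"] e by auto
  have "mdist Y a c \<le> mdist Y a b + mdist Y b c"
    using a b c A B C hyperspace_subset by (intro mdist_triangle) blast+
  with INF_mdist_le[OF c(1), of a] b(2) c(2)
  show "(INF c\<in>C. mdist Y a c) \<le> hausdorff_dist Y A B + hausdorff_dist Y B C + e"
    by linarith
qed

lemma hausdorff_dist_zero_imp_subset:
  assumes A: "A \<in> hyperspace Y" and B: "B \<in> hyperspace Y" and 0: "hausdorff_dist Y A B = 0"
  shows "A \<subseteq> B"
proof
  fix a assume a: "a \<in> A"
  have "closedin Y.mtopology B"
    using B by (auto simp: hyperspace_def mtopology_of_def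
        intro: compactin_imp_closedin Y.Hausdorff_space_mtopology)
  moreover have "a \<in> Y.mtopology closure_of B"
    using hausdorff_dist_near[OF A B a] 0 a A B hyperspace_subset
    unfolding Y.metric_closure_of by (auto simp: subset_iff) metis
  ultimately show "a \<in> B"
    by (simp add: closure_of_closedin)
qed

lemma Metric_space_hyper: "Metric_space (hyperspace Y) (hausdorff_dist Y)"
proof
  fix A B C assume A: "A \<in> hyperspace Y" and B: "B \<in> hyperspace Y"
  show "hausdorff_dist Y A B = 0 \<longleftrightarrow> A = B"
  proof
    assume "hausdorff_dist Y A B = 0"
    then show "A = B"
      using hausdorff_dist_zero_imp_subset[OF A B] hausdorff_dist_zero_imp_subset[OF B A]
      by (simp add: hausdorff_dist_commute)
  next
    assume [simp]: "A = B"
    have "(INF b\<in>A. mdist Y a b) \<le> 0" if "a \<in> A" for a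
      using INF_mdist_le[OF that, of a] hyperspace_subset[OF A] that by auto
    then have "hausdorff_dist Y A A \<le> 0"
      by (intro hausdorff_dist_le A)
    then show "hausdorff_dist Y A B = 0"
      using hausdorff_dist_nonneg[of A B] by simp
  qed
  assume C: "C \<in> hyperspace Y"
  show "hausdorff_dist Y A C \<le> hausdorff_dist Y A B + hausdorff_dist Y B C"
    using hausdorff_dist_triangle_aux[OF A B C] hausdorff_dist_triangle_aux[OF C B A]
    by (intro hausdorff_dist_le A C) (auto simp: hausdorff_dist_commute add.commute)
qed (auto simp: hausdorff_dist_nonneg hausdorff_dist_commute)

end

lemma mspace_hyper: "mspace (hyper Y) = hyperspace Y"
  unfolding hyper_def by (rule Metric_space.mspace_metric[OF Metric_space_hyper])

lemma mdist_hyper: "mdist (hyper Y) = hausdorff_dist Y"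
  unfolding hyper_def by (rule Metric_space.mdist_metric[OF Metric_space_hyper])


section \<open>Finite powers with the maximum metric\<close>

text \<open>A \<open>V\<close>-tuple is a function that is \<^const>\<open>undefined\<close> outside \<open>{1..V}\<close>.\<close>

definition max_dist :: "nat \<Rightarrow> 'a metric \<Rightarrow> (nat \<Rightarrow> 'a) \<Rightarrow> (nat \<Rightarrow> 'a) \<Rightarrow> real"
  where "max_dist V Y x y = Max (insert 0 ((\<lambda>v. mdist Y (x v) (y v)) ` {1..V}))"

definition power_metric :: "nat \<Rightarrow> 'a metric \<Rightarrow> (nat \<Rightarrow> 'a) metric"
  where "power_metric V Y = metric ({1..V} \<rightarrow>\<^sub>E mspace Y, max_dist V Y)"

lemma max_dist_le_iff:
  "max_dist V Y x y \<le> r \<longleftrightarrow> 0 \<le> r \<and> (\<forall>v\<in>{1..V}. mdist Y (x v) (y v) \<le> r)"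
  unfolding max_dist_def by (subst Max_le_iff) auto

lemma max_dist_nonneg: "0 \<le> max_dist V Y x y"
  unfolding max_dist_def by (rule Max_ge) auto

lemma mdist_le_max_dist: "v \<in> {1..V} \<Longrightarrow> mdist Y (x v) (y v) \<le> max_dist V Y x y"
  unfolding max_dist_def by (rule Max_ge) auto

lemma Metric_space_power: "Metric_space ({1..V} \<rightarrow>\<^sub>E mspace Y) (max_dist V Y)"
proof
  fix x y z assume x: "x \<in> {1..V} \<rightarrow>\<^sub>E mspace Y" and y: "y \<in> {1..V} \<rightarrow>\<^sub>E mspace Y"
  have "max_dist V Y x y = 0 \<longleftrightarrow> max_dist V Y x y \<le> 0"
    using max_dist_nonneg[of V Y x y] by linarith
  also have "\<dots> \<longleftrightarrow> (\<forall>v\<in>{1..V}. mdist Y (x v) (y v) = 0)"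
    by (simp add: max_dist_le_iff order_antisym_conv[OF mdist_nonneg])
  also have "\<dots> \<longleftrightarrow> (\<forall>v\<in>{1..V}. x v = y v)"
    using x y by (intro ball_cong refl mdist_zero) (auto simp: PiE_iff)
  also have "\<dots> \<longleftrightarrow> x = y"
    by (auto intro: PiE_ext[OF x y])
  finally show "max_dist V Y x y = 0 \<longleftrightarrow> x = y" .
  assume z: "z \<in> {1..V} \<rightarrow>\<^sub>E mspace Y"
  have "mdist Y (x v) (z v) \<le> max_dist V Y x y + max_dist V Y y z" if v: "v \<in> {1..V}" for v
  proof -
    have "mdist Y (x v) (z v) \<le> mdist Y (x v) (y v) + mdist Y (y v) (z v)"
      using x y z v by (intro mdist_triangle) (auto simp: PiE_iff)
    then show ?thesis
      using mdist_le_max_dist[OF v, of Y x y] mdist_le_max_dist[OF v, of Y y z] by linarith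
  qed
  then show "max_dist V Y x z \<le> max_dist V Y x y + max_dist V Y y z"
    by (simp add: max_dist_le_iff max_dist_nonneg)
next
  show "0 \<le> max_dist V Y x y" for x y by (rule max_dist_nonneg)
  show "max_dist V Y x y = max_dist V Y y x" for x y
    by (simp only: max_dist_def mdist_commute)
qed

lemma mspace_power_metric: "mspace (power_metric V Y) = {1..V} \<rightarrow>\<^sub>E mspace Y"
  unfolding power_metric_def by (rule Metric_space.mspace_metric[OF Metric_space_power])

lemma mdist_power_metric: "mdist (power_metric V Y) = max_dist V Y"
  unfolding power_metric_def by (rule Metric_space.mdist_metric[OF Metric_space_power])


section \<open>The Monge--Kantorovitch metric\<close>

definition metric_borel :: "'a metric \<Rightarrow> 'a measure"
  where "metric_borel Y = sigma (mspace Y) {U. openin (mtopology_of Y) U}"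

definition borel_probs :: "'a metric \<Rightarrow> 'a measure set"
  where "borel_probs Y = {\<mu>. prob_space \<mu> \<and> sets \<mu> = sets (metric_borel Y)}"

definition mk_dist :: "'a metric \<Rightarrow> 'a measure \<Rightarrow> 'a measure \<Rightarrow> real"
  where "mk_dist Y \<mu> \<nu> =
    (if \<mu> \<in> borel_probs Y \<and> \<nu> \<in> borel_probs Y
     then SUP f\<in>{f. lipschitz_map 1 Y euclidean_metric f}. (\<integral>x. f x \<partial>\<mu>) - (\<integral>x. f x \<partial>\<nu>)
     else 0)"

text \<open>This is a metric when \<open>Y\<close> is compact; see \<open>Metric_space_prob\<close> below.\<close>

definition prob_metric :: "'a metric \<Rightarrow> 'a measure metric"
  where "prob_metric Y = metric (borel_probs Y, mk_dist Y)"

lemma space_metric_borel [simp]: "space (metric_borel Y) = mspace Y"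
  unfolding metric_borel_def
  by (rule space_measure_of) (use openin_subset[of "mtopology_of Y"] in auto)

lemma sets_metric_borel: "sets (metric_borel Y) = sigma_sets (mspace Y) {U. openin (mtopology_of Y) U}"
  unfolding metric_borel_def
  by (rule sets_measure_of) (use openin_subset[of "mtopology_of Y"] in auto)

lemma lipschitz_map_imp_continuous:
  assumes "lipschitz_map L Y Z g"
  shows "continuous_map (mtopology_of Y) (mtopology_of Z) g"
proof -
  have "Lipschitz_continuous_map Y Z g"
    using assms unfolding lipschitz_map_def Lipschitz_continuous_map_def by (intro conjI exI[of _ L]) simp_all
  then show ?thesis
    using Lipschitz_continuous_imp_continuous_map by blast
qed

lemma lipschitz_map_borel_measurable:
  fixes g :: "'a \<Rightarrow> real"
  assumes "lipschitz_map L Y euclidean_metric g"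
  shows "g \<in> borel_measurable (metric_borel Y)"
proof (rule borel_measurableI)
  fix S :: "real set" assume "open S"
  have "continuous_map (mtopology_of Y) euclidean g"
    using lipschitz_map_imp_continuous[OF assms] by simp
  then have "openin (mtopology_of Y) {x \<in> topspace (mtopology_of Y). g x \<in> S}"
    by (rule openin_continuous_map_preimage) (use \<open>open S\<close> in simp)
  moreover have "g -` S \<inter> space (metric_borel Y) = {x \<in> topspace (mtopology_of Y). g x \<in> S}"
    by auto
  ultimately show "g -` S \<inter> space (metric_borel Y) \<in> sets (metric_borel Y)"
    by (simp add: sets_metric_borel sigma_sets.Basic)
qed

lemma borel_probsD:
  assumes "\<mu> \<in> borel_probs Y"
  shows "prob_space \<mu>" "sets \<mu> = sets (metric_borel Y)" "space \<mu> = mspace Y"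
  using assms sets_eq_imp_space_eq[of \<mu> "metric_borel Y"] by (auto simp: borel_probs_def)

lemma lipschitz_map_scale:
  fixes g :: "'a \<Rightarrow> real"
  assumes "lipschitz_map L Y euclidean_metric g"
  shows "lipschitz_map (\<bar>c\<bar> * L) Y euclidean_metric (\<lambda>x. c * g x)"
  unfolding lipschitz_map_def
proof (intro conjI ballI)
  fix x y assume xy: "x \<in> mspace Y" "y \<in> mspace Y"
  have "dist (g x) (g y) \<le> L * mdist Y x y"
    using assms xy by (simp add: lipschitz_map_def)
  then have "\<bar>c\<bar> * dist (g x) (g y) \<le> \<bar>c\<bar> * (L * mdist Y x y)"
    by (rule mult_left_mono) simp
  moreover have "\<bar>c\<bar> * dist (g x) (g y) = dist (c * g x) (c * g y)"
    unfolding dist_real_def abs_mult[symmetric] right_diff_distrib ..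
  ultimately show "mdist euclidean_metric (c * g x) (c * g y) \<le> \<bar>c\<bar> * L * mdist Y x y"
    by (simp add: mult.assoc)
qed simp

context
  fixes Y :: "'a metric"
  assumes compact: "compact_space (mtopology_of Y)"
begin

interpretation Y: Metric_space "mspace Y" "mdist Y"
  by simp

lemma compact_diameter:
  obtains D where "0 \<le> D" "\<And>x y. x \<in> mspace Y \<Longrightarrow> y \<in> mspace Y \<Longrightarrow> mdist Y x y \<le> D"
proof -
  have "Y.mbounded (mspace Y)"
    using compact Y.compactin_imp_mbounded[of "mspace Y"]
    by (simp add: compact_space_def mtopology_of_def)
  then obtain D where "\<And>x y. x \<in> mspace Y \<Longrightarrow> y \<in> mspace Y \<Longrightarrow> mdist Y x y \<le> D"
    by (meson Y.mbounded_alt)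
  then show ?thesis
    using that[of "max 0 D"] by (meson max.cobounded1 max.cobounded2 order_trans)
qed

lemma lipschitz_map_integrable:
  fixes g :: "'a \<Rightarrow> real"
  assumes g: "lipschitz_map L Y euclidean_metric g" and \<mu>: "\<mu> \<in> borel_probs Y"
  shows "integrable \<mu> g"
proof -
  interpret prob_space \<mu> by (rule borel_probsD[OF \<mu>])
  obtain x0 where x0: "x0 \<in> mspace Y"
    using not_empty borel_probsD[OF \<mu>] by auto
  obtain D where D: "0 \<le> D" "\<And>x y. x \<in> mspace Y \<Longrightarrow> y \<in> mspace Y \<Longrightarrow> mdist Y x y \<le> D"
    by (rule compact_diameter) blast
  show ?thesis
  proof (rule integrable_const_bound)
    have "norm (g x) \<le> \<bar>g x0\<bar> + \<bar>L\<bar> * D" if x: "x \<in> mspace Y" for x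
    proof -
      have "\<bar>g x - g x0\<bar> \<le> L * mdist Y x x0"
        using g x x0 by (auto simp: lipschitz_map_def dist_real_def)
      also have "\<dots> \<le> \<bar>L\<bar> * D"
        using D x x0 by (intro mult_mono) auto
      finally show ?thesis by simp
    qed
    then show "AE x in \<mu>. norm (g x) \<le> \<bar>g x0\<bar> + \<bar>L\<bar> * D"
      by (intro AE_I2) (simp add: borel_probsD[OF \<mu>])
    show "g \<in> borel_measurable \<mu>"
      using lipschitz_map_borel_measurable[OF g] measurable_cong_sets[OF borel_probsD(2)[OF \<mu>] refl]
      by blast
  qed
qed

lemma mk_dist_bdd_above:
  assumes \<mu>: "\<mu> \<in> borel_probs Y" and \<nu>: "\<nu> \<in> borel_probs Y"
  shows "bdd_above ((\<lambda>f :: 'a \<Rightarrow> real. (\<integral>x. f x \<partial>\<mu>) - (\<integral>x. f x \<partial>\<nu>)) ` {f. lipschitz_map 1 Y euclidean_metric f})"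
proof -
  interpret \<mu>: prob_space \<mu> by (rule borel_probsD[OF \<mu>])
  interpret \<nu>: prob_space \<nu> by (rule borel_probsD[OF \<nu>])
  obtain x0 where x0: "x0 \<in> mspace Y"
    using \<mu>.not_empty borel_probsD[OF \<mu>] by auto
  obtain D where D: "0 \<le> D" "\<And>x y. x \<in> mspace Y \<Longrightarrow> y \<in> mspace Y \<Longrightarrow> mdist Y x y \<le> D"
    by (rule compact_diameter) blast
  show ?thesis
  proof (rule bdd_aboveI2[where M = "2 * D"])
    fix f :: "'a \<Rightarrow> real" assume "f \<in> {f. lipschitz_map 1 Y euclidean_metric f}"
    then have f: "lipschitz_map 1 Y euclidean_metric f" by simp
    have b: "f x0 - D \<le> f x \<and> f x \<le> f x0 + D" if x: "x \<in> mspace Y" for x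
    proof -
      have "\<bar>f x - f x0\<bar> \<le> mdist Y x x0"
        using f x x0 by (auto simp: lipschitz_map_def dist_real_def)
      also have "\<dots> \<le> D" using D x x0 by auto
      finally show ?thesis by (auto simp: abs_le_iff)
    qed
    have "(\<integral>x. f x \<partial>\<mu>) \<le> (\<integral>x. f x0 + D \<partial>\<mu>)"
      using b by (intro integral_mono lipschitz_map_integrable[OF f \<mu>]) (auto simp: borel_probsD[OF \<mu>])
    moreover have "(\<integral>x. f x0 - D \<partial>\<nu>) \<le> (\<integral>x. f x \<partial>\<nu>)"
      using b by (intro integral_mono lipschitz_map_integrable[OF f \<nu>]) (auto simp: borel_probsD[OF \<nu>])
    ultimately show "(\<integral>x. f x \<partial>\<mu>) - (\<integral>x. f x \<partial>\<nu>) \<le> 2 * D"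
      by (simp add: \<mu>.prob_space \<nu>.prob_space)
  qed
qed

lemma mk_dist_upper:
  assumes "\<mu> \<in> borel_probs Y" "\<nu> \<in> borel_probs Y" "lipschitz_map 1 Y euclidean_metric f"
  shows "(\<integral>x. f x \<partial>\<mu>) - (\<integral>x. f x \<partial>\<nu>) \<le> mk_dist Y \<mu> \<nu>"
  using cSUP_upper[OF _ mk_dist_bdd_above[OF assms(1,2)], of f] assms by (simp add: mk_dist_def)

lemma lipschitz_map_zero: "lipschitz_map 1 Y euclidean_metric (\<lambda>x. 0 :: real)"
  by (auto simp: lipschitz_map_def)

lemma mk_dist_le:
  assumes "\<mu> \<in> borel_probs Y" "\<nu> \<in> borel_probs Y"
    and "\<And>f. lipschitz_map 1 Y euclidean_metric f \<Longrightarrow> (\<integral>x. f x \<partial>\<mu>) - (\<integral>x. f x \<partial>\<nu>) \<le> r"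
  shows "mk_dist Y \<mu> \<nu> \<le> r"
  using assms lipschitz_map_zero unfolding mk_dist_def by (auto intro!: cSUP_least)

lemma mk_dist_nonneg: "0 \<le> mk_dist Y \<mu> \<nu>"
proof (cases "\<mu> \<in> borel_probs Y \<and> \<nu> \<in> borel_probs Y")
  case True
  then show ?thesis
    using mk_dist_upper[of \<mu> \<nu>, OF _ _ lipschitz_map_zero] by simp
qed (auto simp: mk_dist_def)

lemma mk_dist_le_commute: "mk_dist Y \<mu> \<nu> \<le> mk_dist Y \<nu> \<mu>"
proof (cases "\<mu> \<in> borel_probs Y \<and> \<nu> \<in> borel_probs Y")
  case True
  show ?thesis
  proof (rule mk_dist_le)
    fix f :: "'a \<Rightarrow> real" assume "lipschitz_map 1 Y euclidean_metric f"
    then have "lipschitz_map 1 Y euclidean_metric (\<lambda>x. - f x)"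
      using lipschitz_map_scale[of 1 Y f "-1"] by simp
    then show "(\<integral>x. f x \<partial>\<mu>) - (\<integral>x. f x \<partial>\<nu>) \<le> mk_dist Y \<nu> \<mu>"
      using mk_dist_upper[of \<nu> \<mu>] True by fastforce
  qed (use True in auto)
qed (auto simp: mk_dist_def)

lemma mk_dist_zero_integral_eq:
  fixes g :: "'a \<Rightarrow> real"
  assumes \<mu>: "\<mu> \<in> borel_probs Y" and \<nu>: "\<nu> \<in> borel_probs Y" and 0: "mk_dist Y \<mu> \<nu> = 0"
    and g: "lipschitz_map L Y euclidean_metric g" and "0 < L"
  shows "(\<integral>x. g x \<partial>\<mu>) = (\<integral>x. g x \<partial>\<nu>)"
proof -
  have "lipschitz_map 1 Y euclidean_metric (\<lambda>x. 1/L * g x)"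
    using lipschitz_map_scale[OF g, of "1/L"] \<open>0 < L\<close> by simp
  from mk_dist_upper[OF \<mu> \<nu> this] mk_dist_upper[OF \<nu> \<mu> this]
  have "1/L * (\<integral>x. g x \<partial>\<mu>) = 1/L * (\<integral>x. g x \<partial>\<nu>)"
    using 0 mk_dist_le_commute[of \<nu> \<mu>] unfolding integral_mult_right_zero by linarith
  then show ?thesis
    using \<open>0 < L\<close> by simp
qed

lemma lipschitz_approx_indicator:
  assumes C: "C \<subseteq> mspace Y" "C \<noteq> {}"
  shows "lipschitz_map (1 + real k) Y euclidean_metric (\<lambda>x. max 0 (1 - real k * (INF c\<in>C. mdist Y x c)))"
proof -
  have *: "(INF c\<in>C. mdist Y x c) \<le> (INF c\<in>C. mdist Y y c) + mdist Y x y"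
    if "x \<in> mspace Y" "y \<in> mspace Y" for x y
  proof -
    have "(INF c\<in>C. mdist Y x c) - mdist Y x y \<le> (INF c\<in>C. mdist Y y c)"
    proof (rule cINF_greatest)
      fix c assume c: "c \<in> C"
      have "(INF c\<in>C. mdist Y x c) \<le> mdist Y x c"
        by (rule INF_mdist_le[OF c])
      also have "\<dots> \<le> mdist Y x y + mdist Y y c"
        using that C c by (intro mdist_triangle) auto
      finally show "(INF c\<in>C. mdist Y x c) - mdist Y x y \<le> mdist Y y c" by simp
    qed fact
    then show ?thesis by simp
  qed
  have "\<bar>max 0 (1 - real k * (INF c\<in>C. mdist Y x c)) - max 0 (1 - real k * (INF c\<in>C. mdist Y y c))\<bar>
      \<le> (1 + real k) * mdist Y x y" if xy: "x \<in> mspace Y" "y \<in> mspace Y" for x y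
  proof -
    have "\<bar>(INF c\<in>C. mdist Y x c) - (INF c\<in>C. mdist Y y c)\<bar> \<le> mdist Y x y"
      using *[OF xy] *[OF xy(2,1)] by (simp add: mdist_commute[of Y y x] abs_le_iff)
    then have "\<bar>real k * (INF c\<in>C. mdist Y x c) - real k * (INF c\<in>C. mdist Y y c)\<bar> \<le> real k * mdist Y x y"
      by (simp add: abs_mult mult_left_mono flip: right_diff_distrib)
    moreover have "0 \<le> mdist Y x y" by simp
    ultimately show ?thesis
      unfolding distrib_right by linarith
  qed
  then show ?thesis
    by (auto simp: lipschitz_map_def dist_real_def)
qed

lemma mk_dist_zero_closed_eq:
  assumes \<mu>: "\<mu> \<in> borel_probs Y" and \<nu>: "\<nu> \<in> borel_probs Y" and 0: "mk_dist Y \<mu> \<nu> = 0"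
    and C: "closedin (mtopology_of Y) C"
  shows "measure \<mu> C = measure \<nu> C"
proof (cases "C = {}")
  case False
  have CY: "C \<subseteq> mspace Y"
    using closedin_subset[OF C] by simp
  define d where "d x = (INF c\<in>C. mdist Y x c)" for x
  define g where "g k x = max 0 (1 - real k * d x)" for k x
  have d_nonneg: "0 \<le> d x" for x
    unfolding d_def by (rule INF_mdist_nonneg[OF False])
  have d_zero: "d x = 0" if "x \<in> C" for x
    using INF_mdist_le[OF that, of Y x] d_nonneg[of x] CY that by (auto simp: d_def)
  have d_pos: "0 < d x" if x: "x \<in> mspace Y" "x \<notin> C" for x
  proof -
    obtain r where r: "0 < r" "disjnt C (Y.mball x r)"
      using C x unfolding mtopology_of_def Y.closedin_metric by blast
    have "r \<le> d x"
      unfolding d_def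
    proof (rule cINF_greatest[OF False])
      fix c assume "c \<in> C"
      then show "r \<le> mdist Y x c"
        using r x CY by (force simp: disjnt_iff)
    qed
    with r show ?thesis by linarith
  qed
  have lim: "(\<lambda>k. g k x) \<longlonglongrightarrow> indicat_real C x" if x: "x \<in> mspace Y" for x
  proof (cases "x \<in> C")
    case True
    then show ?thesis by (simp add: g_def d_zero)
  next
    case False
    obtain k0 where k0: "1 / d x < real k0"
      using reals_Archimedean2 by blast
    have "g k x = 0" if "k0 \<le> k" for k
    proof -
      have "1 / d x < real k" using k0 that by (meson less_le_trans of_nat_mono)
      then have "1 < real k * d x"
        using d_pos[OF x False] by (simp add: divide_less_eq)
      then show ?thesis by (simp add: g_def)
    qed
    then have "eventually (\<lambda>k. g k x = 0) sequentially"
      by (auto simp: eventually_sequentially)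
    then show ?thesis
      using False by (simp add: tendsto_eventually)
  qed
  have g_lip: "lipschitz_map (1 + real k) Y euclidean_metric (g k)" for k
    using lipschitz_approx_indicator[OF CY False, of k] by (simp add: g_def[abs_def] d_def)
  have C_sets: "C \<in> sets (metric_borel Y)"
  proof -
    have "mspace Y - (mspace Y - C) \<in> sigma_sets (mspace Y) {U. openin (mtopology_of Y) U}"
      using C by (intro sigma_sets.Compl sigma_sets.Basic) (auto simp: closedin_def)
    moreover have "mspace Y - (mspace Y - C) = C" using CY by auto
    ultimately show ?thesis by (simp add: sets_metric_borel)
  qed
  have int: "(\<lambda>k. \<integral>x. g k x \<partial>\<kappa>) \<longlonglongrightarrow> measure \<kappa> C" if \<kappa>: "\<kappa> \<in> borel_probs Y" for \<kappa>
  proof -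
    interpret prob_space \<kappa> by (rule borel_probsD[OF \<kappa>])
    have C_sets': "C \<in> sets \<kappa>" and [simp]: "space \<kappa> = mspace Y"
      using C_sets by (simp_all add: borel_probsD(2,3)[OF \<kappa>])
    have "(\<lambda>k. \<integral>x. g k x \<partial>\<kappa>) \<longlonglongrightarrow> (\<integral>x. indicat_real C x \<partial>\<kappa>)"
    proof (rule integral_dominated_convergence[where w = "\<lambda>_. 1"])
      show "g k \<in> borel_measurable \<kappa>" for k
        using lipschitz_map_borel_measurable[OF g_lip] measurable_cong_sets[OF borel_probsD(2)[OF \<kappa>] refl]
        by blast
      show "AE x in \<kappa>. norm (g k x) \<le> 1" for k
        using d_nonneg by (intro AE_I2) (auto simp: g_def)
    qed (use lim C_sets' in auto)
    then show ?thesis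
      using C_sets' CY by (simp add: Int_absorb2)
  qed
  have "(\<lambda>k. \<integral>x. g k x \<partial>\<mu>) = (\<lambda>k. \<integral>x. g k x \<partial>\<nu>)"
    using mk_dist_zero_integral_eq[OF \<mu> \<nu> 0 g_lip] by auto
  then show ?thesis
    using LIMSEQ_unique[OF int[OF \<mu>]] int[OF \<nu>] by simp
qed auto

lemma Metric_space_prob: "Metric_space (borel_probs Y) (mk_dist Y)"
proof
  show "0 \<le> mk_dist Y \<mu> \<nu>" for \<mu> \<nu> by (rule mk_dist_nonneg)
  show "mk_dist Y \<mu> \<nu> = mk_dist Y \<nu> \<mu>" for \<mu> \<nu>
    by (intro order_antisym mk_dist_le_commute)
next
  fix \<mu> \<nu> \<kappa> assume \<mu>: "\<mu> \<in> borel_probs Y" and \<nu>: "\<nu> \<in> borel_probs Y"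
  show "mk_dist Y \<mu> \<nu> = 0 \<longleftrightarrow> \<mu> = \<nu>"
  proof
    assume 0: "mk_dist Y \<mu> \<nu> = 0"
    interpret \<mu>: prob_space \<mu> by (rule borel_probsD[OF \<mu>])
    interpret \<nu>: prob_space \<nu> by (rule borel_probsD[OF \<nu>])
    show "\<mu> = \<nu>"
    proof (rule measure_eqI_generator_eq[where E = "{U. openin (mtopology_of Y) U}" and \<Omega> = "mspace Y"
            and A = "\<lambda>_. mspace Y"])
      fix U assume "U \<in> {U. openin (mtopology_of Y) U}"
      then have U: "openin (mtopology_of Y) U" by simp
      then have US: "U \<in> sets (metric_borel Y)"
        by (auto simp: sets_metric_borel)
      have "closedin (mtopology_of Y) (mspace Y - U)"
        using U by (metis openin_closedin_eq topspace_mtopology_of)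
      then have "measure \<mu> (mspace Y - U) = measure \<nu> (mspace Y - U)"
        by (rule mk_dist_zero_closed_eq[OF \<mu> \<nu> 0])
      then have "measure \<mu> U = measure \<nu> U"
        using \<mu>.prob_compl[of U] \<nu>.prob_compl[of U] US borel_probsD[OF \<mu>] borel_probsD[OF \<nu>] by simp
      then show "emeasure \<mu> U = emeasure \<nu> U"
        by (simp add: \<mu>.emeasure_eq_measure \<nu>.emeasure_eq_measure)
    next
      show "{U. openin (mtopology_of Y) U} \<subseteq> Pow (mspace Y)"
        using openin_subset[of "mtopology_of Y"] by auto
    next
      show "range (\<lambda>_. mspace Y) \<subseteq> {U. openin (mtopology_of Y) U}"
        using openin_topspace[of "mtopology_of Y"] by auto
    qed (use borel_probsD[OF \<mu>] borel_probsD[OF \<nu>] in \<open>auto simp: sets_metric_borel Int_stable_def\<close>)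
  next
    assume "\<mu> = \<nu>"
    then have "mk_dist Y \<mu> \<nu> \<le> 0"
      using \<mu> by (intro mk_dist_le) auto
    then show "mk_dist Y \<mu> \<nu> = 0"
      using mk_dist_nonneg[of \<mu> \<nu>] by linarith
  qed
  assume \<kappa>: "\<kappa> \<in> borel_probs Y"
  show "mk_dist Y \<mu> \<kappa> \<le> mk_dist Y \<mu> \<nu> + mk_dist Y \<nu> \<kappa>"
  proof (rule mk_dist_le[OF \<mu> \<kappa>])
    fix f :: "'a \<Rightarrow> real" assume f: "lipschitz_map 1 Y euclidean_metric f"
    show "(\<integral>x. f x \<partial>\<mu>) - (\<integral>x. f x \<partial>\<kappa>) \<le> mk_dist Y \<mu> \<nu> + mk_dist Y \<nu> \<kappa>"
      using mk_dist_upper[OF \<mu> \<nu> f] mk_dist_upper[OF \<nu> \<kappa> f] by linarith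
  qed
qed

lemma mspace_prob_metric: "mspace (prob_metric Y) = borel_probs Y"
  unfolding prob_metric_def by (rule Metric_space.mspace_metric[OF Metric_space_prob])

lemma mdist_prob_metric: "mdist (prob_metric Y) = mk_dist Y"
  unfolding prob_metric_def by (rule Metric_space.mdist_metric[OF Metric_space_prob])

end


section \<open>Attractors of iterated function systems\<close>

text \<open>
  The IFS on \<open>Y\<close> is given by a finite index set \<open>I\<close>, maps \<open>g a\<close> and probabilities \<open>p a\<close> for
  \<open>a \<in> I\<close>. If the \<open>g a\<close> are contractions and \<open>Y\<close> is compact and non-empty, both descriptions
  below determine a unique object.
\<close>

definition set_attractor :: "'a metric \<Rightarrow> 'i set \<Rightarrow> ('i \<Rightarrow> 'a \<Rightarrow> 'a) \<Rightarrow> 'a set"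
  where "set_attractor Y I g = (THE A. A \<in> hyperspace Y \<and> A = (\<Union>a\<in>I. g a ` A))"

definition measure_attractor ::
    "'a metric \<Rightarrow> 'i set \<Rightarrow> ('i \<Rightarrow> 'a \<Rightarrow> 'a) \<Rightarrow> ('i \<Rightarrow> real) \<Rightarrow> 'a measure"
  where "measure_attractor Y I g p =
    (THE \<mu>. \<mu> \<in> borel_probs Y \<and>
       (\<forall>B\<in>sets (metric_borel Y).
          measure \<mu> B = (\<Sum>a\<in>I. p a * measure (distr \<mu> (metric_borel Y) (g a)) B)))"


section \<open>Random fractal sets of a superIFS\<close>

text \<open>The map \<open>f\<^sub>m\<^sup>n\<close> is written \<open>f m n\<close>.\<close>

definition words :: "nat \<Rightarrow> nat list set"
  where "words M = lists {1..M}"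

definition code_trees :: "nat \<Rightarrow> nat \<Rightarrow> (nat list \<Rightarrow> nat) set"
  where "code_trees M N = words M \<rightarrow>\<^sub>E {1..N}"

definition code_tree_measure :: "nat \<Rightarrow> nat \<Rightarrow> (nat \<Rightarrow> real) \<Rightarrow> (nat list \<Rightarrow> nat) measure"
  where "code_tree_measure M N P =
    Pi\<^sub>M (words M) (\<lambda>_. point_measure {1..N} (\<lambda>n. ennreal (P n)))"

lemma space_code_tree_measure: "space (code_tree_measure M N P) = code_trees M N"
  by (simp add: code_tree_measure_def code_trees_def space_PiM space_point_measure)

text \<open>
  With \<open>i = [i\<^sub>1, \<dots>, i\<^sub>k]\<close> the list index \<open>j\<close> runs from \<open>0\<close>, so its factor is the map \<open>f\<close> with
  lower index \<open>i\<^sub>j\<^sub>+\<^sub>1\<close> and upper index \<open>\<sigma> (i\<^sub>1 \<dots> i\<^sub>j)\<close>.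
\<close>

definition path_map ::
    "(nat \<Rightarrow> nat \<Rightarrow> 'a \<Rightarrow> 'a) \<Rightarrow> (nat list \<Rightarrow> nat) \<Rightarrow> nat list \<Rightarrow> 'a \<Rightarrow> 'a"
  where "path_map f \<sigma> i = foldr (\<lambda>j g. f (i ! j) (\<sigma> (take j i)) \<circ> g) [0..<length i] id"

definition level_set ::
    "nat \<Rightarrow> (nat \<Rightarrow> nat \<Rightarrow> 'a \<Rightarrow> 'a) \<Rightarrow> (nat list \<Rightarrow> nat) \<Rightarrow> 'a set \<Rightarrow> nat \<Rightarrow> 'a set"
  where "level_set M f \<sigma> K k = (\<Union>i\<in>{i \<in> words M. length i = k}. path_map f \<sigma> i ` K)"

definition tree_fractal ::
    "'a metric \<Rightarrow> nat \<Rightarrow> (nat \<Rightarrow> nat \<Rightarrow> 'a \<Rightarrow> 'a) \<Rightarrow> (nat list \<Rightarrow> nat) \<Rightarrow> 'a set"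
  where "tree_fractal X M f \<sigma> =
    (THE A. \<forall>K\<in>hyperspace X. limitin (mtopology_of (hyper X)) (level_set M f \<sigma> K) A sequentially)"

definition fractal_sets ::
    "'a metric \<Rightarrow> nat \<Rightarrow> nat \<Rightarrow> (nat \<Rightarrow> nat \<Rightarrow> 'a \<Rightarrow> 'a) \<Rightarrow> 'a set set"
  where "fractal_sets X M N f = tree_fractal X M f ` code_trees M N"

definition fractal_distribution ::
    "'a metric \<Rightarrow> nat \<Rightarrow> nat \<Rightarrow> (nat \<Rightarrow> nat \<Rightarrow> 'a \<Rightarrow> 'a) \<Rightarrow> (nat \<Rightarrow> real) \<Rightarrow> 'a set measure"
  where "fractal_distribution X M N f P =
    distr (code_tree_measure M N P) (metric_borel (hyper X)) (tree_fractal X M f)"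


section \<open>V-variable fractal sets\<close>

text \<open>
  For an index \<open>a\<close>, \<open>fst (a v)\<close> is \<open>n\<^sub>v\<close> and \<open>snd (a v) m\<close> is \<open>v\<close> with the double subscript \<open>v,m\<close>.
\<close>

type_synonym V_index = "nat \<Rightarrow> nat \<times> (nat \<Rightarrow> nat)"

definition V_indices :: "nat \<Rightarrow> nat \<Rightarrow> nat \<Rightarrow> V_index set"
  where "V_indices M N V = {1..V} \<rightarrow>\<^sub>E {1..N} \<times> ({1..M} \<rightarrow>\<^sub>E {1..V})"

definition V_map ::
    "nat \<Rightarrow> (nat \<Rightarrow> nat \<Rightarrow> 'a \<Rightarrow> 'a) \<Rightarrow> nat \<Rightarrow> V_index \<Rightarrow> (nat \<Rightarrow> 'a set) \<Rightarrow> nat \<Rightarrow> 'a set"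
  where "V_map M f V a K = (\<lambda>v\<in>{1..V}. \<Union>m\<in>{1..M}. f m (fst (a v)) ` K (snd (a v) m))"

definition V_attractor ::
    "'a metric \<Rightarrow> nat \<Rightarrow> nat \<Rightarrow> (nat \<Rightarrow> nat \<Rightarrow> 'a \<Rightarrow> 'a) \<Rightarrow> nat \<Rightarrow> (nat \<Rightarrow> 'a set) set"
  where "V_attractor X M N f V =
    set_attractor (power_metric V (hyper X)) (V_indices M N V) (V_map M f V)"

definition V_distribution ::
    "'a metric \<Rightarrow> nat \<Rightarrow> nat \<Rightarrow> (nat \<Rightarrow> nat \<Rightarrow> 'a \<Rightarrow> 'a) \<Rightarrow> nat \<Rightarrow> (V_index \<Rightarrow> real)
      \<Rightarrow> (nat \<Rightarrow> 'a set) measure"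
  where "V_distribution X M N f V p =
    measure_attractor (power_metric V (hyper X)) (V_indices M N V) (V_map M f V) p"

definition V_fractal_sets ::
    "'a metric \<Rightarrow> nat \<Rightarrow> nat \<Rightarrow> (nat \<Rightarrow> nat \<Rightarrow> 'a \<Rightarrow> 'a) \<Rightarrow> nat \<Rightarrow> 'a set set"
  where "V_fractal_sets X M N f V = (\<lambda>K. K 1) ` V_attractor X M N f V"

definition V_fractal_distribution ::
    "'a metric \<Rightarrow> nat \<Rightarrow> nat \<Rightarrow> (nat \<Rightarrow> nat \<Rightarrow> 'a \<Rightarrow> 'a) \<Rightarrow> nat \<Rightarrow> (V_index \<Rightarrow> real)
      \<Rightarrow> 'a set measure"
  where "V_fractal_distribution X M N f V p =
    distr (V_distribution X M N f V p) (metric_borel (hyper X)) (\<lambda>K. K 1)"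

end

theory Submission
  imports Defs
begin

text \<open>
  Both limits come from one step of the random recursion. Write \<open>D\<close> for the diameter of the
  hyperspace. A set in the attractor of the \<open>V\<close>-variable IFS is a union of contracted copies of
  buffers of another point of the attractor, so after \<open>k\<close> steps it lies within \<open>l ^ k * D\<close> of the
  fractal of a code tree. Conversely, as soon as \<open>M ^ k \<le> V\<close>, the nodes of each of the first \<open>k\<close>
  levels of an arbitrary code tree fit into distinct buffers, so the tree is realised up to the
  same error.

  For the distributions, let \<open>v\<close> place the words of length \<open>j\<close> into distinct buffers, and compare
  the joint law of these buffers under the invariant measure with the law of the fractals of the
  subtrees at level \<open>j\<close>, tested on Lipschitz functions. In one step the letters of the distinct
  buffers are independent with law \<open>P\<close>, as in the code tree, and the Lipschitz constant shrinks by
  \<open>l\<close>; the children are again in distinct buffers except with probability at most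
  \<open>M ^ (2 * (j + 1)) / V\<close>. Iterating \<open>k\<close> times bounds the Monge--Kantorovitch distance by
  \<open>l ^ k * D + C / V\<close> with \<open>C\<close> independent of \<open>V\<close>.
\<close>

section \<open>Hyperspaces and finite powers of compact spaces\<close>

text \<open>A single buffer does not suffice for the induction on distributions. Buffers are
  dependent under the invariant law, because they are built from common buffers, so one step turns a
  function of one set into a function of \<open>M\<close> dependent sets. Hence the estimate
  concerns functions of a whole level, for every \<open>j\<close> and every injective placement
  \<open>v\<close>; \<open>k\<close> counts the remaining steps, and \<open>j\<close> rises as
  \<open>k\<close> falls. In place of a coupling, invariance turns the integral over the buffers
  into an average over the index \<open>a\<close>. The letters that \<open>a\<close> gives to
  distinct buffers have the law of the letters of a code tree at level \<open>j\<close>, so the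
  code-tree side is an average over the same \<open>a\<close>, and the two are compared term by
  term. Where \<open>a\<close> sends two children to one buffer, the crude bound by \<open>D\<close>
  replaces the induction hypothesis. \<open>C\<close> collects these terms and depends on
  \<open>k\<close>, so \<open>k\<close> is chosen before \<open>V\<close>. Attractors and fractals
  are defined by \<open>THE\<close>, so existence and uniqueness have to be supplied: for sets by
  Banach's theorem in the hyperspace, for measures by contraction of the Monge--Kantorovitch
  distance and by the image of a Bernoulli measure.\<close>

lemma hausdorff_dist_leI:
  assumes "A \<in> hyperspace Y" "B \<in> hyperspace Y"
    and 1: "\<And>a. a \<in> A \<Longrightarrow> \<exists>b\<in>B. mdist Y a b \<le> r"
    and 2: "\<And>b. b \<in> B \<Longrightarrow> \<exists>a\<in>A. mdist Y a b \<le> r"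
  shows "hausdorff_dist Y A B \<le> r"
proof (rule hausdorff_dist_le[OF assms(1,2)])
  show "(INF b\<in>B. mdist Y a b) \<le> r" if "a \<in> A" for a
    using 1[OF that] INF_mdist_le order_trans by metis
  show "(INF a\<in>A. mdist Y b a) \<le> r" if "b \<in> B" for b
    using 2[OF that] INF_mdist_le order_trans mdist_commute by metis
qed

text \<open>A continuous function attains its infimum on the compact set \<open>B\<close>. Having an
  actual point at the Hausdorff distance keeps the estimates for unions and images free of
  epsilons.\<close>

lemma hausdorff_dist_attained:
  assumes A: "A \<in> hyperspace Y" and B: "B \<in> hyperspace Y" and a: "a \<in> A"
  shows "\<exists>b\<in>B. mdist Y a b \<le> hausdorff_dist Y A B"
proof -
  have aY: "a \<in> mspace Y"
    using a hyperspace_subset[OF A] by blast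
  have "lipschitz_map 1 Y euclidean_metric (mdist Y a)"
    unfolding lipschitz_map_def
  proof (intro conjI ballI)
    fix x y assume "x \<in> mspace Y" "y \<in> mspace Y"
    then show "mdist euclidean_metric (mdist Y a x) (mdist Y a y) \<le> 1 * mdist Y x y"
      using mdist_triangle[of a Y x y] mdist_triangle[of a Y y x] aY
      by (simp add: dist_real_def abs_le_iff mdist_commute)
  qed simp
  then have "compactin euclidean (mdist Y a ` B)"
    using B lipschitz_map_imp_continuous[of 1 Y euclidean_metric "mdist Y a"]
      image_compactin[of "mtopology_of Y" B euclideanreal "mdist Y a"]
    by (simp add: hyperspace_def)
  then obtain b where b: "b \<in> B" "\<And>c. c \<in> B \<Longrightarrow> mdist Y a b \<le> mdist Y a c"
    using compact_attains_inf[of "mdist Y a ` B"] B by (auto simp: hyperspace_def)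
  then have "mdist Y a b \<le> (INF c\<in>B. mdist Y a c)"
    using B by (intro cINF_greatest) (auto simp: hyperspace_def)
  then show ?thesis
    using b(1) INF_mdist_le_hausdorff_dist[OF A B a] by (intro bexI[of _ b]) auto
qed

lemma hausdorff_dist_attained':
  assumes A: "A \<in> hyperspace Y" and B: "B \<in> hyperspace Y" and b: "b \<in> B"
  shows "\<exists>a\<in>A. mdist Y a b \<le> hausdorff_dist Y A B"
  using hausdorff_dist_attained[OF B A b] hausdorff_dist_commute[of Y B A]
  by (simp add: mdist_commute[of Y b])

lemma hyperspace_UN:
  assumes "finite I" "I \<noteq> {}" "\<And>i. i \<in> I \<Longrightarrow> A i \<in> hyperspace Y"
  shows "(\<Union>i\<in>I. A i) \<in> hyperspace Y"
  using assms by (auto simp: hyperspace_def intro!: compactin_Union)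

lemma hyperspace_image:
  assumes "continuous_map (mtopology_of Y) (mtopology_of Z) g" "A \<in> hyperspace Y"
  shows "g ` A \<in> hyperspace Z"
  using assms by (auto simp: hyperspace_def intro: image_compactin)

lemma hyperspace_mspace:
  assumes "compact_space (mtopology_of Y)" "mspace Y \<noteq> {}"
  shows "mspace Y \<in> hyperspace Y"
  using assms by (simp add: hyperspace_def compact_space_def)

lemma hausdorff_dist_UN_le:
  assumes I: "finite I" "I \<noteq> {}"
    and A: "\<And>i. i \<in> I \<Longrightarrow> A i \<in> hyperspace Y" and B: "\<And>i. i \<in> I \<Longrightarrow> B i \<in> hyperspace Y"
    and r: "\<And>i. i \<in> I \<Longrightarrow> hausdorff_dist Y (A i) (B i) \<le> r"
  shows "hausdorff_dist Y (\<Union>i\<in>I. A i) (\<Union>i\<in>I. B i) \<le> r"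
proof (rule hausdorff_dist_leI)
  fix a assume "a \<in> (\<Union>i\<in>I. A i)"
  then obtain i where i: "i \<in> I" "a \<in> A i" by blast
  obtain b where "b \<in> B i" "mdist Y a b \<le> hausdorff_dist Y (A i) (B i)"
    using hausdorff_dist_attained[OF A B i(2)] i(1) by blast
  with r[OF i(1)] i(1) show "\<exists>b\<in>\<Union>i\<in>I. B i. mdist Y a b \<le> r"
    by (meson UN_I order_trans)
next
  fix b assume "b \<in> (\<Union>i\<in>I. B i)"
  then obtain i where i: "i \<in> I" "b \<in> B i" by blast
  obtain a where "a \<in> A i" "mdist Y a b \<le> hausdorff_dist Y (A i) (B i)"
    using hausdorff_dist_attained'[OF A B i(2)] i(1) by blast
  with r[OF i(1)] i(1) show "\<exists>a\<in>\<Union>i\<in>I. A i. mdist Y a b \<le> r"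
    by (meson UN_I order_trans)
qed (use hyperspace_UN I A B in auto)

lemma hausdorff_dist_image_le:
  assumes g: "lipschitz_map L Y Z g" and "0 \<le> L"
    and A: "A \<in> hyperspace Y" and B: "B \<in> hyperspace Y"
  shows "hausdorff_dist Z (g ` A) (g ` B) \<le> L * hausdorff_dist Y A B"
proof (rule hausdorff_dist_leI)
  have *: "mdist Z (g a) (g b) \<le> L * hausdorff_dist Y A B"
    if "a \<in> A" "b \<in> B" "mdist Y a b \<le> hausdorff_dist Y A B" for a b
  proof -
    have "mdist Z (g a) (g b) \<le> L * mdist Y a b"
      using g that(1,2) hyperspace_subset[OF A] hyperspace_subset[OF B]
      unfolding lipschitz_map_def by blast
    also have "\<dots> \<le> L * hausdorff_dist Y A B"
      using that(3) \<open>0 \<le> L\<close> by (rule mult_left_mono)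
    finally show ?thesis .
  qed
  show "\<exists>z\<in>g ` B. mdist Z y z \<le> L * hausdorff_dist Y A B" if y: "y \<in> g ` A" for y
  proof -
    obtain a where a: "a \<in> A" "y = g a" using y by blast
    obtain b where "b \<in> B" "mdist Y a b \<le> hausdorff_dist Y A B"
      using hausdorff_dist_attained[OF A B a(1)] by blast
    with * a show ?thesis by blast
  qed
  show "\<exists>y\<in>g ` A. mdist Z y z \<le> L * hausdorff_dist Y A B" if z: "z \<in> g ` B" for z
  proof -
    obtain b where b: "b \<in> B" "z = g b" using z by blast
    obtain a where "a \<in> A" "mdist Y a b \<le> hausdorff_dist Y A B"
      using hausdorff_dist_attained'[OF A B b(1)] by blast
    with * b show ?thesis by blast
  qed
qed (use hyperspace_image[OF lipschitz_map_imp_continuous[OF g]] A B in auto)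

text \<open>The non-empty subsets of a finite net of the space form a finite net of the hyperspace:
  a compact set is approximated by the net points close to it.\<close>

lemma mtotally_bounded_hyper:
  assumes "compact_space (mtopology_of Y)"
  shows "Metric_space.mtotally_bounded (hyperspace Y) (hausdorff_dist Y) (hyperspace Y)"
proof -
  interpret Y: Metric_space "mspace Y" "mdist Y" by simp
  interpret H: Metric_space "hyperspace Y" "hausdorff_dist Y" by (rule Metric_space_hyper)
  have tb: "Y.mtotally_bounded (mspace Y)"
    using assms Y.compact_space_eq_mcomplete_mtotally_bounded by (simp add: mtopology_of_def)
  show ?thesis
    unfolding H.mtotally_bounded_def
  proof (intro allI impI)
    fix e :: real assume e: "0 < e"
    obtain S where S: "finite S" "S \<subseteq> mspace Y" "mspace Y \<subseteq> (\<Union>x\<in>S. Y.mball x (e/2))"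
      using tb e unfolding Y.mtotally_bounded_def by (meson half_gt_zero)
    let ?K = "{T. T \<subseteq> S \<and> T \<noteq> {}}"
    have K: "?K \<subseteq> hyperspace Y"
      using S by (auto simp: hyperspace_def intro!: finite_imp_compactin intro: finite_subset)
    have "hyperspace Y \<subseteq> (\<Union>T\<in>?K. H.mball T e)"
    proof
      fix A assume A: "A \<in> hyperspace Y"
      define T where "T = {x \<in> S. \<exists>a\<in>A. mdist Y a x \<le> e/2}"
      have near: "\<exists>x\<in>T. mdist Y a x \<le> e/2" if a: "a \<in> A" for a
      proof -
        obtain x where "x \<in> S" "mdist Y x a < e/2"
          using a hyperspace_subset[OF A] S(3) by fastforce
        with a show ?thesis
          unfolding T_def by (auto simp: mdist_commute intro!: bexI[of _ x] bexI[of _ a])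
      qed
      have T: "T \<in> ?K"
        using A near by (auto simp: T_def hyperspace_def)
      then have "hausdorff_dist Y T A \<le> e/2"
        using near K A by (intro hausdorff_dist_leI) (auto simp: T_def mdist_commute)
      with T K A e show "A \<in> (\<Union>T\<in>?K. H.mball T e)"
        by (intro UN_I[of T]) auto
    qed
    moreover have "finite ?K"
      using S by (auto intro: finite_subset[of _ "Pow S"])
    ultimately show "\<exists>K. finite K \<and> K \<subseteq> hyperspace Y \<and> hyperspace Y \<subseteq> (\<Union>x\<in>K. H.mball x e)"
      using K by blast
  qed
qed

text \<open>The limit is the lower Kuratowski limit \<open>L\<close>, the set of points approached
  by all late \<open>K n\<close>. The work lies in showing that every point of a late
  \<open>K n\<close> has a point of \<open>L\<close> nearby.\<close>

lemma mcomplete_hyper: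
  assumes cpt: "compact_space (mtopology_of Y)"
  shows "Metric_space.mcomplete (hyperspace Y) (hausdorff_dist Y)"
proof -
  interpret Y: Metric_space "mspace Y" "mdist Y" by simp
  interpret H: Metric_space "hyperspace Y" "hausdorff_dist Y" by (rule Metric_space_hyper)
  have sub: "\<exists>y r. y \<in> mspace Y \<and> strict_mono (r :: nat \<Rightarrow> nat) \<and> limitin Y.mtopology (x \<circ> r) y sequentially"
    if "range x \<subseteq> mspace Y" for x
    using cpt that unfolding mtopology_of_def Y.compact_space_sequentially by blast
  show ?thesis
    unfolding H.mcomplete_def
  proof (intro allI impI)
    fix K assume "H.MCauchy K"
    then have K: "\<And>n. K n \<in> hyperspace Y"
      and Cau: "\<And>e. 0 < e \<Longrightarrow> \<exists>n0. \<forall>n\<ge>n0. \<forall>m\<ge>n0. hausdorff_dist Y (K n) (K m) < e"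
      unfolding H.MCauchy_def by auto
    define L where "L = {y \<in> mspace Y. \<forall>e>0. \<exists>n0. \<forall>n\<ge>n0. \<exists>x\<in>K n. mdist Y x y \<le> e}"
    have near: "\<exists>y\<in>L. mdist Y x y \<le> 2 * e"
      if e: "0 < e" and n0: "\<And>n m. n \<ge> n0 \<Longrightarrow> m \<ge> n0 \<Longrightarrow> hausdorff_dist Y (K n) (K m) < e"
        and n: "n \<ge> n0" and x: "x \<in> K n" for e n0 n x
    proof -
      \<comment> \<open>The guard \<open>m \<ge> n0\<close> lets the choice below produce a total
        sequence; for smaller \<open>m\<close> any point of the non-empty set \<open>K m\<close>
        will do.\<close>
      have "\<exists>z\<in>K m. m \<ge> n0 \<longrightarrow> mdist Y x z \<le> e" for m
      proof (cases "m \<ge> n0")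
        case True
        then show ?thesis
          using hausdorff_dist_attained[OF K K x, of m] n0[OF n True] by force
      qed (use K[of m] in \<open>auto simp: hyperspace_def\<close>)
      then have "\<forall>m. \<exists>z. z \<in> K m \<and> (m \<ge> n0 \<longrightarrow> mdist Y x z \<le> e)"
        by blast
      then obtain z where "\<forall>m. z m \<in> K m \<and> (m \<ge> n0 \<longrightarrow> mdist Y x (z m) \<le> e)"
        by (rule choice[THEN exE])
      then have z: "\<And>m. z m \<in> K m" "\<And>m. m \<ge> n0 \<Longrightarrow> mdist Y x (z m) \<le> e"
        by auto
      have zY: "z m \<in> mspace Y" for m
        using z(1)[of m] hyperspace_subset[OF K[of m]] by blast
      then have "range z \<subseteq> mspace Y" by blast
      then obtain y r where y: "y \<in> mspace Y" and r: "strict_mono (r :: nat \<Rightarrow> nat)"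
        and lim: "limitin Y.mtopology (z \<circ> r) y sequentially"
        using sub by blast
      have conv: "\<exists>i0. \<forall>i\<ge>i0. mdist Y (z (r i)) y < d" if "0 < d" for d
        using lim that unfolding Y.limit_metric_sequentially o_apply by blast
      \<comment> \<open>Convergence is known only along the subsequence \<open>r\<close>; the Cauchy
        property moves a point of \<open>K (r i)\<close> to a nearby point of every late
        \<open>K n\<close>.\<close>
      have "y \<in> L"
        unfolding L_def
      proof (intro CollectI conjI allI impI y)
        fix d :: real assume d: "0 < d"
        obtain n1 where n1: "\<And>n m. n \<ge> n1 \<Longrightarrow> m \<ge> n1 \<Longrightarrow> hausdorff_dist Y (K n) (K m) < d/2"
          using Cau[of "d/2"] d by auto
        obtain i0 where i0: "\<And>i. i \<ge> i0 \<Longrightarrow> mdist Y (z (r i)) y < d/2"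
          using conv[of "d/2"] d by auto
        define i where "i = max i0 n1"
        have ri: "r i \<ge> n1"
          using seq_suble[OF r, of i] by (simp add: i_def)
        have "\<exists>x\<in>K n. mdist Y x y \<le> d" if n: "n \<ge> n1" for n
        proof -
          obtain w where w: "w \<in> K n" "mdist Y w (z (r i)) \<le> hausdorff_dist Y (K n) (K (r i))"
            using hausdorff_dist_attained'[OF K K z(1)] by blast
          have "mdist Y w y \<le> mdist Y w (z (r i)) + mdist Y (z (r i)) y"
            using w(1) hyperspace_subset[OF K[of n]] zY y by (intro mdist_triangle) auto
          also have "\<dots> \<le> d"
            using w(2) n1[OF n ri] i0[of i] by (simp add: i_def)
          finally show ?thesis using w(1) by blast
        qed
        then show "\<exists>n0. \<forall>n\<ge>n0. \<exists>x\<in>K n. mdist Y x y \<le> d" by blast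
      qed
      moreover have "mdist Y x y \<le> 2 * e"
      proof -
        obtain i0 where i0: "\<And>i. i \<ge> i0 \<Longrightarrow> mdist Y (z (r i)) y < e"
          using conv[OF e] by auto
        define i where "i = max i0 n0"
        have ri: "r i \<ge> n0"
          using seq_suble[OF r, of i] by (simp add: i_def)
        have "mdist Y x y \<le> mdist Y x (z (r i)) + mdist Y (z (r i)) y"
          using x hyperspace_subset[OF K[of n]] zY y by (intro mdist_triangle) auto
        then show ?thesis
          using z(2)[OF ri] i0[of i] by (simp add: i_def)
      qed
      ultimately show ?thesis by blast
    qed
    have "L \<noteq> {}"
    proof -
      obtain n0 where n0: "\<And>n m. n \<ge> n0 \<Longrightarrow> m \<ge> n0 \<Longrightarrow> hausdorff_dist Y (K n) (K m) < 1"
        using Cau[of 1] by auto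
      obtain x where "x \<in> K n0"
        using K[of n0] by (auto simp: hyperspace_def)
      then show ?thesis
        using near[of 1 n0 n0 x] n0 by auto
    qed
    moreover have "compactin (mtopology_of Y) L"
    proof (rule closedin_compact_space[OF cpt])
      have "Y.mtopology closure_of L \<subseteq> L"
      proof
        fix y assume "y \<in> Y.mtopology closure_of L"
        then have y: "y \<in> mspace Y" and cl: "\<And>e. 0 < e \<Longrightarrow> \<exists>x\<in>L. mdist Y y x < e"
          unfolding Y.metric_closure_of by auto
        show "y \<in> L"
          unfolding L_def
        proof (intro CollectI conjI allI impI y)
          fix d :: real assume d: "0 < d"
          obtain x where x: "x \<in> L" "mdist Y y x < d/2"
            using cl[of "d/2"] d by auto
          have "0 < d/2" using d by simp
          with x(1) obtain n0 where n0: "\<And>n. n \<ge> n0 \<Longrightarrow> \<exists>z\<in>K n. mdist Y z x \<le> d/2"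
            unfolding L_def by blast
          have "\<exists>z\<in>K n. mdist Y z y \<le> d" if n: "n \<ge> n0" for n
          proof -
            obtain z where z: "z \<in> K n" "mdist Y z x \<le> d/2"
              using n0[OF n] by blast
            have "mdist Y z y \<le> mdist Y z x + mdist Y x y"
              using z(1) x(1) hyperspace_subset[OF K[of n]] y
              by (intro mdist_triangle) (auto simp: L_def)
            with z x show ?thesis
              by (intro bexI[of _ z]) (auto simp: mdist_commute)
          qed
          then show "\<exists>n0. \<forall>n\<ge>n0. \<exists>z\<in>K n. mdist Y z y \<le> d" by blast
        qed
      qed
      moreover have "L \<subseteq> mspace Y" by (auto simp: L_def)
      ultimately show "closedin (mtopology_of Y) L"
        unfolding mtopology_of_def
        by (metis closure_of_subset closure_of_eq subset_antisym Y.topspace_mtopology)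
    qed
    ultimately have L: "L \<in> hyperspace Y" by (simp add: hyperspace_def)
    have "\<exists>n0. \<forall>n\<ge>n0. K n \<in> hyperspace Y \<and> hausdorff_dist Y (K n) L < e" if e: "0 < e" for e
    proof -
      \<comment> \<open>\<open>near\<close> doubles its tolerance, so \<open>e/4\<close> leads to
        \<open>e/2\<close>, strictly below \<open>e\<close>.\<close>
      obtain n0 where n0: "\<And>n m. n \<ge> n0 \<Longrightarrow> m \<ge> n0 \<Longrightarrow> hausdorff_dist Y (K n) (K m) < e/4"
        using Cau[of "e/4"] e by auto
      have "hausdorff_dist Y (K n) L \<le> e/2" if n: "n \<ge> n0" for n
      proof (rule hausdorff_dist_leI[OF K L])
        fix x assume "x \<in> K n"
        then show "\<exists>y\<in>L. mdist Y x y \<le> e/2"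
          using near[of "e/4" n0 n x] n0 n e by auto
      next
        fix y assume y: "y \<in> L"
        have "0 < e/4" using e by simp
        with y obtain n1 where n1: "\<And>n. n \<ge> n1 \<Longrightarrow> \<exists>x\<in>K n. mdist Y x y \<le> e/4"
          unfolding L_def by blast
        define m where "m = max n0 n1"
        obtain x where x: "x \<in> K m" "mdist Y x y \<le> e/4"
          using n1[of m] by (auto simp: m_def)
        obtain z where z: "z \<in> K n" "mdist Y z x \<le> hausdorff_dist Y (K n) (K m)"
          using hausdorff_dist_attained'[OF K K x(1)] by blast
        have "mdist Y z y \<le> mdist Y z x + mdist Y x y"
          using z(1) x(1) hyperspace_subset[OF K[of n]] hyperspace_subset[OF K[of m]] y
          by (intro mdist_triangle) (auto simp: L_def)
        also have "\<dots> \<le> e/2"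
          using z(2) x(2) n0[OF n, of m] by (simp add: m_def)
        finally show "\<exists>z\<in>K n. mdist Y z y \<le> e/2"
          using z(1) by blast
      qed
      then show ?thesis
        using K e by (intro exI[of _ n0]) force
    qed
    then have "limitin H.mtopology K L sequentially"
      unfolding H.limit_metric_sequentially using L by blast
    then show "\<exists>L. limitin H.mtopology K L sequentially" ..
  qed
qed

lemma compact_space_hyper:
  assumes "compact_space (mtopology_of Y)"
  shows "compact_space (mtopology_of (hyper Y))"
proof -
  interpret H: Metric_space "hyperspace Y" "hausdorff_dist Y" by (rule Metric_space_hyper)
  show ?thesis
    using mcomplete_hyper[OF assms] mtotally_bounded_hyper[OF assms]
    by (simp add: hyper_def H.compact_space_eq_mcomplete_mtotally_bounded)
qed

text \<open>Tychonoff gives compactness for the product topology, and the identity carries it over,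
  being continuous into the maximum metric: finitely many coordinates are controlled by one open
  box.\<close>

lemma compact_space_power_metric:
  assumes "compact_space (mtopology_of Y)"
  shows "compact_space (mtopology_of (power_metric V Y))"
proof -
  interpret Y: Metric_space "mspace Y" "mdist Y" by simp
  interpret P: Metric_space "{1..V} \<rightarrow>\<^sub>E mspace Y" "max_dist V Y" by (rule Metric_space_power)
  let ?T = "product_topology (\<lambda>_. mtopology_of Y) {1..V}"
  have "continuous_map ?T P.mtopology id"
    unfolding P.continuous_map_to_metric
  proof (intro ballI allI impI)
    fix x and e :: real assume x: "x \<in> topspace ?T" and e: "0 < e"
    let ?U = "PiE {1..V} (\<lambda>v. mball_of Y (x v) (e/2))"
    have xv: "x v \<in> mspace Y" if "v \<in> {1..V}" for v
      using x that by (auto simp: PiE_iff)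
    have "openin ?T ?U"
      by (auto simp: openin_PiE_gen mtopology_of_def mball_of_def)
    moreover have "x \<in> ?U"
      using x xv e by (auto simp: PiE_iff)
    moreover have "id y \<in> P.mball (id x) e" if y: "y \<in> ?U" for y
    proof -
      have "max_dist V Y x y \<le> e/2"
        using y e by (subst max_dist_le_iff) (auto simp: PiE_iff intro: less_imp_le)
      moreover have "x \<in> {1..V} \<rightarrow>\<^sub>E mspace Y" "y \<in> {1..V} \<rightarrow>\<^sub>E mspace Y"
        using x y by (auto simp: PiE_iff)
      ultimately show ?thesis
        using e unfolding P.in_mball id_apply by linarith
    qed
    ultimately show "\<exists>U. openin ?T U \<and> x \<in> U \<and> (\<forall>y\<in>U. id y \<in> P.mball (id x) e)"
      by blast
  qed
  moreover have "compactin ?T (topspace ?T)"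
    using assms compact_space_product_topology[of "\<lambda>_. mtopology_of Y" "{1..V}"]
    by (auto simp: compact_space_def)
  ultimately have "compactin P.mtopology (id ` topspace ?T)"
    by (rule image_compactin[rotated])
  then show ?thesis
    unfolding power_metric_def compact_space_def P.mtopology_of
    by (simp only: P.topspace_mtopology topspace_product_topology topspace_mtopology_of image_id id_apply)
qed

section \<open>Maps on code spaces\<close>

text \<open>
  Uniform continuity for the product of discrete topologies: up to \<open>e\<close>, the value depends on
  finitely many coordinates only.
\<close>

definition code_map :: "'i set \<Rightarrow> 's set \<Rightarrow> 'b metric \<Rightarrow> (('i \<Rightarrow> 's) \<Rightarrow> 'b) \<Rightarrow> bool"
  where "code_map J S Y h \<longleftrightarrow> h \<in> (J \<rightarrow>\<^sub>E S) \<rightarrow> mspace Y \<and>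
    (\<forall>e>0. \<exists>J0\<subseteq>J. finite J0 \<and>
      (\<forall>\<sigma>\<in>J \<rightarrow>\<^sub>E S. \<forall>\<tau>\<in>J \<rightarrow>\<^sub>E S. (\<forall>j\<in>J0. \<sigma> j = \<tau> j) \<longrightarrow> mdist Y (h \<sigma>) (h \<tau>) < e))"

lemma code_mapE:
  assumes "code_map J S Y h" "0 < e"
  obtains J0 where "J0 \<subseteq> J" "finite J0"
    "\<And>\<sigma> \<tau>. \<sigma> \<in> J \<rightarrow>\<^sub>E S \<Longrightarrow> \<tau> \<in> J \<rightarrow>\<^sub>E S \<Longrightarrow> (\<And>j. j \<in> J0 \<Longrightarrow> \<sigma> j = \<tau> j) \<Longrightarrow> mdist Y (h \<sigma>) (h \<tau>) < e"
  using assms unfolding code_map_def by meson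

lemma code_map_continuous:
  assumes h: "code_map J S Y h"
  shows "continuous_map (product_topology (\<lambda>_. discrete_topology S) J) (mtopology_of Y) h"
proof -
  interpret Y: Metric_space "mspace Y" "mdist Y" by simp
  show ?thesis
    unfolding mtopology_of_def Y.continuous_map_to_metric
  proof (intro ballI allI impI)
    fix \<sigma> and e :: real
    assume "\<sigma> \<in> topspace (product_topology (\<lambda>_. discrete_topology S) J)" and e: "0 < e"
    then have \<sigma>: "\<sigma> \<in> J \<rightarrow>\<^sub>E S" by simp
    obtain J0 where J0: "J0 \<subseteq> J" "finite J0"
      "\<And>\<sigma> \<tau>. \<sigma> \<in> J \<rightarrow>\<^sub>E S \<Longrightarrow> \<tau> \<in> J \<rightarrow>\<^sub>E S \<Longrightarrow> (\<And>j. j \<in> J0 \<Longrightarrow> \<sigma> j = \<tau> j) \<Longrightarrow> mdist Y (h \<sigma>) (h \<tau>) < e"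
      by (rule code_mapE[OF h e]) blast
    let ?U = "PiE J (\<lambda>j. if j \<in> J0 then {\<sigma> j} else S)"
    have "finite {j \<in> J. (if j \<in> J0 then {\<sigma> j} else S) \<noteq> S}"
      by (rule finite_subset[OF _ J0(2)]) auto
    then have "openin (product_topology (\<lambda>_. discrete_topology S) J) ?U"
      using \<sigma> by (auto simp: openin_PiE_gen PiE_iff)
    moreover have "\<sigma> \<in> ?U"
      using \<sigma> by (auto simp: PiE_iff)
    moreover have "h \<tau> \<in> Y.mball (h \<sigma>) e" if "\<tau> \<in> ?U" for \<tau>
    proof -
      have 1: "\<tau> j \<in> S" if "j \<in> J" for j
        using PiE_mem[OF \<open>\<tau> \<in> ?U\<close> that] PiE_mem[OF \<sigma> that] by (auto split: if_splits)
      have 2: "\<tau> j = \<sigma> j" if "j \<in> J0" for j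
        using PiE_mem[OF \<open>\<tau> \<in> ?U\<close>, of j] that J0(1) by auto
      have \<tau>: "\<tau> \<in> J \<rightarrow>\<^sub>E S"
        using \<open>\<tau> \<in> ?U\<close> 1 by (auto simp: PiE_iff)
      have "mdist Y (h \<sigma>) (h \<tau>) < e"
        using J0(3)[OF \<sigma> \<tau>] 2 by simp
      then show ?thesis
        using h \<sigma> \<tau> by (auto simp: code_map_def)
    qed
    ultimately show "\<exists>U. openin (product_topology (\<lambda>_. discrete_topology S) J) U \<and> \<sigma> \<in> U \<and>
        (\<forall>\<tau>\<in>U. h \<tau> \<in> Y.mball (h \<sigma>) e)"
      by blast
  qed
qed

lemma code_map_image_hyperspace:
  assumes h: "code_map J S Y h" and S: "finite S" "S \<noteq> {}"
  shows "h ` (J \<rightarrow>\<^sub>E S) \<in> hyperspace Y"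
proof -
  let ?T = "product_topology (\<lambda>_. discrete_topology S) J"
  have "compact_space ?T"
    using S by (auto simp: compact_space_product_topology compact_space_discrete_topology)
  then have "compactin ?T (J \<rightarrow>\<^sub>E S)"
    by (simp add: compact_space_def)
  then show ?thesis
    using S image_compactin[OF _ code_map_continuous[OF h]]
    by (auto simp: hyperspace_def PiE_eq_empty_iff)
qed

text \<open>The product sigma-algebra knows only cylinders, while the target carries all Borel sets.
  The preimage of an open set is a union of cylinders by uniform continuity, and a countable one
  because there are only countably many cylinders over a countable \<open>J\<close> and a finite
  \<open>S\<close>.\<close>

lemma code_map_measurable:
  assumes h: "code_map J S Y h" and J: "countable J" and S: "finite S"
  shows "h \<in> Pi\<^sub>M J (\<lambda>_. point_measure S p) \<rightarrow>\<^sub>M metric_borel Y"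
proof -
  interpret Y: Metric_space "mspace Y" "mdist Y" by simp
  let ?M = "Pi\<^sub>M J (\<lambda>_. point_measure S p)"
  have space: "space ?M = J \<rightarrow>\<^sub>E S"
    by (simp add: space_PiM space_point_measure)
  define C where "C J0 n = {\<sigma> \<in> space ?M. \<forall>j\<in>J0. \<sigma> j = n j}" for J0 and n :: "'a \<Rightarrow> 'b"
  have C: "C J0 n \<in> sets ?M" if "finite J0" "J0 \<subseteq> J" for J0 n
    unfolding C_def
  proof (intro sets.sets_Collect_finite_All that)
    fix j assume "j \<in> J0"
    then have "(\<lambda>\<sigma>. \<sigma> j) \<in> ?M \<rightarrow>\<^sub>M point_measure S p"
      using that by (intro measurable_component_singleton) auto
    moreover have "{n j} \<inter> S \<in> sets (point_measure S p)"
      by (auto simp: sets_point_measure)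
    ultimately have "(\<lambda>\<sigma>. \<sigma> j) -` ({n j} \<inter> S) \<inter> space ?M \<in> sets ?M"
      by (rule measurable_sets)
    also have "(\<lambda>\<sigma>. \<sigma> j) -` ({n j} \<inter> S) \<inter> space ?M = {\<sigma> \<in> space ?M. \<sigma> j = n j}"
      using \<open>j \<in> J0\<close> that unfolding space by auto
    finally show "{\<sigma> \<in> space ?M. \<sigma> j = n j} \<in> sets ?M" .
  qed
  show ?thesis
    unfolding metric_borel_def
  proof (rule measurable_measure_of)
    show "h \<in> space ?M \<rightarrow> mspace Y"
      using h by (auto simp: code_map_def space)
  next
    fix U assume "U \<in> {U. openin (mtopology_of Y) U}"
    then have U: "openin Y.mtopology U"
      by (simp add: mtopology_of_def)
    define W where "W = h -` U \<inter> space ?M"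
    define I where "I = {(J0, n). J0 \<subseteq> J \<and> finite J0 \<and> n \<in> J0 \<rightarrow>\<^sub>E S \<and> C J0 n \<subseteq> W}"
    have "countable (SIGMA J0:{J0. J0 \<subseteq> J \<and> finite J0}. J0 \<rightarrow>\<^sub>E S)"
    proof (intro countable_SIGMA)
      show "countable {J0. J0 \<subseteq> J \<and> finite J0}"
        using countable_Collect_finite_subset[OF J] by (simp add: conj_commute)
    qed (use S in \<open>auto intro!: countable_finite finite_PiE\<close>)
    then have "countable I"
      by (rule countable_subset[rotated]) (auto simp: I_def)
    have "W \<subseteq> (\<Union>(J0, n)\<in>I. C J0 n)"
    proof
      fix \<sigma> assume "\<sigma> \<in> W"
      then have \<sigma>: "\<sigma> \<in> J \<rightarrow>\<^sub>E S" "h \<sigma> \<in> U"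
        by (auto simp: W_def space)
      then obtain e where e: "0 < e" "Y.mball (h \<sigma>) e \<subseteq> U"
        using U unfolding Y.openin_mtopology by blast
      obtain J0 where J0: "J0 \<subseteq> J" "finite J0"
        "\<And>\<sigma> \<tau>. \<sigma> \<in> J \<rightarrow>\<^sub>E S \<Longrightarrow> \<tau> \<in> J \<rightarrow>\<^sub>E S \<Longrightarrow> (\<And>j. j \<in> J0 \<Longrightarrow> \<sigma> j = \<tau> j) \<Longrightarrow> mdist Y (h \<sigma>) (h \<tau>) < e"
        by (rule code_mapE[OF h e(1)]) blast
      have "C J0 (restrict \<sigma> J0) \<subseteq> W"
      proof
        fix \<tau> assume "\<tau> \<in> C J0 (restrict \<sigma> J0)"
        then have \<tau>: "\<tau> \<in> J \<rightarrow>\<^sub>E S" "\<And>j. j \<in> J0 \<Longrightarrow> \<sigma> j = \<tau> j"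
          by (auto simp: C_def space)
        have "h \<tau> \<in> Y.mball (h \<sigma>) e"
          using J0(3)[OF \<sigma>(1) \<tau>] h \<sigma>(1) \<tau>(1) by (auto simp: code_map_def)
        with e(2) \<tau>(1) show "\<tau> \<in> W"
          by (auto simp: W_def space)
      qed
      \<comment> \<open>Restricting \<open>\<sigma>\<close> to \<open>J0\<close> makes the label of
        the cylinder an element of a finite set, which keeps \<open>I\<close> countable.\<close>
      then have "(J0, restrict \<sigma> J0) \<in> I"
        using J0(1,2) \<sigma>(1) by (auto simp: I_def PiE_iff)
      moreover have "\<sigma> \<in> C J0 (restrict \<sigma> J0)"
        using \<sigma>(1) by (auto simp: C_def space)
      ultimately show "\<sigma> \<in> (\<Union>(J0, n)\<in>I. C J0 n)"
        by (intro UN_I[of "(J0, restrict \<sigma> J0)"]) auto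
    qed
    moreover have "(\<Union>(J0, n)\<in>I. C J0 n) \<subseteq> W"
    proof
      fix \<sigma> assume "\<sigma> \<in> (\<Union>(J0, n)\<in>I. C J0 n)"
      then obtain J0 n where "(J0, n) \<in> I" "\<sigma> \<in> C J0 n" by blast
      then show "\<sigma> \<in> W" unfolding I_def by blast
    qed
    ultimately have "W = (\<Union>(J0, n)\<in>I. C J0 n)" by (rule subset_antisym)
    also have "\<dots> \<in> sets ?M"
      using \<open>countable I\<close> by (intro sets.countable_UN') (auto simp: I_def intro!: C)
    finally show "h -` U \<inter> space ?M \<in> sets ?M"
      by (simp add: W_def)
  qed (use openin_subset[of "mtopology_of Y"] in auto)
qed

lemma metric_borel_euclidean: "metric_borel euclidean_metric = (borel :: 'a::metric_space measure)"
  unfolding metric_borel_def borel_def by simp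

section \<open>Attractors of contractive iterated function systems\<close>

lemma geometric_Cauchy_limit:
  assumes cpt: "compact_space (mtopology_of Y)" and l: "0 \<le> l" "l < (1::real)"
    and x: "\<And>k. x k \<in> mspace Y"
    and near: "\<And>k i j. mdist Y (x (k + i)) (x (k + j)) \<le> l ^ k * D"
  shows "\<exists>y. limitin (mtopology_of Y) x y sequentially"
proof -
  interpret Y: Metric_space "mspace Y" "mdist Y" by simp
  have "(\<lambda>k. l ^ k * D) \<longlonglongrightarrow> 0"
    using tendsto_mult_left_zero[OF LIMSEQ_power_zero[of l], of D] l by simp
  have "Y.MCauchy x"
    unfolding Y.MCauchy_def
  proof (intro conjI allI impI)
    fix e :: real assume "0 < e"
    then have "eventually (\<lambda>k. l ^ k * D < e) sequentially"
      using \<open>(\<lambda>k. l ^ k * D) \<longlonglongrightarrow> 0\<close> by (intro order_tendstoD(2)[where y = 0])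
    then obtain k where k: "l ^ k * D < e"
      by (auto simp: eventually_sequentially)
    have "mdist Y (x n) (x m) < e" if "k \<le> n" "k \<le> m" for n m
      using near[of k "n - k" "m - k"] k that by simp
    then show "\<exists>N. \<forall>n n'. N \<le> n \<longrightarrow> N \<le> n' \<longrightarrow> mdist Y (x n) (x n') < e" by blast
  qed (use x in auto)
  moreover have "Y.mcomplete"
    using cpt Y.compact_space_imp_mcomplete by (simp add: mtopology_of_def)
  ultimately show ?thesis
    unfolding Y.mcomplete_def mtopology_of_def by blast
qed

lemma limitin_mdist_le:
  assumes lim: "limitin (mtopology_of Y) x y sequentially" and z: "z \<in> mspace Y"
    and le: "\<And>n. n \<ge> k \<Longrightarrow> mdist Y (x n) z \<le> r"
  shows "mdist Y y z \<le> r"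
proof (rule field_le_epsilon)
  interpret Y: Metric_space "mspace Y" "mdist Y" by simp
  fix e :: real assume "0 < e"
  then obtain n0 where y: "y \<in> mspace Y" and n0: "\<And>n. n \<ge> n0 \<Longrightarrow> x n \<in> mspace Y \<and> mdist Y (x n) y < e"
    using lim unfolding mtopology_of_def Y.limit_metric_sequentially by blast
  define n where "n = max n0 k"
  have "mdist Y y z \<le> mdist Y y (x n) + mdist Y (x n) z"
    using n0[of n] y z by (intro mdist_triangle) (auto simp: n_def)
  moreover have "mdist Y y (x n) < e"
    using n0[of n] by (simp add: n_def mdist_commute)
  moreover have "mdist Y (x n) z \<le> r"
    by (rule le) (simp add: n_def)
  ultimately show "mdist Y y z \<le> r + e" by linarith
qed

text \<open>Only the distances beyond the index \<open>k\<close> matter, so a bound that holds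
  between two sequences from depth \<open>k\<close> on passes to their limits.\<close>

lemma limitin_limitin_mdist_le:
  assumes lim: "limitin (mtopology_of Y) x y sequentially" "limitin (mtopology_of Y) x' y' sequentially"
    and x: "\<And>n. x' n \<in> mspace Y"
    and le: "\<And>n m. n \<ge> k \<Longrightarrow> m \<ge> k \<Longrightarrow> mdist Y (x n) (x' m) \<le> r"
  shows "mdist Y y y' \<le> r"
proof -
  have y: "y \<in> mspace Y"
    using limitin_topspace[OF lim(1)] by simp
  have "mdist Y y (x' m) \<le> r" if "m \<ge> k" for m
    using limitin_mdist_le[OF lim(1) x, of k m r] le that by blast
  then have "mdist Y y' y \<le> r"
    by (intro limitin_mdist_le[OF lim(2) y, of k]) (simp add: mdist_commute)
  then show ?thesis by (simp add: mdist_commute)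
qed

locale contractive_IFS =
  fixes Y :: "'a metric" and I :: "'i set" and g :: "'i \<Rightarrow> 'a \<Rightarrow> 'a" and l :: real
  assumes cpt: "compact_space (mtopology_of Y)" and Y_ne: "mspace Y \<noteq> {}"
    and I: "finite I" "I \<noteq> {}" and l: "0 \<le> l" "l < 1"
    and lip: "\<And>a. a \<in> I \<Longrightarrow> lipschitz_map l Y Y (g a)"
begin

text \<open>The union of the images is a contraction of the complete hyperspace, so its fixed point
  exists and is unique, which makes the \<open>THE\<close> in the definition meaningful.\<close>

lemma set_attractor:
  "set_attractor Y I g \<in> hyperspace Y \<and> set_attractor Y I g = (\<Union>a\<in>I. g a ` set_attractor Y I g)"
proof -
  interpret H: Metric_space "hyperspace Y" "hausdorff_dist Y" by (rule Metric_space_hyper)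
  let ?T = "\<lambda>A. \<Union>a\<in>I. g a ` A"
  have im: "g a ` A \<in> hyperspace Y" if "a \<in> I" "A \<in> hyperspace Y" for a A
    using hyperspace_image[OF lipschitz_map_imp_continuous[OF lip]] that by blast
  have T: "?T \<in> hyperspace Y \<rightarrow> hyperspace Y"
    using I im by (auto intro: hyperspace_UN)
  have con: "hausdorff_dist Y (?T A) (?T B) \<le> l * hausdorff_dist Y A B"
    if "A \<in> hyperspace Y" "B \<in> hyperspace Y" for A B
    using that by (intro hausdorff_dist_UN_le I im hausdorff_dist_image_le lip l) auto
  have "\<exists>!A. A \<in> hyperspace Y \<and> A = ?T A"
  proof -
    obtain A where A: "A \<in> hyperspace Y" "?T A = A"
    proof (rule H.Banach_fixedpoint_thm[OF mcomplete_hyper[OF cpt] _ T l(2) con])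
      show "hyperspace Y \<noteq> {}"
        using hyperspace_mspace[OF cpt Y_ne] by blast
    qed
    moreover have "B = A" if "B \<in> hyperspace Y" "B = ?T B" for B
      by (rule H.contraction_imp_unique_fixpoint[of ?T, OF that(2)[symmetric] A(2) T l(2) con that(1) A(1)])
    moreover have "A \<in> hyperspace Y \<and> A = ?T A"
      using A(1) A(2)[symmetric] by (rule conjI)
    ultimately show ?thesis
      by (intro ex1I[of _ A]) (assumption, elim conjE)
  qed
  then show ?thesis
    unfolding set_attractor_def by (rule theI')
qed

text \<open>The composition of the first \<open>k\<close> maps along \<open>\<omega>\<close>,
  applied to \<open>x\<close>. The newest map is applied innermost, which is what makes the sequence
  in \<open>k\<close> converge.\<close>

primrec address_approx :: "'a \<Rightarrow> nat \<Rightarrow> (nat \<Rightarrow> 'i) \<Rightarrow> 'a" where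
  "address_approx x 0 \<omega> = x"
| "address_approx x (Suc k) \<omega> = g (\<omega> 0) (address_approx x k (\<lambda>n. \<omega> (Suc n)))"

definition base_point :: 'a where
  "base_point = (SOME x. x \<in> mspace Y)"

definition address_map :: "(nat \<Rightarrow> 'i) \<Rightarrow> 'a" where
  "address_map \<omega> = (THE y. limitin (mtopology_of Y) (\<lambda>k. address_approx base_point k \<omega>) y sequentially)"

lemma base_point: "base_point \<in> mspace Y"
  unfolding base_point_def using Y_ne by (simp add: some_in_eq)

lemma address_approx_mspace: "range \<omega> \<subseteq> I \<Longrightarrow> address_approx base_point k \<omega> \<in> mspace Y"
proof (induction k arbitrary: \<omega>)
  case (Suc k)
  have "range (\<lambda>n. \<omega> (Suc n)) \<subseteq> I" "\<omega> 0 \<in> I" using Suc.prems by auto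
  then show ?case
    using Suc.IH[of "\<lambda>n. \<omega> (Suc n)"] lip[of "\<omega> 0"] by (simp add: lipschitz_map_def Pi_iff)
qed (simp add: base_point)

text \<open>With \<open>\<omega> = \<omega>'\<close> this is the Cauchy property; for sequences
  agreeing up to \<open>k\<close> it is the uniform continuity of
  \<open>address_map\<close>.\<close>

lemma address_approx_near:
  assumes D: "\<And>x y. x \<in> mspace Y \<Longrightarrow> y \<in> mspace Y \<Longrightarrow> mdist Y x y \<le> D"
    and "range \<omega> \<subseteq> I" "range \<omega>' \<subseteq> I" "\<And>n. n < k \<Longrightarrow> \<omega> n = \<omega>' n"
  shows "mdist Y (address_approx base_point (k + i) \<omega>) (address_approx base_point (k + j) \<omega>') \<le> l ^ k * D"
  using assms(2-)
proof (induction k arbitrary: \<omega> \<omega>')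
  case 0
  then show ?case using D address_approx_mspace by simp
next
  case (Suc k)
  let ?s = "\<lambda>\<omega> n. \<omega> (Suc n) :: 'i"
  have r: "range (?s \<omega>) \<subseteq> I" "range (?s \<omega>') \<subseteq> I" "\<omega> 0 \<in> I" using Suc.prems by auto
  have "mdist Y (address_approx base_point (k + i) (?s \<omega>)) (address_approx base_point (k + j) (?s \<omega>')) \<le> l ^ k * D"
    using Suc.prems by (intro Suc.IH) auto
  then have "l * mdist Y (address_approx base_point (k + i) (?s \<omega>)) (address_approx base_point (k + j) (?s \<omega>'))
      \<le> l * (l ^ k * D)"
    using l by (intro mult_left_mono)
  moreover have "mdist Y (g (\<omega> 0) (address_approx base_point (k + i) (?s \<omega>)))
       (g (\<omega> 0) (address_approx base_point (k + j) (?s \<omega>')))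
      \<le> l * mdist Y (address_approx base_point (k + i) (?s \<omega>)) (address_approx base_point (k + j) (?s \<omega>'))"
    using lip[OF r(3)] address_approx_mspace[OF r(1)] address_approx_mspace[OF r(2)]
    by (simp add: lipschitz_map_def)
  ultimately show ?case
    using Suc.prems(3)[of 0] by simp
qed

lemma limitin_address_map:
  assumes "range \<omega> \<subseteq> I"
  shows "limitin (mtopology_of Y) (\<lambda>k. address_approx base_point k \<omega>) (address_map \<omega>) sequentially"
proof -
  interpret Y: Metric_space "mspace Y" "mdist Y" by simp
  obtain D where D: "0 \<le> D" "\<And>x y. x \<in> mspace Y \<Longrightarrow> y \<in> mspace Y \<Longrightarrow> mdist Y x y \<le> D"
    by (rule compact_diameter[OF cpt]) blast
  have "\<exists>y. limitin (mtopology_of Y) (\<lambda>k. address_approx base_point k \<omega>) y sequentially"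
    by (rule geometric_Cauchy_limit[OF cpt l address_approx_mspace[OF assms]
          address_approx_near[OF _ assms assms refl]]) (rule D(2))
  then have "\<exists>!y. limitin (mtopology_of Y) (\<lambda>k. address_approx base_point k \<omega>) y sequentially"
    using Y.limitin_metric_unique unfolding mtopology_of_def by (metis sequentially_bot)
  then show ?thesis
    unfolding address_map_def by (rule theI')
qed

lemma address_map_mspace: "range \<omega> \<subseteq> I \<Longrightarrow> address_map \<omega> \<in> mspace Y"
  using limitin_topspace[OF limitin_address_map] by simp

lemma code_map_address_map: "code_map UNIV I Y address_map"
  unfolding code_map_def
proof (intro conjI allI impI)
  show "address_map \<in> (UNIV \<rightarrow>\<^sub>E I) \<rightarrow> mspace Y"
    by (auto simp: PiE_iff intro: address_map_mspace)
next
  fix e :: real assume e: "0 < e"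
  obtain D where D: "0 \<le> D" "\<And>x y. x \<in> mspace Y \<Longrightarrow> y \<in> mspace Y \<Longrightarrow> mdist Y x y \<le> D"
    by (rule compact_diameter[OF cpt]) blast
  have "(\<lambda>k. l ^ k * D) \<longlonglongrightarrow> 0"
    using tendsto_mult_left_zero[OF LIMSEQ_power_zero[of l], of D] l by simp
  then have "eventually (\<lambda>k. l ^ k * D < e) sequentially"
    using e by (intro order_tendstoD(2)[where y = 0])
  then obtain k where k: "l ^ k * D < e"
    by (auto simp: eventually_sequentially)
  have "mdist Y (address_map \<omega>) (address_map \<omega>') < e"
    if "\<omega> \<in> UNIV \<rightarrow>\<^sub>E I" "\<omega>' \<in> UNIV \<rightarrow>\<^sub>E I" "\<forall>j\<in>{..<k}. \<omega> j = \<omega>' j" for \<omega> \<omega>'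
  proof -
    have r: "range \<omega> \<subseteq> I" "range \<omega>' \<subseteq> I" using that by (auto simp: PiE_iff)
    have "mdist Y (address_map \<omega>) (address_map \<omega>') \<le> l ^ k * D"
    proof (rule limitin_limitin_mdist_le[OF limitin_address_map[OF r(1)] limitin_address_map[OF r(2)]])
      fix n m assume "k \<le> n" "k \<le> m"
      then show "mdist Y (address_approx base_point n \<omega>) (address_approx base_point m \<omega>') \<le> l ^ k * D"
        using address_approx_near[OF D(2) r, of k "n - k" "m - k"] that by simp
    qed (rule address_approx_mspace[OF r(2)])
    with k show ?thesis by linarith
  qed
  then show "\<exists>J0\<subseteq>UNIV. finite J0 \<and> (\<forall>\<sigma>\<in>UNIV \<rightarrow>\<^sub>E I. \<forall>\<tau>\<in>UNIV \<rightarrow>\<^sub>E I.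
       (\<forall>j\<in>J0. \<sigma> j = \<tau> j) \<longrightarrow> mdist Y (address_map \<sigma>) (address_map \<tau>) < e)"
    by (intro exI[of _ "{..<k}"]) auto
qed

text \<open>Prepending a symbol shifts the approximations by one and applies the continuous map
  \<open>g a\<close> to them, so the identity holds in the limit. It is the source of the invariance
  of the image of a Bernoulli measure.\<close>

lemma address_map_case_nat:
  assumes a: "a \<in> I" and \<omega>: "range \<omega> \<subseteq> I"
  shows "address_map (case_nat a \<omega>) = g a (address_map \<omega>)"
proof -
  interpret Y: Metric_space "mspace Y" "mdist Y" by simp
  have r: "range (case_nat a \<omega>) \<subseteq> I"
    using assms by (auto simp: image_subset_iff split: nat.split)
  have "limitin (mtopology_of Y) (\<lambda>k. g a (address_approx base_point k \<omega>)) (g a (address_map \<omega>)) sequentially"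
    using continuous_map_limit[OF lipschitz_map_imp_continuous[OF lip[OF a]] limitin_address_map[OF \<omega>]]
    by (simp add: o_def)
  then have "limitin (mtopology_of Y) (\<lambda>k. address_approx base_point (k + 1) (case_nat a \<omega>)) (g a (address_map \<omega>)) sequentially"
    by simp
  then have "limitin (mtopology_of Y) (\<lambda>k. address_approx base_point k (case_nat a \<omega>)) (g a (address_map \<omega>)) sequentially"
    by (rule limitin_sequentially_offset_rev)
  with limitin_address_map[OF r] show ?thesis
    unfolding mtopology_of_def by (rule Y.limitin_metric_unique) simp
qed

end

section \<open>Finite mixtures of image measures\<close>

lemma prob_space_point_measure_real:
  assumes "finite I" "\<And>a. a \<in> I \<Longrightarrow> 0 \<le> p a" "(\<Sum>a\<in>I. p a) = (1::real)"
  shows "prob_space (point_measure I (\<lambda>a. ennreal (p a)))"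
  using assms by (intro prob_space_point_measure) (auto simp flip: ennreal_1)

lemma measurable_pair_point_measure:
  assumes "finite I" "\<And>a. a \<in> I \<Longrightarrow> G a \<in> S \<rightarrow>\<^sub>M T"
  shows "(\<lambda>(a, x). G a x) \<in> point_measure I p \<Otimes>\<^sub>M S \<rightarrow>\<^sub>M T"
proof -
  have "(\<lambda>(a, x). G a x) \<in> count_space I \<Otimes>\<^sub>M S \<rightarrow>\<^sub>M T"
    using assms by (intro measurable_pair_measure_countable1) (auto intro: countable_finite)
  then show ?thesis
    by (simp cong: measurable_cong_sets sets_pair_measure_cong add: sets_point_measure)
qed

text \<open>The law of \<open>G a x\<close> with \<open>a\<close> drawn by \<open>p\<close> and,
  independently, \<open>x\<close> by \<open>S\<close>. It serves twice: with \<open>S\<close> an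
  invariant measure, to pass from sets to integrals, and with \<open>S\<close> a Bernoulli measure,
  to verify invariance.\<close>

locale finite_mixture = S: prob_space S
  for I :: "'i set" and p :: "'i \<Rightarrow> real" and S :: "'a measure" and T :: "'b measure"
    and G :: "'i \<Rightarrow> 'a \<Rightarrow> 'b" +
  assumes I: "finite I" and p: "\<And>a. a \<in> I \<Longrightarrow> 0 \<le> p a" "(\<Sum>a\<in>I. p a) = 1"
    and G: "\<And>a. a \<in> I \<Longrightarrow> G a \<in> S \<rightarrow>\<^sub>M T"
begin

abbreviation "Q \<equiv> point_measure I (\<lambda>a. ennreal (p a))"

sublocale Q: prob_space Q
  using I p by (rule prob_space_point_measure_real)

sublocale QS: pair_prob_space Q S ..

definition "mixture = distr (Q \<Otimes>\<^sub>M S) T (\<lambda>(a, x). G a x)"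

lemma G_pair: "(\<lambda>(a, x). G a x) \<in> Q \<Otimes>\<^sub>M S \<rightarrow>\<^sub>M T"
  using I G by (rule measurable_pair_point_measure)

lemma prob_space_mixture: "prob_space mixture"
  unfolding mixture_def by (rule QS.prob_space_distr[OF G_pair])

lemma measure_mixture:
  assumes B: "B \<in> sets T"
  shows "measure mixture B = (\<Sum>a\<in>I. p a * measure (distr S T (G a)) B)"
proof -
  let ?E = "(\<lambda>(a, x). G a x) -` B \<inter> space (Q \<Otimes>\<^sub>M S)"
  have "emeasure mixture B = emeasure (Q \<Otimes>\<^sub>M S) ?E"
    unfolding mixture_def using B G_pair by (rule emeasure_distr[rotated])
  also have "\<dots> = (\<integral>\<^sup>+a. emeasure S (Pair a -` ?E) \<partial>Q)"
    using measurable_sets[OF G_pair B] by (rule S.emeasure_pair_measure_alt)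
  also have "\<dots> = (\<Sum>a\<in>I. ennreal (p a) * emeasure S (Pair a -` ?E))"
    by (rule nn_integral_point_measure_finite[OF I])
  also have "\<dots> = (\<Sum>a\<in>I. ennreal (p a * measure (distr S T (G a)) B))"
  proof (rule sum.cong)
    fix a assume a: "a \<in> I"
    have "Pair a -` ?E = G a -` B \<inter> space S"
      using a by (auto simp: space_pair_measure space_point_measure)
    then have "emeasure S (Pair a -` ?E) = ennreal (measure (distr S T (G a)) B)"
      using B G[OF a] by (simp add: measure_distr S.emeasure_eq_measure)
    then show "ennreal (p a) * emeasure S (Pair a -` ?E) = ennreal (p a * measure (distr S T (G a)) B)"
      using p(1)[OF a] by (simp add: ennreal_mult)
  qed simp
  also have "\<dots> = ennreal (\<Sum>a\<in>I. p a * measure (distr S T (G a)) B)"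
    using p by (intro sum_ennreal) auto
  finally show ?thesis
    using p by (simp add: measure_def sum_nonneg)
qed

lemma integral_mixture:
  fixes h :: "'b \<Rightarrow> real"
  assumes h: "h \<in> borel_measurable T" and bound: "\<And>x. x \<in> space T \<Longrightarrow> \<bar>h x\<bar> \<le> C"
  shows "(\<integral>x. h x \<partial>mixture) = (\<Sum>a\<in>I. p a * (\<integral>x. h (G a x) \<partial>S))"
proof -
  have hG: "(\<lambda>(a, x). h (G a x)) \<in> borel_measurable (Q \<Otimes>\<^sub>M S)"
    using measurable_compose[OF G_pair h] by (simp add: split_beta)
  have "(\<integral>x. h x \<partial>mixture) = (\<integral>z. (case z of (a, x) \<Rightarrow> h (G a x)) \<partial>(Q \<Otimes>\<^sub>M S))"
    unfolding mixture_def by (subst integral_distr[OF G_pair h]) (simp add: case_prod_unfold)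
  also have "\<dots> = (\<integral>a. \<integral>x. h (G a x) \<partial>S \<partial>Q)"
  proof (rule QS.integral_fst[symmetric])
    show "integrable (Q \<Otimes>\<^sub>M S) (\<lambda>(a, x). h (G a x))"
    proof (rule QS.integrable_const_bound[OF AE_I2 hG, of C])
      fix z assume "z \<in> space (Q \<Otimes>\<^sub>M S)"
      then obtain a x where "z = (a, x)" "a \<in> I" "x \<in> space S"
        by (auto simp: space_pair_measure space_point_measure)
      then show "norm (case z of (a, x) \<Rightarrow> h (G a x)) \<le> C"
        using bound measurable_space[OF G] by auto
    qed
  qed
  also have "\<dots> = (\<Sum>a\<in>I. p a * (\<integral>x. h (G a x) \<partial>S))"
    using I p by (subst lebesgue_integral_point_measure_finite) auto
  finally show ?thesis .
qed

end

lemma continuous_map_borel_measurable: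
  assumes "continuous_map (mtopology_of Y) (mtopology_of Z) g"
  shows "g \<in> metric_borel Y \<rightarrow>\<^sub>M metric_borel Z"
proof -
  have "g \<in> metric_borel Y \<rightarrow>\<^sub>M sigma (mspace Z) {U. openin (mtopology_of Z) U}"
  proof (rule measurable_measure_of)
    show "g \<in> space (metric_borel Y) \<rightarrow> mspace Z"
      using assms continuous_map_image_subset_topspace by fastforce
    fix U assume "U \<in> {U. openin (mtopology_of Z) U}"
    then have "openin (mtopology_of Y) {x \<in> topspace (mtopology_of Y). g x \<in> U}"
      by (intro openin_continuous_map_preimage[OF assms]) simp
    moreover have "g -` U \<inter> space (metric_borel Y) = {x \<in> topspace (mtopology_of Y). g x \<in> U}"
      by auto
    ultimately show "g -` U \<inter> space (metric_borel Y) \<in> sets (metric_borel Y)"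
      by (simp add: sets_metric_borel sigma_sets.Basic)
  qed (use openin_subset[of "mtopology_of Z"] in auto)
  then show ?thesis by (simp add: metric_borel_def)
qed

section \<open>Invariant measures\<close>

locale contractive_IFS_prob = contractive_IFS +
  fixes p :: "'b \<Rightarrow> real"
  assumes p: "\<And>a. a \<in> I \<Longrightarrow> 0 \<le> p a" "(\<Sum>a\<in>I. p a) = 1"
begin

lemma g_measurable: "a \<in> I \<Longrightarrow> g a \<in> metric_borel Y \<rightarrow>\<^sub>M metric_borel Y"
  by (rule continuous_map_borel_measurable[OF lipschitz_map_imp_continuous[OF lip]])

definition invariant :: "'a measure \<Rightarrow> bool" where
  "invariant \<mu> \<longleftrightarrow> \<mu> \<in> borel_probs Y \<and>
     (\<forall>B\<in>sets (metric_borel Y). measure \<mu> B = (\<Sum>a\<in>I. p a * measure (distr \<mu> (metric_borel Y) (g a)) B))"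

text \<open>Invariance says that \<open>\<mu>\<close> and the mixture agree on Borel sets, hence are
  equal as measures; Fubini for the mixture then gives the integral form.\<close>

lemma invariant_integral:
  fixes h :: "'a \<Rightarrow> real"
  assumes \<mu>: "invariant \<mu>" and h: "lipschitz_map L Y euclidean_metric h"
  shows "(\<integral>x. h x \<partial>\<mu>) = (\<Sum>a\<in>I. p a * (\<integral>x. h (g a x) \<partial>\<mu>))"
proof -
  have \<mu>': "\<mu> \<in> borel_probs Y" using \<mu> by (simp add: invariant_def)
  interpret \<mu>: prob_space \<mu> by (rule borel_probsD[OF \<mu>'])
  interpret finite_mixture I p \<mu> "metric_borel Y" g
    using I p g_measurable
    by unfold_locales (auto simp: measurable_cong_sets[OF borel_probsD(2)[OF \<mu>'] refl])
  interpret mix: prob_space mixture by (rule prob_space_mixture)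
  have "\<mu> = mixture"
  proof (rule measure_eqI)
    show "sets \<mu> = sets mixture"
      by (simp add: mixture_def borel_probsD[OF \<mu>'])
    fix B assume "B \<in> sets \<mu>"
    then have "measure \<mu> B = measure mixture B"
      using \<mu> by (simp add: measure_mixture invariant_def borel_probsD[OF \<mu>'])
    then show "emeasure \<mu> B = emeasure mixture B"
      by (simp add: \<mu>.emeasure_eq_measure mix.emeasure_eq_measure)
  qed
  obtain x0 where x0: "x0 \<in> mspace Y" using Y_ne by blast
  obtain D where D: "0 \<le> D" "\<And>x y. x \<in> mspace Y \<Longrightarrow> y \<in> mspace Y \<Longrightarrow> mdist Y x y \<le> D"
    by (rule compact_diameter[OF cpt]) blast
  have "(\<integral>x. h x \<partial>mixture) = (\<Sum>a\<in>I. p a * (\<integral>x. h (g a x) \<partial>\<mu>))"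
  proof (rule integral_mixture[OF lipschitz_map_borel_measurable[OF h]])
    fix x assume "x \<in> space (metric_borel Y)"
    then have x: "x \<in> mspace Y" by simp
    have "\<bar>h x - h x0\<bar> \<le> L * mdist Y x x0"
      using h x x0 by (auto simp: lipschitz_map_def dist_real_def)
    also have "\<dots> \<le> \<bar>L\<bar> * D"
      using D x x0 by (intro mult_mono) auto
    finally show "\<bar>h x\<bar> \<le> \<bar>h x0\<bar> + \<bar>L\<bar> * D" by linarith
  qed
  then show ?thesis
    using \<open>\<mu> = mixture\<close> by simp
qed

text \<open>Composition with \<open>g a\<close> multiplies Lipschitz constants by \<open>l\<close>,
  so the Monge--Kantorovitch distance of two invariant measures is at most \<open>l\<close> times
  itself and vanishes.\<close>

lemma invariant_unique:
  assumes \<mu>: "invariant \<mu>" and \<nu>: "invariant \<nu>"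
  shows "\<mu> = \<nu>"
proof -
  have \<mu>': "\<mu> \<in> borel_probs Y" and \<nu>': "\<nu> \<in> borel_probs Y"
    using \<mu> \<nu> by (simp_all add: invariant_def)
  interpret MK: Metric_space "borel_probs Y" "mk_dist Y" by (rule Metric_space_prob[OF cpt])
  have "mk_dist Y \<mu> \<nu> \<le> l * mk_dist Y \<mu> \<nu>"
  proof (rule mk_dist_le[OF cpt \<mu>' \<nu>'])
    fix h :: "'a \<Rightarrow> real" assume h: "lipschitz_map 1 Y euclidean_metric h"
    have "(\<integral>x. h (g a x) \<partial>\<mu>) - (\<integral>x. h (g a x) \<partial>\<nu>) \<le> l * mk_dist Y \<mu> \<nu>" if a: "a \<in> I" for a
    \<comment> \<open>The general case rescales \<open>h (g a x)\<close> by \<open>1/l\<close> to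
      have constant \<open>1\<close>. For \<open>l = 0\<close> the map \<open>g a\<close> is
      constant, so both integrals are the same number.\<close>
    proof (cases "l = 0")
      case True
      obtain x0 where x0: "x0 \<in> mspace Y" using Y_ne by blast
      have const: "h (g a x) = h (g a x0)" if "x \<in> mspace Y" for x
      proof -
        have "g a x \<in> mspace Y" "g a x0 \<in> mspace Y" "mdist Y (g a x) (g a x0) \<le> 0"
          using lip[OF a] that x0 True by (auto simp: lipschitz_map_def)
        then show ?thesis
          using mdist_zero[of "g a x" Y "g a x0"] mdist_nonneg[of Y "g a x" "g a x0"] by simp
      qed
      have "(\<integral>x. h (g a x) \<partial>\<kappa>) = h (g a x0)" if "\<kappa> \<in> borel_probs Y" for \<kappa>
      proof -
        interpret prob_space \<kappa> by (rule borel_probsD[OF that])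
        have "(\<integral>x. h (g a x) \<partial>\<kappa>) = (\<integral>x. h (g a x0) \<partial>\<kappa>)"
          using const by (intro Bochner_Integration.integral_cong) (auto simp: borel_probsD[OF that])
        then show ?thesis by (simp add: prob_space)
      qed
      then show ?thesis using \<mu>' \<nu>' True by simp
    next
      case False
      have "lipschitz_map l Y euclidean_metric (\<lambda>x. h (g a x))"
        unfolding lipschitz_map_def
      proof (intro conjI ballI)
        fix x y assume xy: "x \<in> mspace Y" "y \<in> mspace Y"
        have "mdist euclidean_metric (h (g a x)) (h (g a y)) \<le> mdist Y (g a x) (g a y)"
          using h lip[OF a] xy by (auto simp: lipschitz_map_def)
        also have "\<dots> \<le> l * mdist Y x y"
          using lip[OF a] xy by (auto simp: lipschitz_map_def)
        finally show "mdist euclidean_metric (h (g a x)) (h (g a y)) \<le> l * mdist Y x y" .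
      qed simp
      then have "lipschitz_map 1 Y euclidean_metric (\<lambda>x. 1/l * h (g a x))"
        using lipschitz_map_scale[of l Y "\<lambda>x. h (g a x)" "1/l"] l False by simp
      from mk_dist_upper[OF cpt \<mu>' \<nu>' this]
      show ?thesis
        using l False by (simp add: field_simps)
    qed
    then have "(\<Sum>a\<in>I. p a * ((\<integral>x. h (g a x) \<partial>\<mu>) - (\<integral>x. h (g a x) \<partial>\<nu>))) \<le> (\<Sum>a\<in>I. p a * (l * mk_dist Y \<mu> \<nu>))"
      using p by (intro sum_mono mult_left_mono) auto
    also have "\<dots> = l * mk_dist Y \<mu> \<nu>"
      using p by (simp flip: sum_distrib_right)
    finally show "(\<integral>x. h x \<partial>\<mu>) - (\<integral>x. h x \<partial>\<nu>) \<le> l * mk_dist Y \<mu> \<nu>"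
      unfolding invariant_integral[OF \<mu> h] invariant_integral[OF \<nu> h]
      by (simp add: sum_subtractf right_diff_distrib)
  qed
  then have "mk_dist Y \<mu> \<nu> = 0"
    using l MK.nonneg[of \<mu> \<nu>] by (smt (verit, best) mult_le_cancel_right1)
  then show ?thesis
    using MK.zero[OF \<mu>' \<nu>'] by simp
qed

text \<open>The candidate is the image of the Bernoulli measure under \<open>address_map\<close>.
  Prepending an independent symbol preserves the Bernoulli measure, and under
  \<open>address_map\<close> this becomes the application of a random \<open>g a\<close>.\<close>

lemma invariant_exists: "\<exists>\<mu>. invariant \<mu>"
proof -
  let ?Q = "point_measure I (\<lambda>a. ennreal (p a))"
  interpret Q: prob_space ?Q
    using I p by (intro prob_space_point_measure_real) auto
  interpret seq: sequence_space ?Q ..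
  have prob_S: "prob_space seq.S" by (rule prob_space_PiM) unfold_locales
  have spS: "space seq.S = (UNIV \<rightarrow>\<^sub>E I)"
    by (simp add: space_PiM space_point_measure)
  have am: "address_map \<in> seq.S \<rightarrow>\<^sub>M metric_borel Y"
    using I by (intro code_map_measurable[OF code_map_address_map]) auto
  interpret finite_mixture I p seq.S "metric_borel Y" "\<lambda>a \<omega>. g a (address_map \<omega>)"
    using I p measurable_compose[OF am g_measurable] prob_S by unfold_locales (auto dest: prob_space.emeasure_space_1)
  let ?\<mu> = "distr seq.S (metric_borel Y) address_map"
  have "?\<mu> = distr (distr (?Q \<Otimes>\<^sub>M seq.S) seq.S (\<lambda>(s, \<omega>). case_nat s \<omega>)) (metric_borel Y) address_map"
    by (simp only: seq.PiM_iter)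
  also have "\<dots> = distr (?Q \<Otimes>\<^sub>M seq.S) (metric_borel Y) (address_map \<circ> (\<lambda>(s, \<omega>). case_nat s \<omega>))"
    by (rule distr_distr[OF am]) measurable
  also have "\<dots> = mixture"
    unfolding mixture_def
    by (intro distr_cong) (auto simp: space_pair_measure space_point_measure spS PiE_iff
        intro!: address_map_case_nat)
  finally have eq: "?\<mu> = mixture" .
  have "invariant ?\<mu>"
    unfolding invariant_def
  proof (intro conjI ballI)
    show "?\<mu> \<in> borel_probs Y"
      using prob_space.prob_space_distr[OF prob_S am] by (simp add: borel_probs_def)
    fix B assume "B \<in> sets (metric_borel Y)"
    then have "measure ?\<mu> B = (\<Sum>a\<in>I. p a * measure (distr seq.S (metric_borel Y) (\<lambda>\<omega>. g a (address_map \<omega>))) B)"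
      unfolding eq by (rule measure_mixture)
    also have "\<dots> = (\<Sum>a\<in>I. p a * measure (distr ?\<mu> (metric_borel Y) (g a)) B)"
      using am g_measurable by (intro sum.cong refl) (simp add: distr_distr o_def)
    finally show "measure ?\<mu> B = (\<Sum>a\<in>I. p a * measure (distr ?\<mu> (metric_borel Y) (g a)) B)" .
  qed
  then show ?thesis ..
qed

lemma invariant_measure_attractor: "invariant (measure_attractor Y I g p)"
proof -
  have "\<exists>!\<mu>. invariant \<mu>"
    using invariant_exists invariant_unique by blast
  then have "invariant (THE \<mu>. invariant \<mu>)"
    by (rule theI')
  then show ?thesis
    by (simp add: measure_attractor_def invariant_def[abs_def])
qed

end

section \<open>Code trees and their fractals\<close>

locale superIFS =
  fixes X :: "'a metric" and M N :: nat and l :: real and f :: "nat \<Rightarrow> nat \<Rightarrow> 'a \<Rightarrow> 'a"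
  assumes cpt: "compact_space (mtopology_of X)" and X_ne: "mspace X \<noteq> {}"
    and M: "1 \<le> M" and N: "1 \<le> N" and l: "0 \<le> l" "l < 1"
    and lip: "\<And>m n. m \<in> {1..M} \<Longrightarrow> n \<in> {1..N} \<Longrightarrow> lipschitz_map l X X (f m n)"
begin

text \<open>The common form of both recursions: the fractal of a code tree at its root
  (\<open>fractal_root\<close>) and a coordinate of \<open>V_map\<close>
  (\<open>V_map_apply\<close>). Comparing the two reduces to comparing the arguments
  \<open>x\<close>.\<close>

definition branch :: "nat \<Rightarrow> (nat \<Rightarrow> 'a set) \<Rightarrow> 'a set" where
  "branch n x = (\<Union>m\<in>{1..M}. f m n ` x m)"

definition subtree :: "(nat list \<Rightarrow> nat) \<Rightarrow> nat list \<Rightarrow> nat list \<Rightarrow> nat" where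
  "subtree \<sigma> w = (\<lambda>u\<in>words M. \<sigma> (w @ u))"

definition level :: "nat \<Rightarrow> nat list set" where
  "level k = {w \<in> words M. length w = k}"

abbreviation "fractal \<equiv> tree_fractal X M f"

lemma words_Nil [simp]: "[] \<in> words M"
  and words_Cons [simp]: "m # w \<in> words M \<longleftrightarrow> m \<in> {1..M} \<and> w \<in> words M"
  and words_append [simp]: "u @ w \<in> words M \<longleftrightarrow> u \<in> words M \<and> w \<in> words M"
  by (auto simp: words_def)

lemma words_take: "w \<in> words M \<Longrightarrow> take j w \<in> words M"
  by (auto simp: words_def dest: in_set_takeD)

lemma level_0 [simp]: "level 0 = {[]}"
  by (auto simp: level_def)

text \<open>Words are extended at the end, from parent to child, because a placement of level
  \<open>k\<close> into buffers is continued to the children; the recursion for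
  \<open>level_set\<close> instead splits off the first letter.\<close>

lemma level_Suc: "level (Suc k) = (\<lambda>(w, m). w @ [m]) ` (level k \<times> {1..M})"
proof (intro equalityI subsetI)
  fix w assume "w \<in> level (Suc k)"
  then have "w \<noteq> []" "w \<in> words M" "length w = Suc k" by (auto simp: level_def)
  then have "w = (\<lambda>(w, m). w @ [m]) (butlast w, last w)" "butlast w \<in> level k" "last w \<in> {1..M}"
    by (auto simp: level_def words_def dest: in_set_butlastD)
  then show "w \<in> (\<lambda>(w, m). w @ [m]) ` (level k \<times> {1..M})" by blast
qed (auto simp: level_def)

lemma level_SucE:
  assumes "u \<in> level (Suc k)"
  obtains w m where "u = w @ [m]" "w \<in> level k" "m \<in> {1..M}"
  using assms unfolding level_Suc by auto

lemma finite_level [simp]: "finite (level k)"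
  by (induction k) (simp_all add: level_Suc)

lemma card_level: "card (level k) = M ^ k"
  using card_lists_length_eq[of "{1..M}" k]
  by (simp add: level_def words_def lists_eq_set)

lemma level_subset_words: "level k \<subseteq> words M"
  by (auto simp: level_def)

lemma level_snoc [simp]: "w \<in> level k \<Longrightarrow> m \<in> {1..M} \<Longrightarrow> w @ [m] \<in> level (Suc k)"
  by (auto simp: level_def)

lemma subtree_code_trees: "\<sigma> \<in> code_trees M N \<Longrightarrow> w \<in> words M \<Longrightarrow> subtree \<sigma> w \<in> code_trees M N"
  by (auto simp: code_trees_def subtree_def PiE_iff)

lemma subtree_subtree:
  "w \<in> words M \<Longrightarrow> u \<in> words M \<Longrightarrow> subtree (subtree \<sigma> w) u = subtree \<sigma> (w @ u)"
  by (auto simp: subtree_def fun_eq_iff)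

lemma subtree_Nil: "\<sigma> \<in> code_trees M N \<Longrightarrow> subtree \<sigma> [] = \<sigma>"
  by (auto simp: subtree_def code_trees_def PiE_iff extensional_def fun_eq_iff)

lemma subtree_root [simp]: "subtree \<sigma> w [] = \<sigma> w"
  by (simp add: subtree_def)

lemma code_tree_mem: "\<sigma> \<in> code_trees M N \<Longrightarrow> w \<in> words M \<Longrightarrow> \<sigma> w \<in> {1..N}"
  by (auto simp: code_trees_def PiE_iff)

lemma path_map_Cons:
  assumes "i \<in> words M"
  shows "path_map f \<sigma> (m # i) = f m (\<sigma> []) \<circ> path_map f (subtree \<sigma> [m]) i"
proof -
  \<comment> \<open>Index \<open>0\<close> gives the root factor; at the index \<open>Suc j\<close>
    the prefix is \<open>m # take j i\<close>, which is the prefix \<open>take j i\<close> seen in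
    the subtree at \<open>[m]\<close>.\<close>
  have "[0..<length (m # i)] = 0 # map Suc [0..<length i]"
    by (simp add: map_Suc_upt upt_conv_Cons del: upt_Suc)
  then have "path_map f \<sigma> (m # i) =
      f m (\<sigma> []) \<circ> foldr (\<lambda>j g. f (i ! j) (\<sigma> (m # take j i)) \<circ> g) [0..<length i] id"
    by (simp add: path_map_def foldr_map o_def)
  also have "foldr (\<lambda>j g. f (i ! j) (\<sigma> (m # take j i)) \<circ> g) [0..<length i] id
      = path_map f (subtree \<sigma> [m]) i"
    using words_take[OF assms] by (simp add: path_map_def subtree_def)
  finally show ?thesis .
qed

lemma level_set_0 [simp]: "level_set M f \<sigma> K 0 = K"
  by (auto simp: level_set_def path_map_def)

lemma level_set_Suc:
  "level_set M f \<sigma> K (Suc k) = branch (\<sigma> []) (\<lambda>m. level_set M f (subtree \<sigma> [m]) K k)"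
proof -
  have *: "{i \<in> words M. length i = Suc k} = (\<Union>m\<in>{1..M}. (#) m ` {i \<in> words M. length i = k})"
  proof (rule set_eqI)
    fix i show "i \<in> {i \<in> words M. length i = Suc k} \<longleftrightarrow>
        i \<in> (\<Union>m\<in>{1..M}. (#) m ` {i \<in> words M. length i = k})"
      by (cases i) auto
  qed
  have "level_set M f \<sigma> K (Suc k)
      = (\<Union>m\<in>{1..M}. \<Union>i\<in>{i \<in> words M. length i = k}. path_map f \<sigma> (m # i) ` K)"
    unfolding level_set_def * by simp
  also have "\<dots> = branch (\<sigma> []) (\<lambda>m. level_set M f (subtree \<sigma> [m]) K k)"
    by (simp add: level_set_def branch_def path_map_Cons image_UN image_comp)
  finally show ?thesis .
qed

lemma branch_hyperspace:
  assumes "n \<in> {1..N}" "\<And>m. m \<in> {1..M} \<Longrightarrow> x m \<in> hyperspace X"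
  shows "branch n x \<in> hyperspace X"
  unfolding branch_def
  using M assms hyperspace_image[OF lipschitz_map_imp_continuous[OF lip]] by (intro hyperspace_UN) auto

lemma hausdorff_dist_branch_le:
  assumes n: "n \<in> {1..N}"
    and x: "\<And>m. m \<in> {1..M} \<Longrightarrow> x m \<in> hyperspace X" and y: "\<And>m. m \<in> {1..M} \<Longrightarrow> y m \<in> hyperspace X"
    and r: "\<And>m. m \<in> {1..M} \<Longrightarrow> hausdorff_dist X (x m) (y m) \<le> r"
  shows "hausdorff_dist X (branch n x) (branch n y) \<le> l * r"
  unfolding branch_def
proof (rule hausdorff_dist_UN_le)
  fix m assume m: "m \<in> {1..M}"
  have "hausdorff_dist X (f m n ` x m) (f m n ` y m) \<le> l * hausdorff_dist X (x m) (y m)"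
    by (intro hausdorff_dist_image_le lip m n l x y)
  also have "\<dots> \<le> l * r"
    using r[OF m] l by (intro mult_left_mono) auto
  finally show "hausdorff_dist X (f m n ` x m) (f m n ` y m) \<le> l * r" .
qed (use M n x y hyperspace_image[OF lipschitz_map_imp_continuous[OF lip]] in auto)

text \<open>Some upper bound for all Hausdorff distances, rather than their supremum; it exists
  because the hyperspace is compact.\<close>

definition D :: real where
  "D = (SOME r. 0 \<le> r \<and> (\<forall>A\<in>hyperspace X. \<forall>B\<in>hyperspace X. hausdorff_dist X A B \<le> r))"

lemma D_nonneg: "0 \<le> D"
  and hausdorff_dist_le_D: "A \<in> hyperspace X \<Longrightarrow> B \<in> hyperspace X \<Longrightarrow> hausdorff_dist X A B \<le> D"
proof -
  obtain r where "0 \<le> r"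
    "\<And>A B. A \<in> mspace (hyper X) \<Longrightarrow> B \<in> mspace (hyper X) \<Longrightarrow> mdist (hyper X) A B \<le> r"
    by (rule compact_diameter[OF compact_space_hyper[OF cpt]]) blast
  then have "\<exists>r. 0 \<le> r \<and> (\<forall>A\<in>hyperspace X. \<forall>B\<in>hyperspace X. hausdorff_dist X A B \<le> r)"
    by (auto simp: mspace_hyper mdist_hyper)
  from someI_ex[OF this, folded D_def]
  show "0 \<le> D" "A \<in> hyperspace X \<Longrightarrow> B \<in> hyperspace X \<Longrightarrow> hausdorff_dist X A B \<le> D"
    by auto
qed

lemma level_set_hyperspace:
  "K \<in> hyperspace X \<Longrightarrow> \<sigma> \<in> code_trees M N \<Longrightarrow> level_set M f \<sigma> K k \<in> hyperspace X"
proof (induction k arbitrary: \<sigma>)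
  case (Suc k)
  then show ?case
    unfolding level_set_Suc
    by (intro branch_hyperspace code_tree_mem Suc.IH subtree_code_trees) auto
qed simp

text \<open>One induction on \<open>k\<close> for three purposes: the Cauchy property
  (\<open>i\<close> and \<open>j\<close> differ), independence of the initial set (\<open>K\<close>
  and \<open>L\<close> differ) and continuity in the code tree (\<open>\<sigma>\<close> and
  \<open>\<tau>\<close> agree above depth \<open>k\<close>).\<close>

lemma level_set_near:
  assumes "K \<in> hyperspace X" "L \<in> hyperspace X" "\<sigma> \<in> code_trees M N" "\<tau> \<in> code_trees M N"
    and "\<And>w. w \<in> words M \<Longrightarrow> length w < k \<Longrightarrow> \<sigma> w = \<tau> w"
  shows "hausdorff_dist X (level_set M f \<sigma> K (k + i)) (level_set M f \<tau> L (k + j)) \<le> l ^ k * D"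
  using assms
proof (induction k arbitrary: \<sigma> \<tau>)
  case 0
  then show ?case by (simp add: hausdorff_dist_le_D level_set_hyperspace)
next
  case (Suc k)
  have root: "\<sigma> [] = \<tau> []" using Suc.prems by simp
  have "hausdorff_dist X (branch (\<tau> []) (\<lambda>m. level_set M f (subtree \<sigma> [m]) K (k + i)))
      (branch (\<tau> []) (\<lambda>m. level_set M f (subtree \<tau> [m]) L (k + j))) \<le> l * (l ^ k * D)"
  proof (rule hausdorff_dist_branch_le)
    fix m assume m: "m \<in> {1..M}"
    then have s: "subtree \<sigma> [m] \<in> code_trees M N" "subtree \<tau> [m] \<in> code_trees M N"
      using Suc.prems by (auto intro!: subtree_code_trees)
    show "level_set M f (subtree \<sigma> [m]) K (k + i) \<in> hyperspace X"
      "level_set M f (subtree \<tau> [m]) L (k + j) \<in> hyperspace X"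
      using s Suc.prems by (auto intro: level_set_hyperspace)
    show "hausdorff_dist X (level_set M f (subtree \<sigma> [m]) K (k + i))
        (level_set M f (subtree \<tau> [m]) L (k + j)) \<le> l ^ k * D"
      using Suc.prems s m by (intro Suc.IH s) (auto simp: subtree_def)
  qed (use Suc.prems code_tree_mem in auto)
  then show ?case
    by (simp add: level_set_Suc root)
qed

text \<open>The defining \<open>THE\<close> asks for one limit common to all \<open>K\<close>; it
  has to be shown to exist and to be unique before anything is known about
  \<open>fractal\<close>.\<close>

lemma limitin_fractal:
  assumes \<sigma>: "\<sigma> \<in> code_trees M N" and K: "K \<in> hyperspace X"
  shows "limitin (mtopology_of (hyper X)) (level_set M f \<sigma> K) (fractal \<sigma>) sequentially"
proof -
  interpret H: Metric_space "mspace (hyper X)" "mdist (hyper X)" by simp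
  have near: "mdist (hyper X) (level_set M f \<sigma> K (k + i)) (level_set M f \<sigma> L (k + j)) \<le> l ^ k * D"
    if "K \<in> hyperspace X" "L \<in> hyperspace X" for K L k i j
    using level_set_near[OF that \<sigma> \<sigma>] by (simp add: mdist_hyper)
  have mem: "level_set M f \<sigma> K k \<in> mspace (hyper X)" if "K \<in> hyperspace X" for K k
    using level_set_hyperspace[OF that \<sigma>] by (simp add: mspace_hyper)
  have ex: "\<exists>A. limitin (mtopology_of (hyper X)) (level_set M f \<sigma> K) A sequentially"
    if "K \<in> hyperspace X" for K
    by (rule geometric_Cauchy_limit[OF compact_space_hyper[OF cpt] l mem[OF that] near[OF that that]])
  obtain A where A: "limitin (mtopology_of (hyper X)) (level_set M f \<sigma> K) A sequentially"
    using ex[OF K] by blast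
  have lim: "limitin (mtopology_of (hyper X)) (level_set M f \<sigma> L) A sequentially"
    if L: "L \<in> hyperspace X" for L
  proof -
    obtain B where B: "limitin (mtopology_of (hyper X)) (level_set M f \<sigma> L) B sequentially"
      using ex[OF L] by blast
    have le: "mdist (hyper X) A B \<le> l ^ k * D" for k
    proof (rule limitin_limitin_mdist_le[OF A B mem[OF L]])
      fix n m assume "k \<le> n" "k \<le> m"
      then show "mdist (hyper X) (level_set M f \<sigma> K n) (level_set M f \<sigma> L m) \<le> l ^ k * D"
        using near[OF K L, of k "n - k" "m - k"] by simp
    qed
    have "(\<lambda>k. l ^ k * D) \<longlonglongrightarrow> 0"
      using tendsto_mult_left_zero[OF LIMSEQ_power_zero[of l], of D] l by simp
    then have "mdist (hyper X) A B \<le> 0"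
      by (rule LIMSEQ_le_const) (use le in auto)
    then have "A = B"
      using limitin_topspace[OF A] limitin_topspace[OF B] mdist_nonneg[of "hyper X" A B]
        mdist_zero[of A "hyper X" B] by simp
    with B show ?thesis by simp
  qed
  have "\<exists>!A. \<forall>K\<in>hyperspace X. limitin (mtopology_of (hyper X)) (level_set M f \<sigma> K) A sequentially"
  proof (rule ex1I[of _ A])
    fix B assume "\<forall>K\<in>hyperspace X. limitin (mtopology_of (hyper X)) (level_set M f \<sigma> K) B sequentially"
    then have "limitin (mtopology_of (hyper X)) (level_set M f \<sigma> K) B sequentially"
      using K by blast
    with A show "B = A"
      using H.limitin_metric_unique[of "level_set M f \<sigma> K" B sequentially A]
      by (simp add: mtopology_of_def)
  qed (use lim in blast)
  then have "\<forall>K\<in>hyperspace X. limitin (mtopology_of (hyper X)) (level_set M f \<sigma> K) (fractal \<sigma>) sequentially"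
    unfolding tree_fractal_def by (rule theI')
  then show ?thesis using K by blast
qed

lemma X_hyperspace: "mspace X \<in> hyperspace X"
  by (rule hyperspace_mspace[OF cpt X_ne])

lemma fractal_hyperspace: "\<sigma> \<in> code_trees M N \<Longrightarrow> fractal \<sigma> \<in> hyperspace X"
  using limitin_topspace[OF limitin_fractal[OF _ X_hyperspace]] by (simp add: mspace_hyper)

lemma fractal_near:
  assumes "\<sigma> \<in> code_trees M N" "\<tau> \<in> code_trees M N"
    and "\<And>w. w \<in> words M \<Longrightarrow> length w < k \<Longrightarrow> \<sigma> w = \<tau> w"
  shows "hausdorff_dist X (fractal \<sigma>) (fractal \<tau>) \<le> l ^ k * D"
proof -
  have "mdist (hyper X) (fractal \<sigma>) (fractal \<tau>) \<le> l ^ k * D"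
  proof (rule limitin_limitin_mdist_le[OF limitin_fractal[OF assms(1) X_hyperspace]
        limitin_fractal[OF assms(2) X_hyperspace]])
    fix n m assume "k \<le> n" "k \<le> m"
    then show "mdist (hyper X) (level_set M f \<sigma> (mspace X) n) (level_set M f \<tau> (mspace X) m) \<le> l ^ k * D"
      using level_set_near[where k = k and i = "n - k" and j = "m - k", OF X_hyperspace X_hyperspace assms]
      by (simp add: mdist_hyper)
  qed (use level_set_hyperspace X_hyperspace assms in \<open>auto simp: mspace_hyper\<close>)
  then show ?thesis by (simp add: mdist_hyper)
qed

text \<open>\<open>level_set_Suc\<close> passes to the limit because \<open>branch\<close> is
  Lipschitz in its arguments; the shifted sequence of level sets has the same limit as the sequence
  itself.\<close>

lemma fractal_root:
  assumes \<sigma>: "\<sigma> \<in> code_trees M N"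
  shows "fractal \<sigma> = branch (\<sigma> []) (\<lambda>m. fractal (subtree \<sigma> [m]))"
proof -
  interpret H: Metric_space "hyperspace X" "hausdorff_dist X" by (rule Metric_space_hyper)
  have H_top: "mtopology_of (hyper X) = H.mtopology"
    by (simp add: hyper_def)
  let ?B = "branch (\<sigma> []) (\<lambda>m. fractal (subtree \<sigma> [m]))"
  let ?L = "level_set M f \<sigma> (mspace X)"
  have s: "subtree \<sigma> [m] \<in> code_trees M N" if "m \<in> {1..M}" for m
    using \<sigma> that by (auto intro!: subtree_code_trees)
  have n: "\<sigma> [] \<in> {1..N}" using code_tree_mem[OF \<sigma>] by simp
  have B: "?B \<in> hyperspace X"
    using s n by (intro branch_hyperspace fractal_hyperspace)
  have "limitin H.mtopology (\<lambda>k. ?L (k + 1)) ?B sequentially"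
    unfolding H.limit_metric_sequentially
  proof (intro conjI allI impI B)
    fix e :: real assume e: "0 < e"
    have "\<exists>n0. \<forall>k\<ge>n0. hausdorff_dist X (level_set M f (subtree \<sigma> [m]) (mspace X) k) (fractal (subtree \<sigma> [m])) < e"
      if "m \<in> {1..M}" for m
      using limitin_fractal[OF s[OF that] X_hyperspace] e
      unfolding H_top H.limit_metric_sequentially by blast
    then obtain n0 where n0: "\<And>m k. m \<in> {1..M} \<Longrightarrow> k \<ge> n0 m \<Longrightarrow>
        hausdorff_dist X (level_set M f (subtree \<sigma> [m]) (mspace X) k) (fractal (subtree \<sigma> [m])) < e"
      by metis
    \<comment> \<open>There are finitely many children, so the maximum of their thresholds works for
      all of them.\<close>
    have "hausdorff_dist X (?L (k + 1)) ?B < e" if k: "k \<ge> Max (n0 ` {1..M})" for k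
    proof -
      have "hausdorff_dist X (?L (k + 1)) ?B \<le> l * e"
        unfolding Suc_eq_plus1[symmetric] level_set_Suc
      proof (intro hausdorff_dist_branch_le n less_imp_le[OF n0])
        fix m assume m: "m \<in> {1..M}"
        then show "n0 m \<le> k"
          using k by (intro order_trans[OF Max_ge k]) auto
      qed (use s level_set_hyperspace X_hyperspace fractal_hyperspace in auto)
      also have "\<dots> < 1 * e" using e l by (intro mult_strict_right_mono)
      finally show ?thesis by simp
    qed
    then show "\<exists>n0. \<forall>k\<ge>n0. ?L (k + 1) \<in> hyperspace X \<and> hausdorff_dist X (?L (k + 1)) ?B < e"
      using level_set_hyperspace[OF X_hyperspace \<sigma>] by blast
  qed
  then have "limitin H.mtopology ?L ?B sequentially"
    by (rule limitin_sequentially_offset_rev)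
  with limitin_fractal[OF \<sigma> X_hyperspace, unfolded H_top]
  show ?thesis by (rule H.limitin_metric_unique) simp
qed

lemma fractal_subtree:
  assumes "\<sigma> \<in> code_trees M N" "w \<in> words M"
  shows "fractal (subtree \<sigma> w) = branch (\<sigma> w) (\<lambda>m. fractal (subtree \<sigma> (w @ [m])))"
  using fractal_root[OF subtree_code_trees[OF assms]] assms
  by (simp add: subtree_subtree branch_def)

lemma power_D_tendsto_0: "(\<lambda>k. l ^ k * D) \<longlonglongrightarrow> 0"
  using tendsto_mult_left_zero[OF LIMSEQ_power_zero[of l], of D] l by simp

lemma power_D_less:
  assumes "0 < e" obtains k where "l ^ k * D < e"
  using order_tendstoD(2)[OF power_D_tendsto_0 assms] by (auto simp: eventually_sequentially)

lemma finite_words_less: "finite {w \<in> words M. length w < k}"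
proof -
  have "{w \<in> words M. length w < k} = (\<Union>j<k. level j)"
    by (auto simp: level_def)
  then show ?thesis by simp
qed

lemma countable_words: "countable (words M)"
proof -
  have "words M = (\<Union>k. level k)" by (auto simp: level_def)
  then show ?thesis by (auto intro!: countable_UN countable_finite)
qed

lemma code_map_fractal: "code_map (words M) {1..N} (hyper X) fractal"
  unfolding code_map_def mspace_hyper mdist_hyper code_trees_def[symmetric]
proof (intro conjI allI impI)
  show "fractal \<in> code_trees M N \<rightarrow> hyperspace X"
    using fractal_hyperspace by blast
  fix e :: real assume "0 < e"
  then obtain k where k: "l ^ k * D < e" by (rule power_D_less)
  have "hausdorff_dist X (fractal \<sigma>) (fractal \<tau>) < e"
    if "\<sigma> \<in> code_trees M N" "\<tau> \<in> code_trees M N" "\<forall>w\<in>{w \<in> words M. length w < k}. \<sigma> w = \<tau> w" for \<sigma> \<tau>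
    using fractal_near[OF that(1,2), of k] that(3) k by fastforce
  then show "\<exists>J0\<subseteq>words M. finite J0 \<and> (\<forall>\<sigma>\<in>code_trees M N. \<forall>\<tau>\<in>code_trees M N.
      (\<forall>w\<in>J0. \<sigma> w = \<tau> w) \<longrightarrow> hausdorff_dist X (fractal \<sigma>) (fractal \<tau>) < e)"
    using finite_words_less by (intro exI[of _ "{w \<in> words M. length w < k}"]) auto
qed

end

section \<open>Convergence of the sets\<close>

context superIFS
begin

lemma V_indices_mem:
  assumes "a \<in> V_indices M N V" "v \<in> {1..V}"
  shows "fst (a v) \<in> {1..N}" "\<And>m. m \<in> {1..M} \<Longrightarrow> snd (a v) m \<in> {1..V}"
proof -
  have "a v \<in> {1..N} \<times> ({1..M} \<rightarrow>\<^sub>E {1..V})"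
    using assms unfolding V_indices_def by blast
  then show "fst (a v) \<in> {1..N}" "\<And>m. m \<in> {1..M} \<Longrightarrow> snd (a v) m \<in> {1..V}"
    by (auto simp: mem_Times_iff)
qed

lemma finite_V_indices: "finite (V_indices M N V)"
  unfolding V_indices_def by (intro finite_PiE finite_cartesian_product) auto

lemma V_indices_nonempty: "1 \<le> V \<Longrightarrow> V_indices M N V \<noteq> {}"
  using N by (auto simp: V_indices_def PiE_eq_empty_iff Sigma_empty_iff)

lemma V_map_apply:
  "v \<in> {1..V} \<Longrightarrow> V_map M f V a K v = branch (fst (a v)) (\<lambda>m. K (snd (a v) m))"
  by (simp add: V_map_def branch_def)

lemma V_map_mem:
  assumes a: "a \<in> V_indices M N V" and K: "K \<in> {1..V} \<rightarrow>\<^sub>E hyperspace X"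
  shows "V_map M f V a K \<in> {1..V} \<rightarrow>\<^sub>E hyperspace X"
proof (rule PiE_I)
  fix v assume v: "v \<in> {1..V}"
  show "V_map M f V a K v \<in> hyperspace X"
    unfolding V_map_apply[OF v]
    using V_indices_mem[OF a v] K by (intro branch_hyperspace) auto
qed (auto simp: V_map_def)

lemma lipschitz_V_map:
  assumes a: "a \<in> V_indices M N V"
  shows "lipschitz_map l (power_metric V (hyper X)) (power_metric V (hyper X)) (V_map M f V a)"
  unfolding lipschitz_map_def mspace_power_metric mdist_power_metric mspace_hyper
proof (intro conjI ballI)
  show "V_map M f V a \<in> ({1..V} \<rightarrow>\<^sub>E hyperspace X) \<rightarrow> ({1..V} \<rightarrow>\<^sub>E hyperspace X)"
    using V_map_mem[OF a] by blast
  fix K L assume K: "K \<in> {1..V} \<rightarrow>\<^sub>E hyperspace X" and L: "L \<in> {1..V} \<rightarrow>\<^sub>E hyperspace X"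
  have "hausdorff_dist X (V_map M f V a K v) (V_map M f V a L v) \<le> l * max_dist V (hyper X) K L"
    if v: "v \<in> {1..V}" for v
    unfolding V_map_apply[OF v]
  proof (rule hausdorff_dist_branch_le)
    fix m assume "m \<in> {1..M}"
    then have u: "snd (a v) m \<in> {1..V}" by (rule V_indices_mem(2)[OF a v])
    then show "K (snd (a v) m) \<in> hyperspace X" "L (snd (a v) m) \<in> hyperspace X"
      using K L by auto
    show "hausdorff_dist X (K (snd (a v) m)) (L (snd (a v) m)) \<le> max_dist V (hyper X) K L"
      using mdist_le_max_dist[OF u, of "hyper X" K L] by (simp add: mdist_hyper)
  qed (rule V_indices_mem(1)[OF a v])
  then show "max_dist V (hyper X) (V_map M f V a K) (V_map M f V a L) \<le> l * max_dist V (hyper X) K L"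
    using l max_dist_nonneg by (auto simp: max_dist_le_iff mdist_hyper intro!: mult_nonneg_nonneg)
qed

lemma contractive_IFS_V:
  assumes "1 \<le> V"
  shows "contractive_IFS (power_metric V (hyper X)) (V_indices M N V) (V_map M f V) l"
proof
  show "mspace (power_metric V (hyper X)) \<noteq> {}"
    using X_hyperspace by (auto simp: mspace_power_metric mspace_hyper PiE_eq_empty_iff)
qed (use assms l compact_space_power_metric[OF compact_space_hyper[OF cpt]]
      finite_V_indices V_indices_nonempty lipschitz_V_map in auto)

lemma V_attractor:
  assumes "1 \<le> V"
  shows "V_attractor X M N f V \<in> hyperspace (power_metric V (hyper X))"
    and "V_attractor X M N f V = (\<Union>a\<in>V_indices M N V. V_map M f V a ` V_attractor X M N f V)"
  unfolding V_attractor_def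
  using contractive_IFS.set_attractor[OF contractive_IFS_V[OF assms]] by blast+

lemma V_attractor_mem:
  "1 \<le> V \<Longrightarrow> K \<in> V_attractor X M N f V \<Longrightarrow> K \<in> {1..V} \<rightarrow>\<^sub>E hyperspace X"
  using hyperspace_subset[OF V_attractor(1)] by (auto simp: mspace_power_metric mspace_hyper)

text \<open>The claim is made for every coordinate \<open>v\<close>, because the children of a set
  in buffer \<open>v\<close> come from arbitrary buffers of the preimage \<open>L\<close>. At
  \<open>k = 0\<close> any code tree is within \<open>D\<close>.\<close>

lemma V_attractor_near_fractal:
  assumes V: "1 \<le> V"
  shows "K \<in> V_attractor X M N f V \<Longrightarrow> v \<in> {1..V} \<Longrightarrow>
    \<exists>\<sigma>\<in>code_trees M N. hausdorff_dist X (K v) (fractal \<sigma>) \<le> l ^ k * D"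
proof (induction k arbitrary: K v)
  case 0
  have "(\<lambda>w\<in>words M. 1) \<in> code_trees M N"
    using N by (auto simp: code_trees_def)
  moreover have "K v \<in> hyperspace X"
    using V_attractor_mem[OF V 0(1)] 0(2) by auto
  ultimately show ?case
    using hausdorff_dist_le_D[OF _ fractal_hyperspace] by auto
next
  case (Suc k)
  obtain a L where a: "a \<in> V_indices M N V" and L: "L \<in> V_attractor X M N f V"
    and K: "K = V_map M f V a L"
    using V_attractor(2)[OF V] Suc.prems(1) by blast
  have "\<exists>\<sigma>\<in>code_trees M N. hausdorff_dist X (L (snd (a v) m)) (fractal \<sigma>) \<le> l ^ k * D"
    if "m \<in> {1..M}" for m
    using Suc.IH[OF L V_indices_mem(2)[OF a Suc.prems(2) that]] .
  then obtain s where s: "\<And>m. m \<in> {1..M} \<Longrightarrow> s m \<in> code_trees M N"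
    "\<And>m. m \<in> {1..M} \<Longrightarrow> hausdorff_dist X (L (snd (a v) m)) (fractal (s m)) \<le> l ^ k * D"
    by metis
  \<comment> \<open>The trees \<open>s m\<close> of the children, glued below a root that carries
    the letter of \<open>a\<close> at \<open>v\<close>; \<open>sub\<close> recovers them as
    subtrees.\<close>
  define \<sigma> where "\<sigma> = (\<lambda>w\<in>words M. case w of [] \<Rightarrow> fst (a v) | m # u \<Rightarrow> s m u)"
  have n: "fst (a v) \<in> {1..N}" by (rule V_indices_mem(1)[OF a Suc.prems(2)])
  have \<sigma>: "\<sigma> \<in> code_trees M N"
    unfolding code_trees_def
  proof (rule PiE_I)
    fix w assume "w \<in> words M"
    then show "\<sigma> w \<in> {1..N}"
      using n code_tree_mem[OF s(1)] by (cases w) (auto simp: \<sigma>_def)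
  qed (simp add: \<sigma>_def)
  have sub: "subtree \<sigma> [m] = s m" if "m \<in> {1..M}" for m
    using s(1)[OF that] that
    by (auto simp: subtree_def \<sigma>_def fun_eq_iff code_trees_def PiE_iff extensional_def)
  have "hausdorff_dist X (K v) (fractal \<sigma>) \<le> l * (l ^ k * D)"
    unfolding K V_map_apply[OF Suc.prems(2)] fractal_root[OF \<sigma>]
  proof -
    have root: "\<sigma> [] = fst (a v)" by (simp add: \<sigma>_def)
    show "hausdorff_dist X (branch (fst (a v)) (\<lambda>m. L (snd (a v) m)))
        (branch (\<sigma> []) (\<lambda>m. fractal (subtree \<sigma> [m]))) \<le> l * (l ^ k * D)"
      unfolding root
    proof (rule hausdorff_dist_branch_le[OF n])
      fix m assume m: "m \<in> {1..M}"
      show "L (snd (a v) m) \<in> hyperspace X"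
        using V_attractor_mem[OF V L] V_indices_mem(2)[OF a Suc.prems(2) m] by auto
      show "fractal (subtree \<sigma> [m]) \<in> hyperspace X"
        "hausdorff_dist X (L (snd (a v) m)) (fractal (subtree \<sigma> [m])) \<le> l ^ k * D"
        using s m by (simp_all add: sub fractal_hyperspace)
    qed
  qed
  with \<sigma> show ?case by (auto simp: mult.assoc)
qed

text \<open>A whole level must be realised at once, since all its nodes live in the same point of
  the attractor. Injectivity is essential: two nodes in one buffer would be forced to share their
  letter and their children. The condition \<open>M ^ (j + k) \<le> V\<close> is unchanged when
  \<open>j\<close> rises and \<open>k\<close> falls by one.\<close>

lemma fractal_near_V_attractor:
  assumes V: "1 \<le> V" and \<sigma>: "\<sigma> \<in> code_trees M N"
  shows "inj_on v (level j) \<Longrightarrow> v ` level j \<subseteq> {1..V} \<Longrightarrow> M ^ (j + k) \<le> V \<Longrightarrow>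
    \<exists>K\<in>V_attractor X M N f V. \<forall>w\<in>level j. hausdorff_dist X (K (v w)) (fractal (subtree \<sigma> w)) \<le> l ^ k * D"
proof (induction k arbitrary: j v)
  case 0
  obtain K where K: "K \<in> V_attractor X M N f V"
    using V_attractor(1)[OF V] by (auto simp: hyperspace_def)
  have "hausdorff_dist X (K (v w)) (fractal (subtree \<sigma> w)) \<le> D" if "w \<in> level j" for w
  proof (rule hausdorff_dist_le_D)
    show "K (v w) \<in> hyperspace X"
      using V_attractor_mem[OF V K] 0(2) that by auto
    show "fractal (subtree \<sigma> w) \<in> hyperspace X"
      using \<sigma> that level_subset_words by (auto intro!: fractal_hyperspace subtree_code_trees)
  qed
  with K show ?case by auto
next
  case (Suc k)
  have "M ^ Suc j \<le> M ^ (j + Suc k)"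
    using M by (intro power_increasing) auto
  then have "card (level (Suc j)) \<le> card {1..V}"
    using Suc.prems(3) unfolding card_level card_atLeastAtMost by linarith
  then obtain v' where v': "inj_on v' (level (Suc j))" "v' ` level (Suc j) \<subseteq> {1..V}"
    using card_le_inj[of "level (Suc j)" "{1..V}"] by auto
  obtain L where L: "L \<in> V_attractor X M N f V"
    "\<And>w. w \<in> level (Suc j) \<Longrightarrow> hausdorff_dist X (L (v' w)) (fractal (subtree \<sigma> w)) \<le> l ^ k * D"
    using Suc.IH[OF v'] Suc.prems(3) by auto
  define word where "word = inv_into (level j) v"
  \<comment> \<open>A buffer that holds a word gets the letter of \<open>\<sigma>\<close> there and
    points to the buffers of its children; every other buffer gets the legal default
    \<open>1\<close> throughout.\<close>
  define a where "a = (\<lambda>x\<in>{1..V}. if x \<in> v ` level j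
      then (\<sigma> (word x), \<lambda>m\<in>{1..M}. v' (word x @ [m])) else (1, \<lambda>m\<in>{1..M}. 1))"
  have word: "word (v w) = w" if "w \<in> level j" for w
    unfolding word_def using Suc.prems(1) that by (rule inv_into_f_f)
  have a: "a \<in> V_indices M N V"
    unfolding V_indices_def
  proof (rule PiE_I)
    fix x assume x: "x \<in> {1..V}"
    show "a x \<in> {1..N} \<times> ({1..M} \<rightarrow>\<^sub>E {1..V})"
    proof (cases "x \<in> v ` level j")
      case True
      then obtain w where w: "w \<in> level j" "x = v w" by blast
      have "v' (w @ [m]) \<in> {1..V}" if "m \<in> {1..M}" for m
        using v'(2) level_snoc[OF w(1) that] by blast
      moreover have "\<sigma> w \<in> {1..N}"
        using w level_subset_words by (intro code_tree_mem[OF \<sigma>]) blast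
      ultimately show ?thesis
        using x w word by (auto simp: a_def)
    qed (use x V N in \<open>auto simp: a_def\<close>)
  qed (auto simp: a_def)
  have "hausdorff_dist X (V_map M f V a L (v w)) (fractal (subtree \<sigma> w)) \<le> l * (l ^ k * D)"
    if w: "w \<in> level j" for w
  proof -
    have vw: "v w \<in> {1..V}" using Suc.prems(2) w by blast
    have ww: "w \<in> words M" using w level_subset_words by blast
    have av: "a (v w) = (\<sigma> w, \<lambda>m\<in>{1..M}. v' (w @ [m]))"
      using vw w word by (simp add: a_def)
    show ?thesis
      unfolding V_map_apply[OF vw] fractal_subtree[OF \<sigma> ww] av fst_conv
    proof (rule hausdorff_dist_branch_le[OF code_tree_mem[OF \<sigma> ww]])
      fix m assume m: "m \<in> {1..M}"
      have wm: "w @ [m] \<in> level (Suc j)" using w m by simp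
      then show "fractal (subtree \<sigma> (w @ [m])) \<in> hyperspace X"
        using \<sigma> level_subset_words by (auto intro!: fractal_hyperspace subtree_code_trees)
      have "v' (w @ [m]) \<in> {1..V}" using v'(2) wm by blast
      then show "L (snd (\<sigma> w, \<lambda>m\<in>{1..M}. v' (w @ [m])) m) \<in> hyperspace X"
        using V_attractor_mem[OF V L(1)] m by auto
      show "hausdorff_dist X (L (snd (\<sigma> w, \<lambda>m\<in>{1..M}. v' (w @ [m])) m)) (fractal (subtree \<sigma> (w @ [m])))
          \<le> l ^ k * D"
        using L(2)[OF wm] m by simp
    qed
  qed
  moreover have "V_map M f V a L \<in> V_attractor X M N f V"
    using V_attractor(2)[OF V] a L(1) by blast
  ultimately show ?case by (auto simp: mult.assoc)
qed

lemma lipschitz_first_component: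
  assumes "1 \<le> V"
  shows "lipschitz_map 1 (power_metric V Y) Y (\<lambda>K. K 1)"
  using assms mdist_le_max_dist[of 1 V Y]
  by (auto simp: lipschitz_map_def mspace_power_metric mdist_power_metric)

lemma V_fractal_sets_hyperspace:
  assumes "1 \<le> V"
  shows "V_fractal_sets X M N f V \<in> hyperspace (hyper X)"
  unfolding V_fractal_sets_def
  using hyperspace_image[OF lipschitz_map_imp_continuous[OF lipschitz_first_component] V_attractor(1)] assms
  by blast

lemma fractal_sets_hyperspace: "fractal_sets X M N f \<in> hyperspace (hyper X)"
  unfolding fractal_sets_def code_trees_def
  using N by (intro code_map_image_hyperspace[OF code_map_fractal]) auto

lemma hausdorff_dist_V_fractal_sets_le:
  assumes V: "1 \<le> V" "M ^ k \<le> V"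
  shows "hausdorff_dist (hyper X) (V_fractal_sets X M N f V) (fractal_sets X M N f) \<le> l ^ k * D"
proof (rule hausdorff_dist_leI[OF V_fractal_sets_hyperspace[OF V(1)] fractal_sets_hyperspace],
    unfold mdist_hyper)
  fix A assume "A \<in> V_fractal_sets X M N f V"
  then obtain K where "K \<in> V_attractor X M N f V" "A = K 1"
    by (auto simp: V_fractal_sets_def)
  then show "\<exists>B\<in>fractal_sets X M N f. hausdorff_dist X A B \<le> l ^ k * D"
    using V_attractor_near_fractal[OF V(1), of K 1 k] V(1) by (auto simp: fractal_sets_def)
next
  fix B assume "B \<in> fractal_sets X M N f"
  then obtain \<sigma> where \<sigma>: "\<sigma> \<in> code_trees M N" "B = fractal \<sigma>"
    by (auto simp: fractal_sets_def)
  then show "\<exists>A\<in>V_fractal_sets X M N f V. hausdorff_dist X A B \<le> l ^ k * D"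
    using fractal_near_V_attractor[OF V(1) \<sigma>(1), of "\<lambda>_. 1" 0 k] V
    by (auto simp: V_fractal_sets_def subtree_Nil)
qed

lemma limitin_V_fractal_sets:
  "limitin (mtopology_of (hyper (hyper X))) (V_fractal_sets X M N f) (fractal_sets X M N f) sequentially"
proof -
  interpret H: Metric_space "hyperspace (hyper X)" "hausdorff_dist (hyper X)" by (rule Metric_space_hyper)
  have "limitin H.mtopology (V_fractal_sets X M N f) (fractal_sets X M N f) sequentially"
    unfolding H.limit_metric_sequentially
  proof (intro conjI allI impI fractal_sets_hyperspace)
    fix e :: real assume "0 < e"
    then obtain k where k: "l ^ k * D < e" by (rule power_D_less)
    have "V_fractal_sets X M N f V \<in> hyperspace (hyper X) \<and>
        hausdorff_dist (hyper X) (V_fractal_sets X M N f V) (fractal_sets X M N f) < e"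
      if "V \<ge> max 1 (M ^ k)" for V
      using V_fractal_sets_hyperspace[of V] hausdorff_dist_V_fractal_sets_le[of V k] that k by simp
    then show "\<exists>n. \<forall>V\<ge>n. V_fractal_sets X M N f V \<in> hyperspace (hyper X) \<and>
        hausdorff_dist (hyper X) (V_fractal_sets X M N f V) (fractal_sets X M N f) < e"
      by blast
  qed
  then show ?thesis by (simp add: hyper_def[of "hyper X"])
qed

end

section \<open>Convergence of the distributions\<close>

text \<open>
  A tuple of sets indexed by the words of length \<open>j\<close> is a function on all lists; a function \<open>g\<close>
  satisfying the condition ignores its values outside \<open>level j\<close>.
\<close>

definition (in superIFS) level_lipschitz :: "nat \<Rightarrow> real \<Rightarrow> ((nat list \<Rightarrow> 'a set) \<Rightarrow> real) \<Rightarrow> bool" where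
  "level_lipschitz j L g \<longleftrightarrow> (\<forall>x y r.
    (\<forall>w\<in>level j. x w \<in> hyperspace X \<and> y w \<in> hyperspace X \<and> hausdorff_dist X (x w) (y w) \<le> r)
      \<longrightarrow> \<bar>g x - g y\<bar> \<le> L * r)"

text \<open>The pull-back of a test function on one level along one step of the recursion with the
  letters \<open>n\<close> held fixed; its variables are the sets at the children.\<close>

definition (in superIFS) branch_fun ::
    "((nat list \<Rightarrow> 'a set) \<Rightarrow> real) \<Rightarrow> (nat list \<Rightarrow> nat) \<Rightarrow> (nat list \<Rightarrow> 'a set) \<Rightarrow> real" where
  "branch_fun g n x = g (\<lambda>w. branch (n w) (\<lambda>m. x (w @ [m])))"

context superIFS
begin

lemma level_lipschitzD:
  assumes "level_lipschitz j L g"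
    and "\<And>w. w \<in> level j \<Longrightarrow> x w \<in> hyperspace X" "\<And>w. w \<in> level j \<Longrightarrow> y w \<in> hyperspace X"
    and "\<And>w. w \<in> level j \<Longrightarrow> hausdorff_dist X (x w) (y w) \<le> r"
  shows "\<bar>g x - g y\<bar> \<le> L * r"
  using assms unfolding level_lipschitz_def by blast

text \<open>The Lipschitz condition with \<open>r = 0\<close> shows that only the values on
  \<open>level j\<close> matter.\<close>

lemma level_lipschitz_cong:
  assumes "level_lipschitz j L g"
    and x: "\<And>w. w \<in> level j \<Longrightarrow> x w \<in> hyperspace X" and eq: "\<And>w. w \<in> level j \<Longrightarrow> x w = y w"
  shows "g x = g y"
proof -
  interpret H: Metric_space "hyperspace X" "hausdorff_dist X" by (rule Metric_space_hyper)
  have "\<bar>g x - g y\<bar> \<le> L * 0"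
    using x eq[symmetric] by (intro level_lipschitzD[OF assms(1)]) auto
  then show ?thesis by simp
qed

lemma level_lipschitz_branch_fun:
  assumes g: "level_lipschitz j L g" and n: "\<And>w. w \<in> level j \<Longrightarrow> n w \<in> {1..N}"
  shows "level_lipschitz (Suc j) (L * l) (branch_fun g n)"
  unfolding level_lipschitz_def
proof (intro allI impI)
  fix x y r
  assume *: "\<forall>w\<in>level (Suc j). x w \<in> hyperspace X \<and> y w \<in> hyperspace X \<and> hausdorff_dist X (x w) (y w) \<le> r"
  have "\<bar>branch_fun g n x - branch_fun g n y\<bar> \<le> L * (l * r)"
    unfolding branch_fun_def
    using * by (intro level_lipschitzD[OF g] branch_hyperspace hausdorff_dist_branch_le n) auto
  then show "\<bar>branch_fun g n x - branch_fun g n y\<bar> \<le> L * l * r"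
    by (simp add: mult.assoc)
qed

lemma subtree_fractal_hyperspace:
  "\<sigma> \<in> code_trees M N \<Longrightarrow> w \<in> level j \<Longrightarrow> fractal (subtree \<sigma> w) \<in> hyperspace X"
  using level_subset_words by (auto intro!: fractal_hyperspace subtree_code_trees)

lemma code_map_level:
  assumes g: "level_lipschitz j L g" and L: "0 \<le> L"
  shows "code_map (words M) {1..N} euclidean_metric (\<lambda>\<sigma>. g (\<lambda>w. fractal (subtree \<sigma> w)))"
  unfolding code_map_def code_trees_def[symmetric]
proof (intro conjI allI impI)
  fix e :: real assume "0 < e"
  \<comment> \<open>\<open>L + 1\<close> instead of \<open>L\<close>, since \<open>L\<close> may be
    zero.\<close>
  then have "0 < e / (L + 1)" using L by simp
  then obtain k where k: "l ^ k * D < e / (L + 1)" by (rule power_D_less)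
  have "L * (l ^ k * D) \<le> (L + 1) * (l ^ k * D)"
    using L l D_nonneg by (intro mult_right_mono mult_nonneg_nonneg) auto
  also have "\<dots> < e"
    using k L by (simp add: pos_less_divide_eq mult.commute)
  finally have less: "L * (l ^ k * D) < e" .
  \<comment> \<open>Subtrees at level \<open>j\<close> have to agree down to depth \<open>k\<close>,
    so the trees are required to agree above depth \<open>j + k\<close>.\<close>
  have "dist (g (\<lambda>w. fractal (subtree \<sigma> w))) (g (\<lambda>w. fractal (subtree \<tau> w))) < e"
    if st: "\<sigma> \<in> code_trees M N" "\<tau> \<in> code_trees M N"
      and eq: "\<forall>w\<in>{w \<in> words M. length w < j + k}. \<sigma> w = \<tau> w" for \<sigma> \<tau>
  proof -
    have "\<bar>g (\<lambda>w. fractal (subtree \<sigma> w)) - g (\<lambda>w. fractal (subtree \<tau> w))\<bar> \<le> L * (l ^ k * D)"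
    proof (rule level_lipschitzD[OF g subtree_fractal_hyperspace[OF st(1)] subtree_fractal_hyperspace[OF st(2)]])
      fix w assume "w \<in> level j"
      then show "hausdorff_dist X (fractal (subtree \<sigma> w)) (fractal (subtree \<tau> w)) \<le> l ^ k * D"
        using st eq by (intro fractal_near subtree_code_trees) (auto simp: level_def subtree_def)
    qed
    with less show ?thesis by (simp add: dist_real_def)
  qed
  then show "\<exists>J0\<subseteq>words M. finite J0 \<and> (\<forall>\<sigma>\<in>code_trees M N. \<forall>\<tau>\<in>code_trees M N. (\<forall>w\<in>J0. \<sigma> w = \<tau> w) \<longrightarrow>
      mdist euclidean_metric (g (\<lambda>w. fractal (subtree \<sigma> w))) (g (\<lambda>w. fractal (subtree \<tau> w))) < e)"
    using finite_words_less by (intro exI[of _ "{w \<in> words M. length w < j + k}"]) auto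
qed simp

lemma lipschitz_map_level:
  assumes g: "level_lipschitz j L g" and v: "v ` level j \<subseteq> {1..V}"
  shows "lipschitz_map L (power_metric V (hyper X)) euclidean_metric (\<lambda>K. g (\<lambda>w. K (v w)))"
  unfolding lipschitz_map_def mspace_power_metric mspace_hyper mdist_power_metric
proof (intro conjI ballI)
  fix K K' assume K: "K \<in> {1..V} \<rightarrow>\<^sub>E hyperspace X" "K' \<in> {1..V} \<rightarrow>\<^sub>E hyperspace X"
  have "\<bar>g (\<lambda>w. K (v w)) - g (\<lambda>w. K' (v w))\<bar> \<le> L * max_dist V (hyper X) K K'"
  proof (rule level_lipschitzD[OF g])
    fix w assume "w \<in> level j"
    then have v: "v w \<in> {1..V}" using v by blast
    then show "K (v w) \<in> hyperspace X" "K' (v w) \<in> hyperspace X" using K by auto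
    show "hausdorff_dist X (K (v w)) (K' (v w)) \<le> max_dist V (hyper X) K K'"
      using mdist_le_max_dist[OF v, of "hyper X"] by (simp add: mdist_hyper)
  qed
  then show "mdist euclidean_metric (g (\<lambda>w. K (v w))) (g (\<lambda>w. K' (v w))) \<le> L * max_dist V (hyper X) K K'"
    by (simp add: dist_real_def)
qed simp

end

text \<open>The bound holds for all pairs of points, so it survives averaging over \<open>x\<close>
  with \<open>y\<close> fixed and then over \<open>y\<close>; the two measures may live on different
  spaces.\<close>

lemma integral_diff_le_const:
  fixes h1 :: "'a \<Rightarrow> real" and h2 :: "'b \<Rightarrow> real"
  assumes "prob_space \<mu>" "prob_space \<nu>" "integrable \<mu> h1" "integrable \<nu> h2"
    and le: "\<And>x y. x \<in> space \<mu> \<Longrightarrow> y \<in> space \<nu> \<Longrightarrow> \<bar>h1 x - h2 y\<bar> \<le> c"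
  shows "\<bar>(\<integral>x. h1 x \<partial>\<mu>) - (\<integral>y. h2 y \<partial>\<nu>)\<bar> \<le> c"
proof -
  interpret \<mu>: prob_space \<mu> by fact
  interpret \<nu>: prob_space \<nu> by fact
  have "h2 y - c \<le> (\<integral>x. h1 x \<partial>\<mu>) \<and> (\<integral>x. h1 x \<partial>\<mu>) \<le> h2 y + c" if y: "y \<in> space \<nu>" for y
    using le[OF _ y] assms(3)
    by (intro conjI \<mu>.integral_ge_const \<mu>.integral_le_const AE_I2) (auto simp: abs_le_iff algebra_simps)
  then have "(\<integral>x. h1 x \<partial>\<mu>) - c \<le> h2 y" "h2 y \<le> (\<integral>x. h1 x \<partial>\<mu>) + c" if "y \<in> space \<nu>" for y
    using that by (simp_all add: algebra_simps)
  then have "(\<integral>x. h1 x \<partial>\<mu>) - c \<le> (\<integral>y. h2 y \<partial>\<nu>)" "(\<integral>y. h2 y \<partial>\<nu>) \<le> (\<integral>x. h1 x \<partial>\<mu>) + c"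
    using assms(4) by (intro \<nu>.integral_ge_const \<nu>.integral_le_const AE_I2; simp)+
  then show ?thesis by (simp add: abs_le_iff)
qed

locale superIFS_prob = superIFS +
  fixes P :: "nat \<Rightarrow> real"
  assumes P_pos: "\<And>n. n \<in> {1..N} \<Longrightarrow> 0 < P n" and P_sum: "(\<Sum>n\<in>{1..N}. P n) = 1"
begin

abbreviation "\<rho> \<equiv> code_tree_measure M N P"
abbreviation "letter \<equiv> point_measure {1..N} (\<lambda>n. ennreal (P n))"

lemma prob_space_letter: "prob_space letter"
  using P_pos P_sum by (intro prob_space_point_measure_real) (auto intro: less_imp_le)

sublocale letters: product_prob_space "\<lambda>_::nat list. letter" "words M"
  by (intro product_prob_spaceI prob_space_letter)

sublocale \<rho>: prob_space \<rho>
  unfolding code_tree_measure_def by (intro prob_space_PiM prob_space_letter)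

lemma code_map_integrable:
  fixes h :: "(nat list \<Rightarrow> nat) \<Rightarrow> real"
  assumes h: "code_map (words M) {1..N} euclidean_metric h"
  shows "integrable \<rho> h"
proof -
  have "h ` code_trees M N \<in> hyperspace euclidean_metric"
    unfolding code_trees_def using N by (intro code_map_image_hyperspace[OF h]) auto
  then have "bounded (h ` code_trees M N)"
    by (simp add: hyperspace_def compact_imp_bounded)
  then obtain c where c: "\<And>\<sigma>. \<sigma> \<in> code_trees M N \<Longrightarrow> norm (h \<sigma>) \<le> c"
    by (auto simp: bounded_iff)
  have "h \<in> borel_measurable \<rho>"
    using code_map_measurable[OF h countable_words, where p = "\<lambda>n. ennreal (P n)"]
    by (simp add: code_tree_measure_def metric_borel_euclidean)
  then show ?thesis
    using c by (intro \<rho>.integrable_const_bound[of _ c] AE_I2) (auto simp: space_code_tree_measure)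
qed

text \<open>Independence amounts to the joint law being the product of the marginals; here the joint
  map is the identity on the space of code trees, whose measure is that product.\<close>

lemma indep_letters: "\<rho>.indep_vars (\<lambda>_. letter) (\<lambda>w \<sigma>. \<sigma> w) (words M)"
proof (subst \<rho>.indep_vars_iff_distr_eq_PiM')
  have comp: "distr \<rho> letter (\<lambda>\<sigma>. \<sigma> w) = letter" if "w \<in> words M" for w
    using letters.PiM_component[OF that] by (simp add: code_tree_measure_def)
  have "distr \<rho> (Pi\<^sub>M (words M) (\<lambda>_. letter)) (\<lambda>\<sigma>. restrict \<sigma> (words M)) = distr \<rho> \<rho> (\<lambda>\<sigma>. \<sigma>)"
    by (intro distr_cong) (auto simp: code_tree_measure_def space_PiM)
  also have "\<dots> = \<rho>" by (rule distr_id2) simp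
  also have "\<rho> = Pi\<^sub>M (words M) (\<lambda>w. distr \<rho> letter (\<lambda>\<sigma>. \<sigma> w))"
    unfolding code_tree_measure_def[of M N P] using comp[unfolded code_tree_measure_def]
    by (intro PiM_cong) auto
  finally show "distr \<rho> (Pi\<^sub>M (words M) (\<lambda>_. letter)) (\<lambda>\<sigma>. restrict \<sigma> (words M)) =
      Pi\<^sub>M (words M) (\<lambda>w. distr \<rho> letter (\<lambda>\<sigma>. \<sigma> w))" .
  show "words M \<noteq> {}" using words_Nil by blast
  show "(\<lambda>\<sigma>. \<sigma> w) \<in> \<rho> \<rightarrow>\<^sub>M letter" if "w \<in> words M" for w
    using measurable_component_singleton[OF that, of "\<lambda>_. letter"] unfolding code_tree_measure_def .
qed

end

section \<open>One step of the recursion for code trees\<close>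

context superIFS_prob
begin

lemma prob_letters:
  assumes "J \<subseteq> words M" "finite J" "\<And>w. w \<in> J \<Longrightarrow> n w \<in> {1..N}"
  shows "measure \<rho> {\<sigma> \<in> space \<rho>. \<forall>w\<in>J. \<sigma> w = n w} = (\<Prod>w\<in>J. P (n w))"
proof -
  have "{\<sigma> \<in> space \<rho>. \<forall>w\<in>J. \<sigma> w = n w} = letters.emb (words M) J (PiE J (\<lambda>w. {n w}))"
    using assms(1) by (auto simp: prod_emb_def code_tree_measure_def space_PiM restrict_PiE_iff)
  then have "measure \<rho> {\<sigma> \<in> space \<rho>. \<forall>w\<in>J. \<sigma> w = n w} = (\<Prod>w\<in>J. measure letter {n w})"
    unfolding code_tree_measure_def using assms
    by (subst letters.measure_PiM_emb[symmetric]) (auto simp: sets_point_measure)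
  also have "\<dots> = (\<Prod>w\<in>J. P (n w))"
  proof (rule prod.cong)
    fix w assume "w \<in> J"
    then have "n w \<in> {1..N}" by (rule assms)
    then show "measure letter {n w} = P (n w)"
      using P_pos[of "n w"] by (simp add: measure_def emeasure_point_measure_finite)
  qed simp
  finally show ?thesis .
qed

text \<open>
  The integrand on the left depends on \<open>\<sigma>\<close> through its letters at level \<open>j\<close> and, independently of
  these, through its subtrees at level \<open>Suc j\<close>.
\<close>

lemma integral_level_step:
  assumes g: "level_lipschitz j L g" and L: "0 \<le> L"
  shows "(\<integral>\<sigma>. g (\<lambda>w. fractal (subtree \<sigma> w)) \<partial>\<rho>) =
    (\<Sum>n\<in>level j \<rightarrow>\<^sub>E {1..N}. (\<Prod>w\<in>level j. P (n w)) *
        (\<integral>\<sigma>. branch_fun g n (\<lambda>w. fractal (subtree \<sigma> w)) \<partial>\<rho>))"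
proof -
  let ?I = "level j \<rightarrow>\<^sub>E {1..N}"
  define h where "h n \<sigma> = branch_fun g n (\<lambda>w. fractal (subtree \<sigma> w))" for n \<sigma>
  define ev where "ev n \<sigma> = (if \<forall>w\<in>level j. \<sigma> w = n w then 1 else 0 :: real)" for n \<sigma> :: "nat list \<Rightarrow> nat"
  define B where "B = {w \<in> words M. j < length w}"
  \<comment> \<open>\<open>fill\<close> completes a labelling of the words longer than
    \<open>j\<close> to a full code tree, with the legal letter \<open>1\<close> elsewhere. Thus
    \<open>h n\<close> becomes a function of the restriction to \<open>B\<close>, as the
    independence argument requires.\<close>
  define fill where "fill \<tau> = (\<lambda>w\<in>words M. if w \<in> B then \<tau> w else 1)" for \<tau> :: "nat list \<Rightarrow> nat"
  have finI: "finite ?I" by (intro finite_PiE) auto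
  have h: "code_map (words M) {1..N} euclidean_metric (h n)" if "n \<in> ?I" for n
    unfolding h_def using that L l
    by (intro code_map_level[OF level_lipschitz_branch_fun[OF g]]) (auto simp: PiE_iff)
  have h_meas: "h n \<in> borel_measurable (Pi\<^sub>M (words M) (\<lambda>_. letter))" if "n \<in> ?I" for n
    using code_map_measurable[OF h[OF that] countable_words] by (simp add: metric_borel_euclidean)
  have ev_meas: "ev n \<in> borel_measurable (Pi\<^sub>M (level j) (\<lambda>_. letter))" if "n \<in> ?I" for n
  proof -
    have "code_map (level j) {1..N} euclidean_metric (ev n)"
      unfolding code_map_def
      by (intro conjI allI impI exI[of _ "level j"]) (auto simp: ev_def)
    then show ?thesis
      using code_map_measurable[of "level j" "{1..N}" euclidean_metric "ev n"]
      by (simp add: metric_borel_euclidean countable_finite)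
  qed
  have fill_meas: "fill \<in> Pi\<^sub>M B (\<lambda>_. letter) \<rightarrow>\<^sub>M Pi\<^sub>M (words M) (\<lambda>_. letter)"
    unfolding fill_def
  proof (rule measurable_restrict)
    fix w assume "w \<in> words M"
    show "(\<lambda>\<tau>. if w \<in> B then \<tau> w else 1) \<in> Pi\<^sub>M B (\<lambda>_. letter) \<rightarrow>\<^sub>M letter"
    proof (cases "w \<in> B")
      case True
      then show ?thesis
        using measurable_component_singleton[of w B "\<lambda>_. letter"] by simp
    next
      case False
      then show ?thesis
        using N measurable_const[of 1 letter "Pi\<^sub>M B (\<lambda>_. letter)"] by (simp add: space_point_measure)
    qed
  qed
  \<comment> \<open>All subtrees at level \<open>Suc j\<close> lie inside \<open>B\<close>, so
    altering the letters outside \<open>B\<close> does not change \<open>h n\<close>.\<close>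
  have h_fill: "h n (fill (restrict \<sigma> B)) = h n \<sigma>" if n: "n \<in> ?I" and \<sigma>: "\<sigma> \<in> code_trees M N" for n \<sigma>
  proof -
    have fill_ct: "fill (restrict \<sigma> B) \<in> code_trees M N"
      using N code_tree_mem[OF \<sigma>] by (auto simp: fill_def code_trees_def B_def)
    have "subtree (fill (restrict \<sigma> B)) w = subtree \<sigma> w" if "w \<in> level (Suc j)" for w
      using that by (auto simp: subtree_def fill_def B_def level_def fun_eq_iff)
    then show ?thesis
      unfolding h_def using n subtree_fractal_hyperspace[OF \<sigma>]
      by (intro level_lipschitz_cong[OF level_lipschitz_branch_fun[OF g]]) (auto simp: PiE_iff)
  qed
  have split: "(\<integral>\<sigma>. ev n \<sigma> * h n \<sigma> \<partial>\<rho>) = (\<Prod>w\<in>level j. P (n w)) * (\<integral>\<sigma>. h n \<sigma> \<partial>\<rho>)"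
    and int: "integrable \<rho> (\<lambda>\<sigma>. ev n \<sigma> * h n \<sigma>)" if n: "n \<in> ?I" for n
  proof -
    \<comment> \<open>\<open>level j\<close> and \<open>B\<close> are disjoint sets of
      coordinates.\<close>
    have "\<rho>.indep_var (Pi\<^sub>M (level j) (\<lambda>_. letter)) (\<lambda>\<sigma>. restrict \<sigma> (level j))
        (Pi\<^sub>M B (\<lambda>_. letter)) (\<lambda>\<sigma>. restrict \<sigma> B)"
      using \<rho>.indep_var_restrict[OF indep_letters, of "level j" B]
      by (auto simp: level_def B_def)
    then have "\<rho>.indep_var borel (ev n \<circ> (\<lambda>\<sigma>. restrict \<sigma> (level j)))
        borel ((h n \<circ> fill) \<circ> (\<lambda>\<sigma>. restrict \<sigma> B))"
      using ev_meas[OF n] measurable_comp[OF fill_meas h_meas[OF n]]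
      by (intro \<rho>.indep_var_compose)
    moreover have "ev n \<circ> (\<lambda>\<sigma>. restrict \<sigma> (level j)) = ev n"
      by (auto simp: ev_def fun_eq_iff)
    ultimately have ind: "\<rho>.indep_var borel (ev n) borel (\<lambda>\<sigma>. h n (fill (restrict \<sigma> B)))"
      by (simp add: o_def)
    have int_h: "integrable \<rho> (h n)"
      by (rule code_map_integrable[OF h[OF n]])
    then have int_h': "integrable \<rho> (\<lambda>\<sigma>. h n (fill (restrict \<sigma> B)))"
      using h_fill[OF n] by (subst Bochner_Integration.integrable_cong[OF refl])
        (auto simp: space_code_tree_measure)
    have ev_ind: "ev n \<sigma> = indicat_real {\<sigma> \<in> space \<rho>. \<forall>w\<in>level j. \<sigma> w = n w} \<sigma>" if "\<sigma> \<in> space \<rho>" for \<sigma>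
      using that by (simp add: ev_def indicator_def)
    have "ev n \<in> borel_measurable \<rho>"
      using ind by (rule \<rho>.indep_var_rv1)
    then have int_ev: "integrable \<rho> (ev n)"
      by (intro \<rho>.integrable_const_bound[of _ 1] AE_I2) (auto simp: ev_def)
    have "(\<integral>\<sigma>. ev n \<sigma> \<partial>\<rho>) = (\<integral>\<sigma>. indicat_real {\<sigma> \<in> space \<rho>. \<forall>w\<in>level j. \<sigma> w = n w} \<sigma> \<partial>\<rho>)"
      by (intro Bochner_Integration.integral_cong refl ev_ind)
    also have "\<dots> = (\<Prod>w\<in>level j. P (n w))"
      using prob_letters[OF level_subset_words finite_level, of j n] n
      by (auto simp: PiE_iff Int_absorb2 subsetI)
    finally have ev_eq: "(\<integral>\<sigma>. ev n \<sigma> \<partial>\<rho>) = (\<Prod>w\<in>level j. P (n w))" .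
    have cong: "(\<integral>\<sigma>. h n (fill (restrict \<sigma> B)) \<partial>\<rho>) = (\<integral>\<sigma>. h n \<sigma> \<partial>\<rho>)"
      using h_fill[OF n] by (intro Bochner_Integration.integral_cong) (auto simp: space_code_tree_measure)
    have cong': "(\<integral>\<sigma>. ev n \<sigma> * h n (fill (restrict \<sigma> B)) \<partial>\<rho>) = (\<integral>\<sigma>. ev n \<sigma> * h n \<sigma> \<partial>\<rho>)"
      using h_fill[OF n] by (intro Bochner_Integration.integral_cong) (auto simp: space_code_tree_measure)
    show "(\<integral>\<sigma>. ev n \<sigma> * h n \<sigma> \<partial>\<rho>) = (\<Prod>w\<in>level j. P (n w)) * (\<integral>\<sigma>. h n \<sigma> \<partial>\<rho>)"
      using \<rho>.indep_var_lebesgue_integral[OF ind int_ev int_h'] by (simp add: cong cong' ev_eq)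
    have "integrable \<rho> (\<lambda>\<sigma>. ev n \<sigma> * h n (fill (restrict \<sigma> B)))"
      by (rule \<rho>.indep_var_integrable[OF ind int_ev int_h'])
    then show "integrable \<rho> (\<lambda>\<sigma>. ev n \<sigma> * h n \<sigma>)"
      by (subst Bochner_Integration.integrable_cong[OF refl])
        (auto simp: space_code_tree_measure h_fill[OF n])
  qed
  \<comment> \<open>For each \<open>\<sigma>\<close> exactly one \<open>n\<close> contributes,
    namely the actual letters of \<open>\<sigma>\<close> on \<open>level j\<close>.\<close>
  have pointwise: "g (\<lambda>w. fractal (subtree \<sigma> w)) = (\<Sum>n\<in>?I. ev n \<sigma> * h n \<sigma>)"
    if "\<sigma> \<in> space \<rho>" for \<sigma>
  proof -
    have \<sigma>: "\<sigma> \<in> code_trees M N" using that by (simp add: space_code_tree_measure)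
    have mem: "restrict \<sigma> (level j) \<in> ?I"
      using code_tree_mem[OF \<sigma>] level_subset_words[of j] by (auto simp: PiE_iff)
    have "(\<Sum>n\<in>?I. ev n \<sigma> * h n \<sigma>) = (\<Sum>n\<in>{restrict \<sigma> (level j)}. ev n \<sigma> * h n \<sigma>)"
    proof (rule sum.mono_neutral_right[OF finI])
      show "\<forall>n\<in>?I - {restrict \<sigma> (level j)}. ev n \<sigma> * h n \<sigma> = 0"
      proof
        fix n assume n: "n \<in> ?I - {restrict \<sigma> (level j)}"
        have "\<not> (\<forall>w\<in>level j. \<sigma> w = n w)"
        proof
          assume eq: "\<forall>w\<in>level j. \<sigma> w = n w"
          have "n = restrict \<sigma> (level j)"
            using n eq by (intro PiE_ext[of n "level j" "\<lambda>_. {1..N}", OF _ mem]) auto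
          with n show False by blast
        qed
        then have "ev n \<sigma> = 0" unfolding ev_def by (rule if_not_P)
        then show "ev n \<sigma> * h n \<sigma> = 0" by simp
      qed
    qed (use mem in auto)
    also have "\<dots> = h (restrict \<sigma> (level j)) \<sigma>"
      by (simp add: ev_def)
    also have "\<dots> = g (\<lambda>w. branch (restrict \<sigma> (level j) w) (\<lambda>m. fractal (subtree \<sigma> (w @ [m]))))"
      by (simp add: h_def branch_fun_def)
    also have "\<dots> = g (\<lambda>w. fractal (subtree \<sigma> w))"
    proof (rule level_lipschitz_cong[OF g, symmetric])
      fix w assume w: "w \<in> level j"
      show "fractal (subtree \<sigma> w) \<in> hyperspace X"
        by (rule subtree_fractal_hyperspace[OF \<sigma> w])
      have "w \<in> words M" using w level_subset_words by blast
      then show "fractal (subtree \<sigma> w) = branch (restrict \<sigma> (level j) w) (\<lambda>m. fractal (subtree \<sigma> (w @ [m])))"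
        using fractal_subtree[OF \<sigma>] w by simp
    qed
    finally show ?thesis by simp
  qed
  have "(\<integral>\<sigma>. g (\<lambda>w. fractal (subtree \<sigma> w)) \<partial>\<rho>) = (\<integral>\<sigma>. (\<Sum>n\<in>?I. ev n \<sigma> * h n \<sigma>) \<partial>\<rho>)"
    by (intro Bochner_Integration.integral_cong refl pointwise)
  also have "\<dots> = (\<Sum>n\<in>?I. \<integral>\<sigma>. ev n \<sigma> * h n \<sigma> \<partial>\<rho>)"
    using int by (rule Bochner_Integration.integral_sum)
  also have "\<dots> = (\<Sum>n\<in>?I. (\<Prod>w\<in>level j. P (n w)) * (\<integral>\<sigma>. h n \<sigma> \<partial>\<rho>))"
    by (intro sum.cong refl split)
  finally show ?thesis by (simp only: h_def)
qed

end

text \<open>Conditioning on all coordinates except \<open>x\<close> fixes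
  \<open>\<psi> (y x')\<close> as a target \<open>t\<close>, and the independent coordinate
  \<open>x\<close> hits any given target with probability at most \<open>c\<close>.\<close>

lemma prob_Pi_pmf_collision:
  assumes A: "finite A" "x \<in> A" "x \<noteq> x'"
    and c: "\<And>t. measure_pmf.prob (p x) {z. \<phi> z = t} \<le> c"
  shows "measure_pmf.prob (Pi_pmf A d p) {y. \<phi> (y x) = \<psi> (y x')} \<le> c"
proof -
  define A' where "A' = A - {x}"
  have A': "A = insert x A'" "finite A'" "x \<notin> A'"
    using A by (auto simp: A'_def)
  have c0: "0 \<le> c"
    using order_trans[OF measure_nonneg c] by blast
  let ?E = "{y. \<phi> (y x) = \<psi> (y x')}"
  have "Pi_pmf A d p = bind_pmf (Pi_pmf A' d p) (\<lambda>y. map_pmf (\<lambda>z. y(x := z)) (p x))"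
    unfolding A'(1) Pi_pmf_insert'[OF A'(2,3)]
    by (subst bind_commute_pmf) (simp add: map_pmf_def)
  then have "emeasure (Pi_pmf A d p) ?E =
      (\<integral>\<^sup>+y. emeasure (p x) {z. \<phi> z = \<psi> (y x')} \<partial>Pi_pmf A' d p)"
    using A(3) by (simp add: vimage_def)
  also have "\<dots> \<le> (\<integral>\<^sup>+y. ennreal c \<partial>Pi_pmf A' d p)"
    using c by (intro nn_integral_mono) (simp add: measure_pmf.emeasure_eq_measure ennreal_leI)
  also have "\<dots> = ennreal c" by simp
  finally show ?thesis
    using c0 by (simp add: measure_pmf.emeasure_eq_measure)
qed

section \<open>Random indices and collisions of buffers\<close>

context superIFS_prob
begin

definition letter_pmf :: "nat pmf" where
  "letter_pmf = embed_pmf (\<lambda>n. if n \<in> {1..N} then P n else 0)"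

lemma pmf_letter: "pmf letter_pmf n = (if n \<in> {1..N} then P n else 0)"
  unfolding letter_pmf_def
proof (rule pmf_embed_pmf)
  show "0 \<le> (if n \<in> {1..N} then P n else 0)" for n
    using P_pos[of n] by (auto intro: less_imp_le)
  have "(\<integral>\<^sup>+n. ennreal (if n \<in> {1..N} then P n else 0) \<partial>count_space UNIV)
      = (\<Sum>n\<in>{1..N}. ennreal (P n))"
    by (subst nn_integral_count_space'[of "{1..N}"]) auto
  also have "\<dots> = ennreal (\<Sum>n\<in>{1..N}. P n)"
    using P_pos by (intro sum_ennreal) (auto intro: less_imp_le)
  finally show "(\<integral>\<^sup>+n. ennreal (if n \<in> {1..N} then P n else 0) \<partial>count_space UNIV) = 1"
    by (simp only: P_sum ennreal_1)
qed

definition row_pmf :: "nat \<Rightarrow> (nat \<Rightarrow> nat) pmf" where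
  "row_pmf V = pmf_of_set ({1..M} \<rightarrow>\<^sub>E {1..V})"

text \<open>The probabilities of the theorem as a product law: the rows of the index are
  independent, each consisting of a letter with law \<open>P\<close> and an independent uniform row
  of pointers. \<open>pmf_index\<close> gives the explicit formula.\<close>

definition index_pmf :: "nat \<Rightarrow> V_index pmf" where
  "index_pmf V = Pi_pmf {1..V} undefined (\<lambda>_. pair_pmf letter_pmf (row_pmf V))"

lemma finite_rows: "finite ({1..M} \<rightarrow>\<^sub>E {1..V::nat})"
  by (intro finite_PiE) auto

lemma rows_nonempty: "1 \<le> V \<Longrightarrow> {1..M} \<rightarrow>\<^sub>E {1..V::nat} \<noteq> {}"
  by (auto simp: PiE_eq_empty_iff)

text \<open>A uniformly chosen function has independent uniform values; this independence handles
  collisions between two pointers of the same row.\<close>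

lemma row_pmf_eq: "1 \<le> V \<Longrightarrow> row_pmf V = Pi_pmf {1..M} undefined (\<lambda>_. pmf_of_set {1..V})"
  unfolding row_pmf_def
  by (subst Pi_pmf_of_set) (auto simp: PiE_dflt_def PiE_def extensional_def intro!: arg_cong[of _ _ pmf_of_set])

lemma set_index_pmf:
  assumes "1 \<le> V" shows "set_pmf (index_pmf V) \<subseteq> V_indices M N V"
proof
  fix a assume "a \<in> set_pmf (index_pmf V)"
  then have a: "a \<in> PiE_dflt {1..V} undefined (\<lambda>_. set_pmf (pair_pmf letter_pmf (row_pmf V)))"
    by (simp add: index_pmf_def set_Pi_pmf o_def)
  have "set_pmf letter_pmf \<subseteq> {1..N}"
    by (auto simp: set_pmf_eq pmf_letter split: if_splits)
  moreover have "set_pmf (row_pmf V) = {1..M} \<rightarrow>\<^sub>E {1..V}"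
    unfolding row_pmf_def by (rule set_pmf_of_set[OF rows_nonempty[OF assms] finite_rows])
  ultimately have "set_pmf (pair_pmf letter_pmf (row_pmf V)) \<subseteq> {1..N} \<times> ({1..M} \<rightarrow>\<^sub>E {1..V})"
    unfolding set_pair_pmf by blast
  with a show "a \<in> V_indices M N V"
    unfolding V_indices_def PiE_dflt_def by (intro PiE_I) blast+
qed

lemma pmf_index:
  assumes V: "1 \<le> V" and a: "a \<in> V_indices M N V"
  shows "pmf (index_pmf V) a = (\<Prod>v\<in>{1..V}. P (fst (a v))) / real V ^ (M * V)"
proof -
  have "pmf (index_pmf V) a = (\<Prod>v\<in>{1..V}. pmf (pair_pmf letter_pmf (row_pmf V)) (a v))"
    unfolding index_pmf_def using a by (intro pmf_Pi') (auto simp: V_indices_def PiE_iff extensional_def)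
  also have "\<dots> = (\<Prod>v\<in>{1..V}. P (fst (a v)) / real V ^ M)"
  proof (rule prod.cong)
    fix v assume v: "v \<in> {1..V}"
    have "a v \<in> {1..N} \<times> ({1..M} \<rightarrow>\<^sub>E {1..V})"
      using a v unfolding V_indices_def by blast
    then have "fst (a v) \<in> {1..N}" "snd (a v) \<in> {1..M} \<rightarrow>\<^sub>E {1..V}"
      by (simp_all add: mem_Times_iff)
    moreover from this have "pmf (row_pmf V) (snd (a v)) = 1 / real V ^ M"
      unfolding row_pmf_def pmf_of_set[OF rows_nonempty[OF V] finite_rows]
      by (simp add: card_PiE)
    ultimately show "pmf (pair_pmf letter_pmf (row_pmf V)) (a v) = P (fst (a v)) / real V ^ M"
      using pmf_pair[of letter_pmf "row_pmf V" "fst (a v)" "snd (a v)"]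
      by (simp add: pmf_letter)
  qed simp
  also have "\<dots> = (\<Prod>v\<in>{1..V}. P (fst (a v))) / real V ^ (M * V)"
    by (simp add: prod_dividef power_mult)
  finally show ?thesis .
qed

lemma prob_row:
  assumes "1 \<le> V" "m \<in> {1..M}"
  shows "measure_pmf.prob (row_pmf V) {u. u m = t} \<le> 1 / real V"
proof -
  have "measure_pmf.prob (row_pmf V) {u. u m = t} = measure_pmf.prob (map_pmf (\<lambda>u. u m) (row_pmf V)) {t}"
    by (simp add: vimage_def)
  also have "\<dots> = measure_pmf.prob (pmf_of_set {1..V}) {t}"
    using assms by (simp add: row_pmf_eq Pi_pmf_component)
  also have "\<dots> \<le> 1 / real V"
    using assms by (subst measure_pmf_of_set) (auto intro!: divide_right_mono simp: card_insert_le_m1 Int_insert_right)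
  finally show ?thesis .
qed

lemma prob_collision:
  assumes V: "1 \<le> V" and v: "v \<in> {1..V}" "v' \<in> {1..V}" and m: "m \<in> {1..M}" "m' \<in> {1..M}"
    and ne: "(v, m) \<noteq> (v', m')"
  shows "measure_pmf.prob (index_pmf V) {a. snd (a v) m = snd (a v') m'} \<le> 1 / real V"
\<comment> \<open>Pointers in different rows are independent because the rows are, pointers in the
  same row by \<open>row_pmf_eq\<close>; either way \<open>prob_Pi_pmf_collision\<close>
  applies.\<close>
proof (cases "v = v'")
  case False
  have "measure_pmf.prob (pair_pmf letter_pmf (row_pmf V)) {z. snd z m = t} \<le> 1 / real V" for t
  proof -
    have "measure_pmf.prob (pair_pmf letter_pmf (row_pmf V)) {z. snd z m = t}
        = measure_pmf.prob (map_pmf snd (pair_pmf letter_pmf (row_pmf V))) {u. u m = t}"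
      by (simp add: vimage_def)
    also have "\<dots> \<le> 1 / real V"
      unfolding map_snd_pair_pmf by (rule prob_row[OF V m(1)])
    finally show ?thesis .
  qed
  then show ?thesis
    unfolding index_pmf_def
    using prob_Pi_pmf_collision[of "{1..V}" v v' "\<lambda>_. pair_pmf letter_pmf (row_pmf V)"
        "\<lambda>z. snd z m" "1 / real V" undefined "\<lambda>z. snd z m'"] v False by simp
next
  case True
  with ne have "m \<noteq> m'" by simp
  have "measure_pmf.prob (index_pmf V) {a. snd (a v) m = snd (a v') m'}
      = measure_pmf.prob (map_pmf snd (map_pmf (\<lambda>a. a v) (index_pmf V))) {u. u m = u m'}"
    using True by (simp add: vimage_def)
  also have "map_pmf snd (map_pmf (\<lambda>a. a v) (index_pmf V)) = row_pmf V"
    using v by (simp add: index_pmf_def Pi_pmf_component map_snd_pair_pmf)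
  also have "measure_pmf.prob (row_pmf V) {u. u m = u m'} \<le> 1 / real V"
    unfolding row_pmf_eq[OF V]
  proof (rule prob_Pi_pmf_collision[where \<phi> = "\<lambda>x. x" and \<psi> = "\<lambda>x. x"])
    fix t show "measure_pmf.prob (pmf_of_set {1..V}) {z. z = t} \<le> 1 / real V"
      using V by (subst measure_pmf_of_set) (auto intro!: divide_right_mono simp: Int_insert_right)
  qed (use m \<open>m \<noteq> m'\<close> in auto)
  finally show ?thesis .
qed

text \<open>
  The tree of buffer indices: \<open>v\<close> places the words of length \<open>j\<close> into the \<open>V\<close> buffers, and \<open>a\<close>
  then determines the buffers of their children.
\<close>

definition child_buffer :: "(nat list \<Rightarrow> nat) \<Rightarrow> V_index \<Rightarrow> nat list \<Rightarrow> nat" where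
  "child_buffer v a w = snd (a (v (butlast w))) (last w)"

text \<open>Union bound over the pairs of distinct words of length \<open>Suc j\<close>, of which
  there are at most \<open>M ^ Suc j * M ^ Suc j\<close>, each colliding with probability at most
  \<open>1 / V\<close>.\<close>

lemma prob_child_buffer_not_inj:
  assumes V: "1 \<le> V" and v: "inj_on v (level j)" "v ` level j \<subseteq> {1..V}"
  shows "measure_pmf.prob (index_pmf V) {a. \<not> inj_on (child_buffer v a) (level (Suc j))}
    \<le> real (M ^ Suc j * M ^ Suc j) / real V"
proof -
  let ?W = "level (Suc j)"
  let ?S = "{(w, w') \<in> ?W \<times> ?W. w \<noteq> w'}"
  let ?E = "\<lambda>(w, w'). {a. child_buffer v a w = child_buffer v a w'}"
  have S: "finite ?S" by (rule finite_subset[of _ "?W \<times> ?W"]) auto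
  have le: "measure_pmf.prob (index_pmf V) (?E z) \<le> 1 / real V" if zS: "z \<in> ?S" for z
  proof -
    obtain w m w' m' where z: "z = (w @ [m], w' @ [m'])" "w \<in> level j" "w' \<in> level j"
      "m \<in> {1..M}" "m' \<in> {1..M}" "(w, m) \<noteq> (w', m')"
    proof -
      obtain u u' where z: "z = (u, u')" "u \<in> ?W" "u' \<in> ?W" "u \<noteq> u'"
        using zS by blast
      obtain w m where w: "u = w @ [m]" "w \<in> level j" "m \<in> {1..M}"
        using z(2) by (rule level_SucE)
      obtain w' m' where w': "u' = w' @ [m']" "w' \<in> level j" "m' \<in> {1..M}"
        using z(3) by (rule level_SucE)
      show thesis
        using z(1,4) w w' by (intro that[of w m w' m']) auto
    qed
    \<comment> \<open>Distinct children have distinct parents, hence distinct buffers by injectivity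
      of \<open>v\<close>, or the same parent and distinct last letters.\<close>
    have ne: "(v w, m) \<noteq> (v w', m')"
      using z v(1) by (auto dest: inj_onD)
    have "v w \<in> {1..V}" "v w' \<in> {1..V}" using z v(2) by auto
    from prob_collision[OF V this z(4,5) ne] show ?thesis
      by (simp add: z(1) child_buffer_def)
  qed
  have "measure_pmf.prob (index_pmf V) {a. \<not> inj_on (child_buffer v a) ?W}
      \<le> measure_pmf.prob (index_pmf V) (\<Union>z\<in>?S. ?E z)"
    by (rule measure_pmf.finite_measure_mono) (auto simp: inj_on_def)
  also have "\<dots> \<le> (\<Sum>z\<in>?S. measure_pmf.prob (index_pmf V) (?E z))"
    using S by (rule measure_pmf.finite_measure_subadditive_finite) simp
  also have "\<dots> \<le> (\<Sum>z\<in>?S. 1 / real V)"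
    by (rule sum_mono[OF le])
  also have "\<dots> = real (card ?S) * (1 / real V)" by simp
  also have "\<dots> \<le> real (card (?W \<times> ?W)) * (1 / real V)"
    by (intro mult_right_mono of_nat_mono card_mono) auto
  also have "\<dots> = real (M ^ Suc j * M ^ Suc j) / real V"
    unfolding card_cartesian_product card_level by simp
  finally show ?thesis .
qed

text \<open>Distinct buffers carry independent letters with law \<open>P\<close>, so their joint law
  is that of the letters of a code tree at level \<open>j\<close>. This rewrites the sum over
  letters in \<open>integral_level_step\<close> as an average over the index.\<close>

lemma expectation_letters:
  assumes V: "1 \<le> V" and v: "inj_on v (level j)" "v ` level j \<subseteq> {1..V}"
  shows "(\<Sum>n\<in>level j \<rightarrow>\<^sub>E {1..N}. (\<Prod>w\<in>level j. P (n w)) * B n) =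
    (\<Sum>a\<in>V_indices M N V. pmf (index_pmf V) a * B (\<lambda>w\<in>level j. fst (a (v w))))"
proof -
  let ?I = "level j \<rightarrow>\<^sub>E {1..N}"
  let ?A = "V_indices M N V"
  let ?n = "\<lambda>a :: V_index. \<lambda>w\<in>level j. fst (a (v w))"
  have finI: "finite ?I" by (intro finite_PiE) auto
  have n_mem: "?n a \<in> ?I" if "a \<in> ?A" for a
    using V_indices_mem(1)[OF that] v(2) by auto
  have prob: "(\<Prod>w\<in>level j. P (n w)) = (\<Sum>a\<in>?A. if ?n a = n then pmf (index_pmf V) a else 0)"
    if n: "n \<in> ?I" for n
  proof -
    define word where "word = inv_into (level j) v"
    have word: "word (v w) = w" if "w \<in> level j" for w
      unfolding word_def using v(1) that by (rule inv_into_f_f)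
    let ?E = "\<lambda>x. {z :: nat \<times> (nat \<Rightarrow> nat). x \<in> v ` level j \<longrightarrow> fst z = n (word x)}"
    let ?q = "pair_pmf letter_pmf (row_pmf V)"
    have "(\<Sum>a\<in>?A. if ?n a = n then pmf (index_pmf V) a else 0)
        = (\<Sum>a\<in>?A. (if ?n a = n then 1 else 0) * pmf (index_pmf V) a)"
      by (intro sum.cong) auto
    also have "\<dots> = (\<integral>a. (if ?n a = n then 1 else 0) \<partial>index_pmf V)"
      using set_index_pmf[OF V] finite_V_indices by (intro integral_measure_pmf_real[symmetric]) auto
    also have "\<dots> = (\<integral>a. indicat_real (Pi {1..V} ?E) a \<partial>index_pmf V)"
    proof (intro integral_cong_AE AE_pmfI)
      fix a
      have "?n a = n \<longleftrightarrow> (\<forall>w\<in>level j. fst (a (v w)) = n w)"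
        using n by (auto simp: fun_eq_iff PiE_iff extensional_def)
      also have "\<dots> \<longleftrightarrow> a \<in> Pi {1..V} ?E"
        using v(2) word by (auto simp: Pi_iff)
      finally show "(if ?n a = n then 1 else 0) = indicat_real (Pi {1..V} ?E) a"
        by (simp add: indicator_def)
    qed auto
    also have "\<dots> = measure_pmf.prob (index_pmf V) (Pi {1..V} ?E)" by simp
    also have "\<dots> = (\<Prod>x\<in>{1..V}. measure_pmf.prob ?q (?E x))"
      unfolding index_pmf_def by (rule measure_Pi_pmf_Pi) simp
    also have "\<dots> = (\<Prod>x\<in>v ` level j. measure_pmf.prob ?q (?E x))"
      using v(2) by (intro prod.mono_neutral_right) auto
    also have "\<dots> = (\<Prod>w\<in>level j. measure_pmf.prob ?q (?E (v w)))"
      by (subst prod.reindex[OF v(1)]) simp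
    also have "\<dots> = (\<Prod>w\<in>level j. P (n w))"
    proof (rule prod.cong)
      fix w assume w: "w \<in> level j"
      have "measure_pmf.prob ?q (?E (v w)) = measure_pmf.prob (map_pmf fst ?q) {n w}"
        using w word by (simp add: vimage_def)
      also have "\<dots> = pmf letter_pmf (n w)"
        by (simp add: map_fst_pair_pmf measure_pmf_single)
      also have "\<dots> = P (n w)"
        using n w by (auto simp: pmf_letter PiE_iff)
      finally show "measure_pmf.prob ?q (?E (v w)) = P (n w)" .
    qed simp
    finally show ?thesis by simp
  qed
  have "(\<Sum>n\<in>?I. (\<Prod>w\<in>level j. P (n w)) * B n)
      = (\<Sum>n\<in>?I. \<Sum>a\<in>?A. if n = ?n a then pmf (index_pmf V) a * B n else 0)"
    unfolding sum_distrib_right[symmetric]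
    by (intro sum.cong refl) (auto simp: prob sum_distrib_right intro!: sum.cong)
  also have "\<dots> = (\<Sum>a\<in>?A. \<Sum>n\<in>?I. if n = ?n a then pmf (index_pmf V) a * B n else 0)"
    by (rule sum.swap)
  also have "\<dots> = (\<Sum>a\<in>?A. pmf (index_pmf V) a * B (?n a))"
    using n_mem finI by (intro sum.cong refl) (simp add: sum.delta)
  finally show ?thesis .
qed

end

section \<open>Comparison of the buffer law with the law of the code trees\<close>

context superIFS_prob
begin

definition buffer_law :: "nat \<Rightarrow> (nat \<Rightarrow> 'a set) measure" where
  "buffer_law V = V_distribution X M N f V (pmf (index_pmf V))"

lemma contractive_IFS_prob_V:
  assumes V: "1 \<le> V"
  shows "contractive_IFS_prob (power_metric V (hyper X)) (V_indices M N V) (V_map M f V) l (pmf (index_pmf V))"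
proof -
  interpret contractive_IFS "power_metric V (hyper X)" "V_indices M N V" "V_map M f V" l
    by (rule contractive_IFS_V[OF V])
  show ?thesis
    using sum_pmf_eq_1[OF finite_V_indices set_index_pmf[OF V]] by unfold_locales auto
qed

lemma buffer_law_prob:
  assumes "1 \<le> V" shows "buffer_law V \<in> borel_probs (power_metric V (hyper X))"
proof -
  interpret contractive_IFS_prob "power_metric V (hyper X)" "V_indices M N V" "V_map M f V" l "pmf (index_pmf V)"
    by (rule contractive_IFS_prob_V[OF assms])
  show ?thesis
    using invariant_measure_attractor by (simp add: invariant_def buffer_law_def V_distribution_def)
qed

lemma buffer_law_integral:
  fixes h :: "(nat \<Rightarrow> 'a set) \<Rightarrow> real"
  assumes "1 \<le> V" "lipschitz_map L (power_metric V (hyper X)) euclidean_metric h"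
  shows "(\<integral>K. h K \<partial>buffer_law V) =
    (\<Sum>a\<in>V_indices M N V. pmf (index_pmf V) a * (\<integral>K. h (V_map M f V a K) \<partial>buffer_law V))"
proof -
  interpret contractive_IFS_prob "power_metric V (hyper X)" "V_indices M N V" "V_map M f V" l "pmf (index_pmf V)"
    by (rule contractive_IFS_prob_V[OF assms(1)])
  show ?thesis
    using invariant_integral[OF invariant_measure_attractor assms(2)]
    by (simp add: buffer_law_def V_distribution_def)
qed

lemma compact_buffers: "compact_space (mtopology_of (power_metric V (hyper X)))"
  by (rule compact_space_power_metric[OF compact_space_hyper[OF cpt]])

lemma integrable_buffer_law:
  fixes h :: "(nat \<Rightarrow> 'a set) \<Rightarrow> real"
  assumes "1 \<le> V" "lipschitz_map L (power_metric V (hyper X)) euclidean_metric h"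
  shows "integrable (buffer_law V) h"
  by (rule lipschitz_map_integrable[OF compact_buffers assms(2) buffer_law_prob[OF assms(1)]])

lemma space_buffer_law:
  "1 \<le> V \<Longrightarrow> space (buffer_law V) = ({1..V} \<rightarrow>\<^sub>E hyperspace X)"
  using borel_probsD(3)[OF buffer_law_prob] by (simp add: mspace_power_metric mspace_hyper)

text \<open>A crude bound that asks no injectivity of \<open>u\<close>: it starts the induction and
  covers the indices for which children collide.\<close>

lemma integral_level_diff_le:
  assumes V: "1 \<le> V" and u: "u ` level j \<subseteq> {1..V}" and L: "0 \<le> L" and g: "level_lipschitz j L g"
  shows "\<bar>(\<integral>K. g (\<lambda>w. K (u w)) \<partial>buffer_law V) - (\<integral>\<sigma>. g (\<lambda>w. fractal (subtree \<sigma> w)) \<partial>\<rho>)\<bar> \<le> L * D"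
proof (rule integral_diff_le_const)
  show "prob_space (buffer_law V)"
    by (rule borel_probsD[OF buffer_law_prob[OF V]])
  show "integrable (buffer_law V) (\<lambda>K. g (\<lambda>w. K (u w)))"
    by (rule integrable_buffer_law[OF V lipschitz_map_level[OF g u]])
  show "integrable \<rho> (\<lambda>\<sigma>. g (\<lambda>w. fractal (subtree \<sigma> w)))"
    by (rule code_map_integrable[OF code_map_level[OF g L]])
  fix K \<sigma> assume K: "K \<in> space (buffer_law V)" and \<sigma>: "\<sigma> \<in> space \<rho>"
  then have \<sigma>: "\<sigma> \<in> code_trees M N" and K: "K \<in> {1..V} \<rightarrow>\<^sub>E hyperspace X"
    by (simp_all add: space_code_tree_measure space_buffer_law[OF V])
  have K': "K (u w) \<in> hyperspace X" if "w \<in> level j" for w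
    using K u that by auto
  show "\<bar>g (\<lambda>w. K (u w)) - g (\<lambda>w. fractal (subtree \<sigma> w))\<bar> \<le> L * D"
    using K' subtree_fractal_hyperspace[OF \<sigma>]
    by (intro level_lipschitzD[OF g] hausdorff_dist_le_D) auto
qed unfold_locales

lemma level_V_map:
  assumes g: "level_lipschitz j L g" and v: "v ` level j \<subseteq> {1..V}"
    and a: "a \<in> V_indices M N V" and K: "K \<in> {1..V} \<rightarrow>\<^sub>E hyperspace X"
  shows "g (\<lambda>w. V_map M f V a K (v w)) =
    branch_fun g (\<lambda>w\<in>level j. fst (a (v w))) (\<lambda>w. K (child_buffer v a w))"
  unfolding branch_fun_def
proof (rule level_lipschitz_cong[OF g])
  fix w assume w: "w \<in> level j"
  then have vw: "v w \<in> {1..V}" using v by blast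
  show "V_map M f V a K (v w) \<in> hyperspace X"
    using V_map_mem[OF a K] vw by auto
  show "V_map M f V a K (v w) =
      branch ((\<lambda>w\<in>level j. fst (a (v w))) w) (\<lambda>m. K (child_buffer v a (w @ [m])))"
    using w by (simp add: V_map_apply[OF vw] child_buffer_def)
qed

lemma child_buffer_image:
  assumes "a \<in> V_indices M N V" "v ` level j \<subseteq> {1..V}"
  shows "child_buffer v a ` level (Suc j) \<subseteq> {1..V}"
proof (rule image_subsetI)
  fix u assume "u \<in> level (Suc j)"
  then obtain w m where "u = w @ [m]" "w \<in> level j" "m \<in> {1..M}"
    by (rule level_SucE)
  then show "child_buffer v a u \<in> {1..V}"
    using V_indices_mem(2)[OF assms(1), of "v w" m] assms(2) by (simp add: child_buffer_def image_subset_iff)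
qed

text \<open>
  One step of the recursion contracts by \<open>l\<close>, and costs the probability that the words of length
  \<open>Suc j\<close> do not end up in distinct buffers.
\<close>

lemma level_integral_step:
  assumes V: "1 \<le> V" and v: "inj_on v (level j)" "v ` level j \<subseteq> {1..V}"
    and L: "0 \<le> L" and g: "level_lipschitz j L g"
    and IH: "\<And>u g. inj_on u (level (Suc j)) \<Longrightarrow> u ` level (Suc j) \<subseteq> {1..V} \<Longrightarrow>
      level_lipschitz (Suc j) (L * l) g \<Longrightarrow>
      \<bar>(\<integral>K. g (\<lambda>w. K (u w)) \<partial>buffer_law V) - (\<integral>\<sigma>. g (\<lambda>w. fractal (subtree \<sigma> w)) \<partial>\<rho>)\<bar> \<le> L * l * c"
    and c: "0 \<le> c"
  shows "\<bar>(\<integral>K. g (\<lambda>w. K (v w)) \<partial>buffer_law V) - (\<integral>\<sigma>. g (\<lambda>w. fractal (subtree \<sigma> w)) \<partial>\<rho>)\<bar>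
    \<le> L * (l * c + D * real (M ^ Suc j * M ^ Suc j) / real V)"
proof -
  let ?A = "V_indices M N V"
  let ?n = "\<lambda>a :: V_index. \<lambda>w\<in>level j. fst (a (v w))"
  let ?p = "pmf (index_pmf V)"
  define bad where "bad = {a. \<not> inj_on (child_buffer v a) (level (Suc j))}"
  define mu where "mu a = (\<integral>K. branch_fun g (?n a) (\<lambda>w. K (child_buffer v a w)) \<partial>buffer_law V)" for a
  define nu where "nu n = (\<integral>\<sigma>. branch_fun g n (\<lambda>w. fractal (subtree \<sigma> w)) \<partial>\<rho>)" for n
  have lhs: "(\<integral>K. g (\<lambda>w. K (v w)) \<partial>buffer_law V) = (\<Sum>a\<in>?A. ?p a * mu a)"
    unfolding buffer_law_integral[OF V lipschitz_map_level[OF g v(2)]] mu_def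
  proof (intro sum.cong refl arg_cong2[where f = "(*)"] Bochner_Integration.integral_cong)
    fix a K assume "a \<in> ?A" "K \<in> space (buffer_law V)"
    then show "g (\<lambda>w. V_map M f V a K (v w)) = branch_fun g (?n a) (\<lambda>w. K (child_buffer v a w))"
      by (intro level_V_map[OF g v(2)]) (simp_all add: space_buffer_law[OF V])
  qed
  \<comment> \<open>The code-tree integral becomes an average over the same index \<open>a\<close>
    as the buffer integral, with the same letters \<open>?n a\<close>, so only the sets at the
    children remain to be compared.\<close>
  have rhs: "(\<integral>\<sigma>. g (\<lambda>w. fractal (subtree \<sigma> w)) \<partial>\<rho>) = (\<Sum>a\<in>?A. ?p a * nu (?n a))"
    unfolding integral_level_step[OF g L] nu_def by (rule expectation_letters[OF V v])
  have diff: "\<bar>mu a - nu (?n a)\<bar> \<le> L * l * c + (if a \<in> bad then L * D else 0)" if a: "a \<in> ?A" for a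
  proof -
    have lipg: "level_lipschitz (Suc j) (L * l) (branch_fun g (?n a))"
      using V_indices_mem(1)[OF a] v(2) by (intro level_lipschitz_branch_fun[OF g]) auto
    have img: "child_buffer v a ` level (Suc j) \<subseteq> {1..V}"
      by (rule child_buffer_image[OF a v(2)])
    show ?thesis
    \<comment> \<open>A collision leaves only the bound by \<open>D\<close>, its factor
      \<open>l\<close> being dropped; otherwise \<open>child_buffer v a\<close> is an admissible
      placement of level \<open>Suc j\<close> and \<open>IH\<close> applies.\<close>
    proof (cases "a \<in> bad")
      case True
      have "\<bar>mu a - nu (?n a)\<bar> \<le> (L * l) * D"
        unfolding mu_def nu_def using L l by (intro integral_level_diff_le[OF V img _ lipg]) simp
      also have "\<dots> \<le> L * D"
        using L l D_nonneg by (intro mult_right_mono) (auto intro: mult_left_le)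
      also have "\<dots> \<le> L * l * c + L * D"
        using L l c by simp
      finally show ?thesis using True by simp
    next
      case False
      then have "\<bar>mu a - nu (?n a)\<bar> \<le> L * l * c"
        unfolding mu_def nu_def by (intro IH img lipg) (simp add: bad_def)
      then show ?thesis using False by simp
    qed
  qed
  have sum_p: "(\<Sum>a\<in>?A. ?p a) = 1"
    by (rule sum_pmf_eq_1[OF finite_V_indices set_index_pmf[OF V]])
  have "(\<Sum>a\<in>?A. ?p a * (if a \<in> bad then 1 else 0)) = (\<Sum>a\<in>?A. indicat_real bad a * ?p a)"
    by (intro sum.cong) auto
  also have "\<dots> = (\<integral>a. indicat_real bad a \<partial>index_pmf V)"
    using set_index_pmf[OF V] finite_V_indices by (intro integral_measure_pmf_real[symmetric]) auto
  also have "\<dots> \<le> real (M ^ Suc j * M ^ Suc j) / real V"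
    using prob_child_buffer_not_inj[OF V v] by (simp add: bad_def)
  finally have bad: "(\<Sum>a\<in>?A. ?p a * (if a \<in> bad then 1 else 0)) \<le> real (M ^ Suc j * M ^ Suc j) / real V" .
  have "\<bar>(\<Sum>a\<in>?A. ?p a * mu a) - (\<Sum>a\<in>?A. ?p a * nu (?n a))\<bar> \<le> (\<Sum>a\<in>?A. \<bar>?p a * (mu a - nu (?n a))\<bar>)"
    unfolding sum_subtractf[symmetric] right_diff_distrib[symmetric] by (rule sum_abs)
  also have "\<dots> \<le> (\<Sum>a\<in>?A. ?p a * (L * l * c) + L * D * (?p a * (if a \<in> bad then 1 else 0)))"
  proof (rule sum_mono)
    fix a assume a: "a \<in> ?A"
    have "\<bar>?p a * (mu a - nu (?n a))\<bar> = ?p a * \<bar>mu a - nu (?n a)\<bar>"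
      by (simp add: abs_mult)
    also have "\<dots> \<le> ?p a * (L * l * c + (if a \<in> bad then L * D else 0))"
      using diff[OF a] by (intro mult_left_mono) auto
    finally show "\<bar>?p a * (mu a - nu (?n a))\<bar> \<le> ?p a * (L * l * c) + L * D * (?p a * (if a \<in> bad then 1 else 0))"
      by (simp add: algebra_simps split: if_splits)
  qed
  also have "\<dots> = L * l * c + L * D * (\<Sum>a\<in>?A. ?p a * (if a \<in> bad then 1 else 0))"
    by (simp only: sum.distrib sum_distrib_left[symmetric] sum_distrib_right[symmetric] sum_p mult_1)
  also have "\<dots> \<le> L * l * c + L * D * (real (M ^ Suc j * M ^ Suc j) / real V)"
    using bad L D_nonneg by (intro add_left_mono mult_left_mono) auto
  finally show ?thesis
    unfolding lhs rhs by (simp add: algebra_simps)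
qed

text \<open>\<open>C\<close> is fixed ahead of \<open>V\<close>, \<open>v\<close>, \<open>L\<close>
  and \<open>g\<close>. Uniformity in \<open>V\<close> is what the limit needs; scaling with
  \<open>L\<close> lets the induction pass to a test function with constant
  \<open>L * l\<close>.\<close>

definition level_estimate :: "nat \<Rightarrow> nat \<Rightarrow> real \<Rightarrow> bool" where
  "level_estimate j k C \<longleftrightarrow> (\<forall>V v L g. 1 \<le> V \<longrightarrow> inj_on v (level j) \<longrightarrow> v ` level j \<subseteq> {1..V} \<longrightarrow>
    0 \<le> L \<longrightarrow> level_lipschitz j L g \<longrightarrow>
    \<bar>(\<integral>K. g (\<lambda>w. K (v w)) \<partial>buffer_law V) - (\<integral>\<sigma>. g (\<lambda>w. fractal (subtree \<sigma> w)) \<partial>\<rho>)\<bar>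
      \<le> L * (l ^ k * D + C / real V))"

lemma level_estimateD:
  assumes "level_estimate j k C" "1 \<le> V" "inj_on v (level j)" "v ` level j \<subseteq> {1..V}"
    "0 \<le> L" "level_lipschitz j L g"
  shows "\<bar>(\<integral>K. g (\<lambda>w. K (v w)) \<partial>buffer_law V) - (\<integral>\<sigma>. g (\<lambda>w. fractal (subtree \<sigma> w)) \<partial>\<rho>)\<bar>
      \<le> L * (l ^ k * D + C / real V)"
  using assms unfolding level_estimate_def by simp

lemma level_estimate: "\<exists>C\<ge>0. level_estimate j k C"
proof (induction k arbitrary: j)
  case 0
  show ?case
    using integral_level_diff_le by (intro exI[of _ 0]) (simp add: level_estimate_def)
next
  case (Suc k)
  obtain C where C: "0 \<le> C" and est: "level_estimate (Suc j) k C"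
    using Suc.IH by blast
  \<comment> \<open>The recursion for the constant: the error of level \<open>Suc j\<close>
    contracted by \<open>l\<close>, plus the collision cost of the present step. It starts from
    \<open>0\<close> at \<open>k = 0\<close>.\<close>
  let ?C = "l * C + D * real (M ^ Suc j * M ^ Suc j)"
  have "level_estimate j (Suc k) ?C"
    unfolding level_estimate_def
  proof (intro allI impI)
    fix V :: nat and v L g
    assume V: "1 \<le> V" and v: "inj_on v (level j)" "v ` level j \<subseteq> {1..V}"
      and L: "0 \<le> L" and g: "level_lipschitz j L g"
    have "\<bar>(\<integral>K. g (\<lambda>w. K (v w)) \<partial>buffer_law V) - (\<integral>\<sigma>. g (\<lambda>w. fractal (subtree \<sigma> w)) \<partial>\<rho>)\<bar>
        \<le> L * (l * (l ^ k * D + C / real V) + D * real (M ^ Suc j * M ^ Suc j) / real V)"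
      using C L l D_nonneg by (intro level_integral_step[OF V v L g] level_estimateD[OF est V]) auto
    also have "l * (l ^ k * D + C / real V) + D * real (M ^ Suc j * M ^ Suc j) / real V
        = l ^ Suc k * D + ?C / real V"
      by (simp only: power_Suc distrib_left add_divide_distrib times_divide_eq_right mult.assoc add.assoc)
    finally show "\<bar>(\<integral>K. g (\<lambda>w. K (v w)) \<partial>buffer_law V) - (\<integral>\<sigma>. g (\<lambda>w. fractal (subtree \<sigma> w)) \<partial>\<rho>)\<bar>
        \<le> L * (l ^ Suc k * D + ?C / real V)" .
  qed
  moreover have "0 \<le> ?C"
    using C l D_nonneg by simp
  ultimately show ?case by blast
qed

lemma fractal_distribution_prob: "fractal_distribution X M N f P \<in> borel_probs (hyper X)"
proof -
  have "fractal \<in> \<rho> \<rightarrow>\<^sub>M metric_borel (hyper X)"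
    unfolding code_tree_measure_def
    by (rule code_map_measurable[OF code_map_fractal countable_words]) simp
  from \<rho>.prob_space_distr[OF this] show ?thesis
    by (simp add: borel_probs_def fractal_distribution_def)
qed

lemma first_component_measurable:
  assumes "1 \<le> V"
  shows "(\<lambda>K. K 1) \<in> buffer_law V \<rightarrow>\<^sub>M metric_borel (hyper X)"
  using continuous_map_borel_measurable[OF lipschitz_map_imp_continuous[OF lipschitz_first_component[OF assms]]]
    measurable_cong_sets[OF borel_probsD(2)[OF buffer_law_prob[OF assms]] refl] by blast

lemma V_fractal_distribution_prob:
  assumes "1 \<le> V"
  shows "V_fractal_distribution X M N f V (pmf (index_pmf V)) \<in> borel_probs (hyper X)"
  using prob_space.prob_space_distr[OF borel_probsD(1)[OF buffer_law_prob[OF assms]]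
      first_component_measurable[OF assms]]
  by (simp add: borel_probs_def V_fractal_distribution_def buffer_law_def)

lemma mk_dist_V_fractal_distribution:
  "\<exists>C\<ge>0. \<forall>V\<ge>1. mk_dist (hyper X) (V_fractal_distribution X M N f V (pmf (index_pmf V)))
      (fractal_distribution X M N f P) \<le> l ^ k * D + C / real V"
proof -
  obtain C where C: "0 \<le> C" and est: "level_estimate 0 k C"
    using level_estimate by blast
  have "mk_dist (hyper X) (V_fractal_distribution X M N f V (pmf (index_pmf V)))
      (fractal_distribution X M N f P) \<le> l ^ k * D + C / real V" if V: "1 \<le> V" for V
  proof (rule mk_dist_le[OF compact_space_hyper[OF cpt] V_fractal_distribution_prob[OF V] fractal_distribution_prob])
    fix h :: "'a set \<Rightarrow> real" assume h: "lipschitz_map 1 (hyper X) euclidean_metric h"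
    have h_meas: "h \<in> borel_measurable (metric_borel (hyper X))"
      by (rule lipschitz_map_borel_measurable[OF h])
    \<comment> \<open>The case \<open>j = 0\<close>: level \<open>0\<close> consists of the empty
      word, placed into buffer \<open>1\<close>, and its subtree is the whole code tree.\<close>
    have g: "level_lipschitz 0 1 (\<lambda>x. h (x []))"
      unfolding level_lipschitz_def
    proof (intro allI impI)
      fix x y r
      assume "\<forall>w\<in>level 0. x w \<in> hyperspace X \<and> y w \<in> hyperspace X \<and> hausdorff_dist X (x w) (y w) \<le> r"
      then have xy: "x [] \<in> hyperspace X" "y [] \<in> hyperspace X" "hausdorff_dist X (x []) (y []) \<le> r"
        by auto
      have "\<bar>h (x []) - h (y [])\<bar> \<le> 1 * hausdorff_dist X (x []) (y [])"
        using h xy by (auto simp: lipschitz_map_def mspace_hyper mdist_hyper dist_real_def)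
      with xy(3) show "\<bar>h (x []) - h (y [])\<bar> \<le> 1 * r" by simp
    qed
    have "(\<integral>A. h A \<partial>V_fractal_distribution X M N f V (pmf (index_pmf V))) = (\<integral>K. h (K 1) \<partial>buffer_law V)"
      unfolding V_fractal_distribution_def buffer_law_def[symmetric]
      by (rule integral_distr[OF first_component_measurable[OF V] h_meas])
    moreover have "(\<integral>A. h A \<partial>fractal_distribution X M N f P) = (\<integral>\<sigma>. h (fractal (subtree \<sigma> [])) \<partial>\<rho>)"
    proof -
      have "fractal \<in> \<rho> \<rightarrow>\<^sub>M metric_borel (hyper X)"
        unfolding code_tree_measure_def
        by (rule code_map_measurable[OF code_map_fractal countable_words]) simp
      from integral_distr[OF this h_meas]
      have "(\<integral>A. h A \<partial>fractal_distribution X M N f P) = (\<integral>\<sigma>. h (fractal \<sigma>) \<partial>\<rho>)"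
        by (simp add: fractal_distribution_def)
      also have "\<dots> = (\<integral>\<sigma>. h (fractal (subtree \<sigma> [])) \<partial>\<rho>)"
        by (intro Bochner_Integration.integral_cong) (auto simp: space_code_tree_measure subtree_Nil)
      finally show ?thesis .
    qed
    ultimately show "(\<integral>A. h A \<partial>V_fractal_distribution X M N f V (pmf (index_pmf V)))
        - (\<integral>A. h A \<partial>fractal_distribution X M N f P) \<le> l ^ k * D + C / real V"
      using level_estimateD[OF est V _ _ _ g, of "\<lambda>_. 1"] V by (simp add: abs_le_iff)
  qed
  with C show ?thesis by blast
qed

lemma limitin_V_fractal_distribution:
  "limitin (mtopology_of (prob_metric (hyper X)))
    (\<lambda>V. V_fractal_distribution X M N f V (pmf (index_pmf V))) (fractal_distribution X M N f P) sequentially"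
proof -
  interpret MK: Metric_space "borel_probs (hyper X)" "mk_dist (hyper X)"
    by (rule Metric_space_prob[OF compact_space_hyper[OF cpt]])
  let ?d = "\<lambda>V. mk_dist (hyper X) (V_fractal_distribution X M N f V (pmf (index_pmf V)))
      (fractal_distribution X M N f P)"
  have "limitin MK.mtopology (\<lambda>V. V_fractal_distribution X M N f V (pmf (index_pmf V)))
      (fractal_distribution X M N f P) sequentially"
    unfolding MK.limit_metric_sequentially
  proof (intro conjI allI impI fractal_distribution_prob)
    fix e :: real assume e: "0 < e"
    \<comment> \<open>\<open>k\<close> makes the contraction term less than \<open>e / 2\<close>;
      only then is \<open>C\<close> determined, and \<open>V\<close> beyond \<open>2 * C / e\<close>
      takes care of the collision term.\<close>
    then have "0 < e / 2" by simp
    then obtain k where k: "l ^ k * D < e / 2" by (rule power_D_less)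
    obtain C where C: "0 \<le> C" "\<And>V. 1 \<le> V \<Longrightarrow> ?d V \<le> l ^ k * D + C / real V"
      using mk_dist_V_fractal_distribution[of k] by blast
    obtain n where n: "2 * C / e < real n"
      using reals_Archimedean2 by blast
    have "?d V < e" if V: "V \<ge> max 1 n" for V
    proof -
      have "2 * C / e < real V" using n V by simp
      then have "C / real V < e / 2"
        using e V by (simp add: field_simps)
      moreover have "1 \<le> V" using V by simp
      ultimately show ?thesis using C(2)[of V] k by linarith
    qed
    then show "\<exists>n. \<forall>V\<ge>n. V_fractal_distribution X M N f V (pmf (index_pmf V)) \<in> borel_probs (hyper X) \<and> ?d V < e"
      using V_fractal_distribution_prob by (intro exI[of _ "max 1 n"]) auto
  qed
  then show ?thesis by (simp add: prob_metric_def)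
qed

end

text \<open>The invariance equation sees the probabilities only at indices in
  \<open>V_indices M N V\<close>, which is where \<open>PP V\<close> and
  \<open>pmf (index_pmf V)\<close> are known to agree.\<close>

lemma V_fractal_distribution_cong:
  assumes "\<And>a. a \<in> V_indices M N V \<Longrightarrow> p a = q a"
  shows "V_fractal_distribution X M N f V p = V_fractal_distribution X M N f V q"
  unfolding V_fractal_distribution_def V_distribution_def measure_attractor_def
  using assms by (simp cong: sum.cong)

theorem theorem19:
  fixes X :: "'a metric"
    and M N :: nat
    and l :: real
    and f :: "nat \<Rightarrow> nat \<Rightarrow> 'a \<Rightarrow> 'a"
    and P :: "nat \<Rightarrow> real"
    and PP :: "nat \<Rightarrow> V_index \<Rightarrow> real"
  assumes "compact_space (mtopology_of X)" and "mspace X \<noteq> {}"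
    and "1 \<le> M" and "1 \<le> N"
    and "0 \<le> l" and "l < 1"
    and "\<And>m n. m \<in> {1..M} \<Longrightarrow> n \<in> {1..N} \<Longrightarrow> lipschitz_map l X X (f m n)"
    and "\<And>n. n \<in> {1..N} \<Longrightarrow> 0 < P n" and "(\<Sum>n\<in>{1..N}. P n) = 1"
    and "\<And>V a. 1 \<le> V \<Longrightarrow> a \<in> V_indices M N V \<Longrightarrow> 0 \<le> PP V a"
    and "\<And>V. 1 \<le> V \<Longrightarrow> (\<Sum>a\<in>V_indices M N V. PP V a) = 1"
  shows "limitin (mtopology_of (hyper (hyper X)))
           (\<lambda>V. V_fractal_sets X M N f V) (fractal_sets X M N f) sequentially
       \<and> ((\<forall>V\<ge>1. \<forall>a\<in>V_indices M N V.
              PP V a = (\<Prod>v\<in>{1..V}. P (fst (a v))) / real V ^ (M * V))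
          \<longrightarrow> limitin (mtopology_of (prob_metric (hyper X)))
                (\<lambda>V. V_fractal_distribution X M N f V (PP V))
                (fractal_distribution X M N f P) sequentially)"
proof (intro conjI impI)
  interpret superIFS_prob X M N l f P
    using assms(1-9) by unfold_locales auto
  show "limitin (mtopology_of (hyper (hyper X))) (\<lambda>V. V_fractal_sets X M N f V)
      (fractal_sets X M N f) sequentially"
    by (rule limitin_V_fractal_sets)
  assume PP: "\<forall>V\<ge>1. \<forall>a\<in>V_indices M N V. PP V a = (\<Prod>v\<in>{1..V}. P (fst (a v))) / real V ^ (M * V)"
  \<comment> \<open>The two sequences agree from \<open>V = 1\<close> on; the value at
    \<open>V = 0\<close> does not affect the limit.\<close>
  have "eventually (\<lambda>V. V_fractal_distribution X M N f V (PP V) =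
      V_fractal_distribution X M N f V (pmf (index_pmf V))) sequentially"
    unfolding eventually_sequentially
    by (intro exI[of _ 1] allI impI V_fractal_distribution_cong) (simp add: PP pmf_index)
  then show "limitin (mtopology_of (prob_metric (hyper X))) (\<lambda>V. V_fractal_distribution X M N f V (PP V))
      (fractal_distribution X M N f P) sequentially"
    by (intro limitin_transform_eventually[OF _ limitin_V_fractal_distribution])
      (auto elim: eventually_mono)
qed

end
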